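(* Let $\mathcal{K}$ be a field, $\Gamma\leq\mathbb{R}$ an additive subgroup, $\Lambda=\Lambda^{\mathcal{K},\Gamma}$, and let $(C_1\xrightarrow{\partial}C_0)$ be a two-term Floer-type complex over $\Lambda$. For each positive integer $k$ the $k$th torsion exponent of $(C_1\xrightarrow{\partial}C_0)$ is equal to the generalized boundary depth $\beta_k(\partial)$.
   Context: **Novikov field.** $\Lambda=\Lambda^{\mathcal{K},\Gamma}$ is the field of formal sums $\sum_{g\in\Gamma}a_gT^g$ with $a_g\in\mathcal{K}$ such that for every $C\in\mathbb{R}$ only finitely many $g<C$ have $a_g\neq 0$, with power-series addition and multiplication. Its valuation is $\nu(\sum a_gT^g)=\min\{g\mid a_g\neq 0\}$, $\nu(0)=\infty$. **Orthogonalizable spaces.** A non-Archimedean normed vector space over $\Lambda$ is a pair $(C,\ell)$ with $C$ a $\Lambda$-vector space and $\ell\colon C\to\mathbb{R}\cup\{-\infty\}$ satisfying: $\ell(x)=-\infty$ iff $x=0$; $\ell(\lambda x)=\ell(x)-\nu(\lambda)$; $\ell(x+y)\leq\max\{\ell(x),\ell(y)\}$. A finite ordered collection $(w_1,\dots,w_r)$ in $C$ is orthogonal if $\ell(\sum_i\lambda_iw_i)=\max_i\ell(\lambda_iw_i)$ for all $\lambda_i\in\Lambda$. An orthogonalizable $\Lambda$-space is a finite-dimensional non-Archimedean normed vector space admitting an orthogonal basis. **Two-term Floer-type complex.** $(C_1\xrightarrow{\partial}C_0)$ consists of orthogonalizable $\Lambda$-spaces $C_1,C_0$ (both filtration functions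 denoted $\ell$) and a $\Lambda$-linear map $\partial\colon C_1\to C_0$ with $\ell(\partial x)\leq\ell(x)$ for all $x\in C_1$. **Generalized boundary depth.** For $\delta\in\mathbb{R}$, $x\in C_0$ is $\delta$-robust if every $y\in C_1$ with $\partial y=x$ satisfies $\ell(y)>\ell(x)+\delta$. A subspace $V\leq C_0$ is $\delta$-robust if every $x\in V\setminus\{0\}$ is. For a positive integer $k$, $\beta_k(\partial)=\sup(\{0\}\cup\{\delta\geq 0\mid\text{there exists a }\delta\text{-robust subspace }V\leq\mathrm{Im}\,\partial\text{ with }\dim V=k\})$. **Torsion exponents.** Let $\Lambda^{univ}=\Lambda^{\mathcal{K},\mathbb{R}}$ (a field extension of $\Lambda$) and $\Lambda^{univ}_0=\{\lambda\in\Lambda^{univ}\mid\nu(\lambda)\geq 0\}$. For $j=0,1$ let $C'_j=C_j\otimes_\Lambda\Lambda^{univ}$ with filtration function $\ell'$ obtained by choosing an orthogonal ordered basis $(w_1,\dots,w_a)$ of $C_j$ and setting $\ell'(\sum_i\lambda'_i\,w_i\otimes 1)=\max_i(\ell(w_i)-\nu(\lambda'_i))$ for $\lambda'_i\in\Lambda^{univ}$ (this is independent of the basis chosen). Let $\bar C'_j=\{c\in C'_j\mid\ell'(c)\leq 0\}$, a $\Lambda^{univ}_0$-module; $\partial\otimes 1$ maps $\bar C'_1$ to $\bar C'_0$. By a known theorem of Fukaya–Oh–Ohta–Ono, the quotient $\bar C'_0/(\partial\otimes 1)\bar C'_1$ is isomorphic as a $\Lambda^{univ}_0$-module to $$(\Lambda^{univ}_0)^q\oplus\bigoplus_{k=1}^s(\Lambda^{univ}_0/T^{\lambda_k}\Lambda^{univ}_0)$$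 for some natural numbers $q,s$ and positive real numbers $\lambda_1\geq\cdots\geq\lambda_s$ (ordered decreasingly). The $k$th torsion exponent is $\lambda_k$ if $k\leq s$ and $0$ otherwise. *)

theory Defs
  imports
    Complex_Main
    "HOL-Library.Extended_Real"
    "HOL-Algebra.Free_Abelian_Groups"
    "HOL-Algebra.QuotRing"
    "Jordan_Normal_Form.Missing_VectorSpace"
begin

subsection \<open>Novikov fields\<close>

text \<open>
  The series \<open>\<Sum>a\<^sub>g T\<^sup>g\<close> is represented by its coefficient function \<open>g \<mapsto> a\<^sub>g\<close> on all of
  \<open>\<real>\<close>. Hence the Novikov fields for all groups \<open>\<Gamma> \<subseteq> \<real>\<close> live on one type, they differ only in
  their carriers, and \<open>novikov \<Gamma>\<close> is literally a subring of \<open>novikov UNIV\<close>.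
\<close>

type_synonym 'k series = "real \<Rightarrow> 'k"

text \<open>For series in the carrier, the index set of the sum defining the product is finite.\<close>

definition novikov :: "real set \<Rightarrow> 'k::field series ring" where
  "novikov \<Gamma> =
     \<lparr>carrier = {f. {g. f g \<noteq> 0} \<subseteq> \<Gamma> \<and> (\<forall>C. finite {g. g < C \<and> f g \<noteq> 0})},
      mult = (\<lambda>f h x. \<Sum>g | f g \<noteq> 0 \<and> h (x - g) \<noteq> 0. f g * h (x - g)),
      one = (\<lambda>x. if x = 0 then 1 else 0),
      zero = (\<lambda>x. 0),
      add = (\<lambda>f h x. f x + h x)\<rparr>"

abbreviation novikov_univ :: "'k::field series ring" where
  "novikov_univ \<equiv> novikov UNIV"

definition T_power :: "real \<Rightarrow> 'k::field series" where
  "T_power a = (\<lambda>x. if x = a then 1 else 0)"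

text \<open>On the carrier the infimum is a minimum, except for \<open>\<nu> 0 = Inf {} = \<infinity>\<close>.\<close>

definition nu :: "'k::field series \<Rightarrow> ereal" where
  "nu f = (INF g \<in> {g. f g \<noteq> 0}. ereal g)"

definition novikov_univ0 :: "'k::field series ring" where
  "novikov_univ0 = novikov_univ\<lparr>carrier := {f \<in> carrier novikov_univ. nu f \<ge> 0}\<rparr>"


subsection \<open>Orthogonalizable spaces and two-term Floer-type complexes\<close>

definition nonarch_normed_space ::
    "real set \<Rightarrow> ('k::field series, 'c) module \<Rightarrow> ('c \<Rightarrow> ereal) \<Rightarrow> bool" where
  "nonarch_normed_space \<Gamma> C l \<longleftrightarrow>
     vectorspace (novikov \<Gamma>) C \<and>
     (\<forall>x\<in>carrier C. l x \<noteq> \<infinity>) \<and>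
     (\<forall>x\<in>carrier C. l x = -\<infinity> \<longleftrightarrow> x = \<zero>\<^bsub>C\<^esub>) \<and>
     (\<forall>c\<in>carrier (novikov \<Gamma>). \<forall>x\<in>carrier C. l (c \<odot>\<^bsub>C\<^esub> x) = l x - nu c) \<and>
     (\<forall>x\<in>carrier C. \<forall>y\<in>carrier C. l (x \<oplus>\<^bsub>C\<^esub> y) \<le> max (l x) (l y))"

text \<open>
  Finite maxima of filtration levels are written as suprema in \<^typ>\<open>ereal\<close>, so that the
  maximum over the empty family is \<open>-\<infinity>\<close>.
\<close>

definition orthogonal_list ::
    "real set \<Rightarrow> ('k::field series, 'c) module \<Rightarrow> ('c \<Rightarrow> ereal) \<Rightarrow> 'c list \<Rightarrow> bool" where
  "orthogonal_list \<Gamma> C l ws \<longleftrightarrow>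
     set ws \<subseteq> carrier C \<and>
     (\<forall>c \<in> {..<length ws} \<rightarrow> carrier (novikov \<Gamma>).
        l (\<Oplus>\<^bsub>C\<^esub>i\<in>{..<length ws}. c i \<odot>\<^bsub>C\<^esub> ws ! i) = (SUP i\<in>{..<length ws}. l (c i \<odot>\<^bsub>C\<^esub> ws ! i)))"

definition orthogonal_basis ::
    "real set \<Rightarrow> ('k::field series, 'c) module \<Rightarrow> ('c \<Rightarrow> ereal) \<Rightarrow> 'c list \<Rightarrow> bool" where
  "orthogonal_basis \<Gamma> C l ws \<longleftrightarrow>
     distinct ws \<and> vectorspace.basis (novikov \<Gamma>) C (set ws) \<and> orthogonal_list \<Gamma> C l ws"

definition orthogonalizable_space ::
    "real set \<Rightarrow> ('k::field series, 'c) module \<Rightarrow> ('c \<Rightarrow> ereal) \<Rightarrow> bool" where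
  "orthogonalizable_space \<Gamma> C l \<longleftrightarrow>
     nonarch_normed_space \<Gamma> C l \<and> vectorspace.fin_dim (novikov \<Gamma>) C \<and>
     (\<exists>ws. orthogonal_basis \<Gamma> C l ws)"

definition two_term_floer_complex ::
    "real set \<Rightarrow> ('k::field series, 'a) module \<Rightarrow> ('a \<Rightarrow> ereal) \<Rightarrow>
     ('k series, 'b) module \<Rightarrow> ('b \<Rightarrow> ereal) \<Rightarrow> ('a \<Rightarrow> 'b) \<Rightarrow> bool" where
  "two_term_floer_complex \<Gamma> C1 l1 C0 l0 d \<longleftrightarrow>
     orthogonalizable_space \<Gamma> C1 l1 \<and> orthogonalizable_space \<Gamma> C0 l0 \<and>
     linear_map (novikov \<Gamma>) C1 C0 d \<and>
     (\<forall>x\<in>carrier C1. l0 (d x) \<le> l1 x)"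


subsection \<open>Generalized boundary depth\<close>

definition robust_element ::
    "('s, 'a) module \<Rightarrow> ('a \<Rightarrow> ereal) \<Rightarrow> ('b \<Rightarrow> ereal) \<Rightarrow> ('a \<Rightarrow> 'b) \<Rightarrow> real \<Rightarrow> 'b \<Rightarrow> bool" where
  "robust_element C1 l1 l0 d \<delta> x \<longleftrightarrow> (\<forall>y\<in>carrier C1. d y = x \<longrightarrow> l1 y > l0 x + ereal \<delta>)"

definition robust_subspace ::
    "real set \<Rightarrow> ('k::field series, 'a) module \<Rightarrow> ('a \<Rightarrow> ereal) \<Rightarrow>
     ('k series, 'b) module \<Rightarrow> ('b \<Rightarrow> ereal) \<Rightarrow> ('a \<Rightarrow> 'b) \<Rightarrow> real \<Rightarrow> 'b set \<Rightarrow> bool" where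
  "robust_subspace \<Gamma> C1 l1 C0 l0 d \<delta> V \<longleftrightarrow>
     subspace (novikov \<Gamma>) V C0 \<and> (\<forall>x\<in>V - {\<zero>\<^bsub>C0\<^esub>}. robust_element C1 l1 l0 d \<delta> x)"

text \<open>The supremum is taken in \<^typ>\<open>ereal\<close>, so it exists without a boundedness hypothesis.\<close>

definition boundary_depth ::
    "real set \<Rightarrow> ('k::field series, 'a) module \<Rightarrow> ('a \<Rightarrow> ereal) \<Rightarrow>
     ('k series, 'b) module \<Rightarrow> ('b \<Rightarrow> ereal) \<Rightarrow> ('a \<Rightarrow> 'b) \<Rightarrow> nat \<Rightarrow> ereal" where
  "boundary_depth \<Gamma> C1 l1 C0 l0 d k =
     Sup ({0} \<union> {ereal \<delta> | \<delta>. \<delta> \<ge> 0 \<and>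
       (\<exists>V. robust_subspace \<Gamma> C1 l1 C0 l0 d \<delta> V \<and> V \<subseteq> d ` carrier C1 \<and>
            vectorspace.dim (novikov \<Gamma>) (C0\<lparr>carrier := V\<rparr>) = k)})"


subsection \<open>Modules: quotients, finite direct sums, isomorphism\<close>

text \<open>
  The ring components \<^const>\<open>mult\<close> and \<^const>\<open>one\<close> of a module record carry no meaning and are
  left undefined.
\<close>

definition quot_module :: "('s, 'c) module \<Rightarrow> 'c set \<Rightarrow> ('s, 'c set) module" where
  "quot_module M N =
     \<lparr>carrier = a_rcosets\<^bsub>M\<^esub> N, mult = undefined, one = undefined, zero = N, add = set_add M,
      smult = (\<lambda>r X. \<Union>x\<in>X. N +>\<^bsub>M\<^esub> (r \<odot>\<^bsub>M\<^esub> x))\<rparr>"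

definition self_module :: "'s ring \<Rightarrow> ('s, 's) module" where
  "self_module R =
     \<lparr>carrier = carrier R, mult = mult R, one = one R, zero = zero R, add = add R, smult = mult R\<rparr>"

text \<open>The direct sum of a family indexed by a finite set \<open>I\<close>.\<close>

definition direct_sum_family :: "'i set \<Rightarrow> ('i \<Rightarrow> ('s, 'c) module) \<Rightarrow> ('s, 'i \<Rightarrow> 'c) module" where
  "direct_sum_family I M =
     \<lparr>carrier = (\<Pi>\<^sub>E i\<in>I. carrier (M i)), mult = undefined, one = undefined,
      zero = (\<lambda>i\<in>I. \<zero>\<^bsub>M i\<^esub>),
      add = (\<lambda>f h. \<lambda>i\<in>I. f i \<oplus>\<^bsub>M i\<^esub> h i),
      smult = (\<lambda>r f. \<lambda>i\<in>I. r \<odot>\<^bsub>M i\<^esub> f i)\<rparr>"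

definition module_isomorphic :: "'s ring \<Rightarrow> ('s, 'c) module \<Rightarrow> ('s, 'd) module \<Rightarrow> bool" where
  "module_isomorphic R M N \<longleftrightarrow> (\<exists>f\<in>module_hom R M N. bij_betw f (carrier M) (carrier N))"


subsection \<open>Extension of scalars\<close>

text \<open>
  For a subring \<open>R\<close> of \<open>S\<close> and an \<open>R\<close>-module \<open>M\<close>, the \<open>S\<close>-module \<open>M \<otimes>\<^sub>R S\<close> is the free abelian
  group on \<open>M \<times> S\<close> modulo the bilinearity relations; \<open>s\<close> acts by \<open>s (x \<otimes> t) = x \<otimes> (s t)\<close>.
  Elements are cosets; maps on them are given by their effect on representatives, taking the
  union of the (mutually equal) resulting cosets.
\<close>

definition tensor_free ::
    "'s ring \<Rightarrow> ('s, 'c) module \<Rightarrow> ('c \<times> 's \<Rightarrow>\<^sub>0 int) monoid" where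
  "tensor_free S M = free_Abelian_group (carrier M \<times> carrier S)"

definition tensor_relations ::
    "'s ring \<Rightarrow> 's ring \<Rightarrow> ('s, 'c) module \<Rightarrow> ('c \<times> 's \<Rightarrow>\<^sub>0 int) set" where
  "tensor_relations R S M = generate (tensor_free S M)
     ({frag_of (x \<oplus>\<^bsub>M\<^esub> y, s) - frag_of (x, s) - frag_of (y, s) | x y s.
         x \<in> carrier M \<and> y \<in> carrier M \<and> s \<in> carrier S} \<union>
      {frag_of (x, s \<oplus>\<^bsub>S\<^esub> t) - frag_of (x, s) - frag_of (x, t) | x s t.
         x \<in> carrier M \<and> s \<in> carrier S \<and> t \<in> carrier S} \<union>
      {frag_of (r \<odot>\<^bsub>M\<^esub> x, s) - frag_of (x, r \<otimes>\<^bsub>S\<^esub> s) | r x s.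
         r \<in> carrier R \<and> x \<in> carrier M \<and> s \<in> carrier S})"

definition tensor_class ::
    "'s ring \<Rightarrow> 's ring \<Rightarrow> ('s, 'c) module \<Rightarrow> ('c \<times> 's \<Rightarrow>\<^sub>0 int) \<Rightarrow> ('c \<times> 's \<Rightarrow>\<^sub>0 int) set" where
  "tensor_class R S M p = tensor_relations R S M #>\<^bsub>tensor_free S M\<^esub> p"

definition extend_scalars ::
    "'s ring \<Rightarrow> 's ring \<Rightarrow> ('s, 'c) module \<Rightarrow> ('s, ('c \<times> 's \<Rightarrow>\<^sub>0 int) set) module" where
  "extend_scalars R S M =
     \<lparr>carrier = carrier (tensor_free S M Mod tensor_relations R S M),
      mult = undefined, one = undefined,
      zero = one (tensor_free S M Mod tensor_relations R S M),
      add = mult (tensor_free S M Mod tensor_relations R S M),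
      smult = (\<lambda>s X. \<Union>p\<in>X. tensor_class R S M
                 (frag_extend (\<lambda>(x, t). frag_of (x, s \<otimes>\<^bsub>S\<^esub> t)) p))\<rparr>"

text \<open>The map \<open>d \<otimes> 1\<close>, for an \<open>R\<close>-linear map \<open>d\<close> with values in \<open>N\<close>.\<close>

definition extend_map ::
    "'s ring \<Rightarrow> 's ring \<Rightarrow> ('s, 'd) module \<Rightarrow> ('c \<Rightarrow> 'd) \<Rightarrow>
     ('c \<times> 's \<Rightarrow>\<^sub>0 int) set \<Rightarrow> ('d \<times> 's \<Rightarrow>\<^sub>0 int) set" where
  "extend_map R S N d X =
     (\<Union>p\<in>X. tensor_class R S N (frag_extend (\<lambda>(x, t). frag_of (d x, t)) p))"


subsection \<open>Torsion exponents\<close>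

abbreviation extend_novikov ::
    "real set \<Rightarrow> ('k::field series, 'c) module \<Rightarrow>
     ('k series, ('c \<times> 'k series \<Rightarrow>\<^sub>0 int) set) module" where
  "extend_novikov \<Gamma> C \<equiv> extend_scalars (novikov \<Gamma>) novikov_univ C"

text \<open>
  The filtration on \<open>C \<otimes> \<Lambda>\<^bsup>univ\<^esup>\<close> obtained from the choice of an orthogonal ordered basis \<open>ws\<close>.
  The coefficients with respect to the basis \<open>w\<^sub>i \<otimes> 1\<close> are unique, hence so is \<open>v\<close>.
\<close>

definition extended_filtration ::
    "real set \<Rightarrow> ('k::field series, 'c) module \<Rightarrow> ('c \<Rightarrow> ereal) \<Rightarrow> 'c list \<Rightarrow>
     ('c \<times> 'k series \<Rightarrow>\<^sub>0 int) set \<Rightarrow> ereal" where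
  "extended_filtration \<Gamma> C l ws X =
     (THE v. \<exists>c \<in> {..<length ws} \<rightarrow> carrier novikov_univ.
        X = (\<Oplus>\<^bsub>extend_novikov \<Gamma> C\<^esub>i\<in>{..<length ws}. c i \<odot>\<^bsub>extend_novikov \<Gamma> C\<^esub>
               tensor_class (novikov \<Gamma>) novikov_univ C (frag_of (ws ! i, \<one>\<^bsub>novikov_univ\<^esub>))) \<and>
        v = (SUP i\<in>{..<length ws}. l (ws ! i) - nu (c i)))"

definition extended_ball ::
    "real set \<Rightarrow> ('k::field series, 'c) module \<Rightarrow> ('c \<Rightarrow> ereal) \<Rightarrow> 'c list \<Rightarrow>
     ('k series, ('c \<times> 'k series \<Rightarrow>\<^sub>0 int) set) module" where
  "extended_ball \<Gamma> C l ws = (extend_novikov \<Gamma> C)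
     \<lparr>carrier := {X \<in> carrier (extend_novikov \<Gamma> C). extended_filtration \<Gamma> C l ws X \<le> 0}\<rparr>"

definition torsion_quotient ::
    "real set \<Rightarrow> ('k::field series, 'a) module \<Rightarrow> ('a \<Rightarrow> ereal) \<Rightarrow> 'a list \<Rightarrow>
     ('k series, 'b) module \<Rightarrow> ('b \<Rightarrow> ereal) \<Rightarrow> 'b list \<Rightarrow> ('a \<Rightarrow> 'b) \<Rightarrow>
     ('k series, ('b \<times> 'k series \<Rightarrow>\<^sub>0 int) set set) module" where
  "torsion_quotient \<Gamma> C1 l1 ws1 C0 l0 ws0 d =
     quot_module (extended_ball \<Gamma> C0 l0 ws0)
       (extend_map (novikov \<Gamma>) novikov_univ C0 d ` carrier (extended_ball \<Gamma> C1 l1 ws1))"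

definition standard_module ::
    "nat \<Rightarrow> real list \<Rightarrow>
     ('k::field series, (nat \<Rightarrow> 'k series) \<times> (nat \<Rightarrow> 'k series set)) module" where
  "standard_module q ls =
     direct_sum (ring.func_space novikov_univ0 {..<q})
       (direct_sum_family {..<length ls}
          (\<lambda>k. quot_module (self_module novikov_univ0) (PIdl\<^bsub>novikov_univ0\<^esub> (T_power (ls ! k)))))"

text \<open>
  The exponents are indexed from 1, whereas list positions start at 0. The decomposition exists
  by a theorem of Fukaya, Oh, Ohta and Ono, and the exponents do not depend on it.
\<close>

definition torsion_exponent ::
    "real set \<Rightarrow> ('k::field series, 'a) module \<Rightarrow> ('a \<Rightarrow> ereal) \<Rightarrow> 'a list \<Rightarrow>
     ('k series, 'b) module \<Rightarrow> ('b \<Rightarrow> ereal) \<Rightarrow> 'b list \<Rightarrow> ('a \<Rightarrow> 'b) \<Rightarrow> nat \<Rightarrow> real" where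
  "torsion_exponent \<Gamma> C1 l1 ws1 C0 l0 ws0 d k =
     (THE e. \<exists>q ls. sorted_wrt (\<ge>) ls \<and> (\<forall>x\<in>set ls. x > 0) \<and>
        module_isomorphic novikov_univ0
          (torsion_quotient \<Gamma> C1 l1 ws1 C0 l0 ws0 d) (standard_module q ls) \<and>
        e = (if k \<le> length ls then ls ! (k - 1) else 0))"

end

theory Submission
  imports Defs
begin

text \<open>Starting from orthogonal bases \<open>(w\<^sub>i)\<close> of \<open>C\<^sub>1\<close> and \<open>(v\<^sub>j)\<close> of \<open>C\<^sub>0\<close>, Gaussian elimination that
  always pivots on an entry \<open>a\<^sub>i\<^sub>j\<close> of \<open>\<partial>\<close> maximising \<open>\<ell>(v\<^sub>j) - \<nu>(a\<^sub>i\<^sub>j) - \<ell>(w\<^sub>i)\<close> keeps both bases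
  orthogonal, and ends with \<open>\<partial> w\<^sub>i = v\<^bsub>\<sigma>(i)\<^esub>\<close> for \<open>i \<in> D\<close> and \<open>\<partial> w\<^sub>i = 0\<close> otherwise. The gaps
  \<open>\<ell>(w\<^sub>i) - \<ell>(v\<^bsub>\<sigma>(i)\<^esub>) \<ge> 0\<close> determine both invariants. The \<open>k\<close> vectors \<open>v\<^bsub>\<sigma>(i)\<^esub>\<close> with the largest gaps
  span a robust subspace, and any \<open>k\<close>-dimensional subspace of the image meets the span of those with
  gap at most the \<open>k\<close>-th one. Over the universal field, rescaling the two bases identifies the
  quotient of the unit balls with a sum of free modules and of modules \<open>\<Lambda>\<^sub>0 / T\<^bsup>gap\<^esup> \<Lambda>\<^sub>0\<close>. The positive
  exponents are unique because the number of those exceeding \<open>a\<close> is a rank attached to \<open>T\<^sup>a M\<close>.\<close>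

subsection \<open>The ring of Novikov series\<close>

text \<open>Pivoting on an extremal entry is what makes elimination compatible with levels: another
  pivot may have so large a valuation that dividing by it raises the level of a modified vector
  above that of the vector it replaces. The elimination ends in new bases, whereas the torsion
  quotient is built from the given ones. The bridge is that transition coefficients between
  orthogonal bases cannot raise levels, so over the universal field all orthogonal bases have the
  same unit ball. Elements of the tensor product are cosets of formal sums; they are handled through
  coordinate functionals that vanish on the bilinearity relations. The universal field matters
  because its value group is all of \<real>: there every basis vector can be brought to level 0 by a
  power of T. Gaps equal to 0 give zero summands, so they drop out of the list of exponents and
  return as the default value 0. When exponents above a threshold are counted, free summands always
  count, and a threshold above all exponents isolates their number.\<close>

lemma mult_novikov_apply:
  "mult (novikov \<Gamma>) f h x = (\<Sum>g | f g \<noteq> 0 \<and> h (x - g) \<noteq> 0. f g * h (x - g))"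
  by (simp add: novikov_def)

lemma mult_nonzeroE:
  assumes "mult (novikov \<Gamma>) f h x \<noteq> 0"
  obtains g where "f g \<noteq> 0" "h (x - g) \<noteq> 0"
  using sum.not_neutral_contains_not_neutral[OF assms[unfolded mult_novikov_apply]] that by auto

lemma novikov_simps [simp]:
  "\<one>\<^bsub>novikov \<Gamma>\<^esub> = T_power 0"
  "\<zero>\<^bsub>novikov \<Gamma>\<^esub> = (\<lambda>x. 0)"
  "f \<oplus>\<^bsub>novikov \<Gamma>\<^esub> h = (\<lambda>x. f x + h x)"
  by (simp_all add: novikov_def T_power_def)

text \<open>The product formula does not mention \<Gamma>, so scalars of
  \<open>novikov \<Gamma>\<close> multiply inside the universal field exactly as in their own field,
  and no embedding has to be carried along.\<close>

lemma mult_novikov: "mult (novikov \<Gamma>) = mult novikov_univ"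
  by (simp add: novikov_def)

lemma carrier_novikov_univ:
  "f \<in> carrier novikov_univ \<longleftrightarrow> (\<forall>C. finite {g. g < C \<and> f g \<noteq> 0})"
  by (simp add: novikov_def)

lemma carrier_novikov_sub: "carrier (novikov \<Gamma>) \<subseteq> carrier novikov_univ"
  by (auto simp: novikov_def)

text \<open>Holds for every coefficient function, not only for members of the carrier. It trades a
  valuation estimate for the vanishing of coefficients below a real bound, so that the infinite
  valuation of 0 needs no separate case.\<close>

lemma ereal_le_nu_iff: "ereal c \<le> nu f \<longleftrightarrow> (\<forall>x<c. f x = 0)"
  unfolding nu_def by (simp add: le_INF_iff) (meson not_le)

lemma nu_zero [simp]: "nu (\<lambda>x. 0) = \<infinity>"
  by (simp add: nu_def top_ereal_def)

lemma series_bounded_below: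
  assumes "f \<in> carrier novikov_univ"
  obtains m where "\<And>x. f x \<noteq> 0 \<Longrightarrow> m \<le> x"
proof (cases "\<exists>x0. f x0 \<noteq> 0")
  case True
  then obtain x0 where x0: "f x0 \<noteq> 0" by blast
  have fin: "finite {g. g < x0 \<and> f g \<noteq> 0}"
    using assms by (simp add: carrier_novikov_univ)
  \<comment> \<open>Only finitely many exponents lie below \<open>x0\<close>; inserting
    \<open>x0\<close> keeps the set nonempty and makes \<open>m\<close> a bound for the exponents
    from \<open>x0\<close> on as well.\<close>
  define m where "m = Min (insert x0 {g. g < x0 \<and> f g \<noteq> 0})"
  have "m \<le> x" if "f x \<noteq> 0" for x
  proof (cases "x < x0")
    case True
    then show ?thesis using that fin by (auto simp: m_def intro!: Min_le)
  next
    case False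
    then have "m \<le> x0" using fin by (auto simp: m_def intro!: Min_le)
    then show ?thesis using False by simp
  qed
  then show ?thesis by (rule that)
next
  case False
  then show ?thesis using that[of 0] by auto
qed

lemma nu_real:
  assumes f: "f \<in> carrier novikov_univ" and "f \<noteq> (\<lambda>x. 0)"
  obtains r where "nu f = ereal r"
proof -
  obtain x where x: "f x \<noteq> 0" using assms by auto
  obtain m where "\<And>x. f x \<noteq> 0 \<Longrightarrow> m \<le> x" using series_bounded_below[OF f] by blast
  then have "ereal m \<le> nu f" by (auto simp: ereal_le_nu_iff) (meson not_le)
  moreover have "nu f \<le> ereal x" unfolding nu_def using x by (auto intro!: INF_lower)
  ultimately show ?thesis using that by (cases "nu f") auto
qed

lemma finite_below:
  assumes "f \<in> carrier novikov_univ" shows "finite {g. f g \<noteq> 0 \<and> g \<le> C}"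
proof (rule finite_subset)
  show "finite {g. g < C + 1 \<and> f g \<noteq> 0}" using assms by (simp add: carrier_novikov_univ)
qed auto

text \<open>The lower bound for the exponents of \<open>h\<close> turns into an upper bound for
  those of \<open>f\<close>, and \<open>f\<close> has finitely many exponents below any
  bound.\<close>

lemma finite_mult_support:
  assumes f: "f \<in> carrier novikov_univ" and h: "h \<in> carrier novikov_univ"
  shows "finite {g. f g \<noteq> 0 \<and> h (x - g) \<noteq> 0}"
proof -
  obtain m where "\<And>x. h x \<noteq> 0 \<Longrightarrow> m \<le> x" using series_bounded_below[OF h] by blast
  then have "{g. f g \<noteq> 0 \<and> h (x - g) \<noteq> 0} \<subseteq> {g. f g \<noteq> 0 \<and> g \<le> x - m}" by force
  then show ?thesis using finite_below[OF f] finite_subset by blast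
qed

text \<open>The exact index set depends on \<open>x\<close> and on both factors. Enlarging it to a
  common finite set is what allows sums for different products to be added or interchanged.\<close>

lemma mult_eq_sum:
  assumes "finite A" "{g. f g \<noteq> 0 \<and> h (x - g) \<noteq> 0} \<subseteq> A"
  shows "mult (novikov \<Gamma>) f h x = (\<Sum>g\<in>A. f g * h (x - g))"
  unfolding mult_novikov_apply by (rule sum.mono_neutral_left) (use assms in auto)

lemma mult_comm_series:
  "mult (novikov \<Gamma>) f h = mult (novikov \<Gamma>) h f"
proof
  fix x :: real
  show "mult (novikov \<Gamma>) f h x = mult (novikov \<Gamma>) h f x"
    unfolding mult_novikov_apply
    by (rule sum.reindex_bij_witness[of _ "\<lambda>g. x - g" "\<lambda>g. x - g"]) (auto simp: mult.commute)
qed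

lemma mult_eq_sum':
  assumes "finite A" "{g. f (x - g) \<noteq> 0 \<and> h g \<noteq> 0} \<subseteq> A"
  shows "mult (novikov \<Gamma>) f h x = (\<Sum>g\<in>A. f (x - g) * h g)"
  by (subst mult_comm_series, subst mult_eq_sum[OF assms(1)])
    (use assms(2) in \<open>auto simp: mult.commute\<close>)

text \<open>An exponent of the product below \<open>C\<close> is a sum of exponents of the factors,
  and each of them is bounded above because the other is bounded below.\<close>

lemma mult_closed_series:
  assumes f: "f \<in> carrier novikov_univ" and h: "h \<in> carrier novikov_univ"
  shows "mult (novikov \<Gamma>) f h \<in> carrier novikov_univ"
  unfolding carrier_novikov_univ
proof
  fix C :: real
  obtain m where m: "\<And>x. h x \<noteq> 0 \<Longrightarrow> m \<le> x" using series_bounded_below[OF h] by blast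
  obtain m' where m': "\<And>x. f x \<noteq> 0 \<Longrightarrow> m' \<le> x" using series_bounded_below[OF f] by blast
  have "{g. g < C \<and> mult (novikov \<Gamma>) f h g \<noteq> 0} \<subseteq>
     (\<lambda>(a, b). a + b) ` ({a. f a \<noteq> 0 \<and> a \<le> C - m} \<times> {b. h b \<noteq> 0 \<and> b \<le> C - m'})"
  proof
    fix x assume x: "x \<in> {g. g < C \<and> mult (novikov \<Gamma>) f h g \<noteq> 0}"
    then have "\<exists>a. f a \<noteq> 0 \<and> h (x - a) \<noteq> 0"
      by (auto elim: mult_nonzeroE)
    then obtain a where a: "f a \<noteq> 0" "h (x - a) \<noteq> 0" by blast
    with x m[OF a(2)] m'[OF a(1)] show "x \<in> (\<lambda>(a, b). a + b) `
        ({a. f a \<noteq> 0 \<and> a \<le> C - m} \<times> {b. h b \<noteq> 0 \<and> b \<le> C - m'})"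
      by (intro image_eqI[of _ _ "(a, x - a)"]) auto
  qed
  then show "finite {g. g < C \<and> mult (novikov \<Gamma>) f h g \<noteq> 0}"
    by (rule finite_subset) (use finite_below[OF f] finite_below[OF h] in auto)
qed

text \<open>Both bracketings become double sums over one rectangle \<open>A\<close> times
  \<open>B\<close> that does not depend on the inner index; the two sums are then swapped.\<close>

lemma mult_assoc_series:
  assumes f: "f \<in> carrier novikov_univ" and g: "g \<in> carrier novikov_univ"
    and h: "h \<in> carrier novikov_univ"
  shows "mult (novikov \<Gamma>) (mult (novikov \<Gamma>) f g) h = mult (novikov \<Gamma>) f (mult (novikov \<Gamma>) g h)"
proof
  fix x :: real
  obtain mf where mf: "\<And>x. f x \<noteq> 0 \<Longrightarrow> mf \<le> x" using series_bounded_below[OF f] by blast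
  obtain mg where mg: "\<And>x. g x \<noteq> 0 \<Longrightarrow> mg \<le> x" using series_bounded_below[OF g] by blast
  obtain mh where mh: "\<And>x. h x \<noteq> 0 \<Longrightarrow> mh \<le> x" using series_bounded_below[OF h] by blast
  let ?m = "mult (novikov \<Gamma>)"
  \<comment> \<open>In a term of total exponent \<open>x\<close> the factors \<open>g\<close> and
    \<open>h\<close> take up at least \<open>mg + mh\<close>, which bounds the exponent of
    \<open>f\<close>. \<open>B\<close> bounds the exponent of \<open>h\<close> in the same
    way.\<close>
  define A where "A = {b. f b \<noteq> 0 \<and> b \<le> x - mg - mh}"
  define B where "B = {c. h c \<noteq> 0 \<and> c \<le> x - mf - mg}"
  have finA: "finite A" and finB: "finite B"
    unfolding A_def B_def by (rule finite_below[OF f], rule finite_below[OF h])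
  have low: "mf + mg \<le> y" if nz: "?m f g y \<noteq> 0" for y
  proof -
    obtain a where "f a \<noteq> 0" "g (y - a) \<noteq> 0"
      by (rule mult_nonzeroE[OF nz])
    then show ?thesis using mf mg by force
  qed
  have low': "mg + mh \<le> y" if nz: "?m g h y \<noteq> 0" for y
  proof -
    obtain a where "g a \<noteq> 0" "h (y - a) \<noteq> 0"
      by (rule mult_nonzeroE[OF nz])
    then show ?thesis using mg mh by force
  qed
  have "?m (?m f g) h x = (\<Sum>c\<in>B. ?m f g (x - c) * h c)"
    by (rule mult_eq_sum') (use finB low in \<open>force simp: B_def\<close>)+
  also have "\<dots> = (\<Sum>c\<in>B. (\<Sum>b\<in>A. f b * g (x - c - b)) * h c)"
  proof (intro sum.cong refl arg_cong2[where f = times])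
    fix c assume "c \<in> B"
    then have "mh \<le> c" using mh by (auto simp: B_def)
    then have "{b. f b \<noteq> 0 \<and> g (x - c - b) \<noteq> 0} \<subseteq> A"
      unfolding A_def using mg by force
    then show "?m f g (x - c) = (\<Sum>b\<in>A. f b * g (x - c - b))"
      using mult_eq_sum[OF finA] by blast
  qed
  also have "\<dots> = (\<Sum>b\<in>A. \<Sum>c\<in>B. f b * (g (x - b - c) * h c))"
    by (subst sum.swap) (simp add: sum_distrib_left sum_distrib_right mult.assoc diff_diff_eq add.commute)
  also have "\<dots> = (\<Sum>b\<in>A. f b * ?m g h (x - b))"
  proof (rule sum.cong[OF refl])
    fix b assume "b \<in> A"
    then have "mf \<le> b" using mf by (auto simp: A_def)
    then have "{c. g (x - b - c) \<noteq> 0 \<and> h c \<noteq> 0} \<subseteq> B"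
      unfolding B_def using mg by force
    then have "?m g h (x - b) = (\<Sum>c\<in>B. g (x - b - c) * h c)"
      using mult_eq_sum'[OF finB] by blast
    then show "(\<Sum>c\<in>B. f b * (g (x - b - c) * h c)) = f b * ?m g h (x - b)"
      by (simp add: sum_distrib_left)
  qed
  also have "\<dots> = ?m f (?m g h) x"
    by (rule mult_eq_sum[symmetric]) (use finA low' in \<open>force simp: A_def\<close>)+
  finally show "?m (?m f g) h x = ?m f (?m g h) x" .
qed

lemma T_power_mult:
  "mult (novikov \<Gamma>) (T_power a) f = (\<lambda>x. f (x - a))"
proof
  fix x
  show "mult (novikov \<Gamma>) (T_power a) f x = f (x - a)"
    by (subst mult_eq_sum[of "{a}"]) (auto simp: T_power_def split: if_splits)
qed

lemma T_power_closed: "T_power a \<in> carrier novikov_univ"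
  unfolding carrier_novikov_univ
proof
  fix C
  have "{g. g < C \<and> T_power a g \<noteq> 0} \<subseteq> {a}" by (auto simp: T_power_def split: if_splits)
  then show "finite {g. g < C \<and> T_power a g \<noteq> 0}" using finite_subset by blast
qed

lemma add_closed_series:
  assumes "f \<in> carrier novikov_univ" "h \<in> carrier novikov_univ"
  shows "(\<lambda>x. f x + h x) \<in> carrier novikov_univ"
  unfolding carrier_novikov_univ
proof
  fix C
  have "{g. g < C \<and> f g + h g \<noteq> 0} \<subseteq> {g. g < C \<and> f g \<noteq> 0} \<union> {g. g < C \<and> h g \<noteq> 0}" by auto
  then show "finite {g. g < C \<and> f g + h g \<noteq> 0}"
    by (rule finite_subset) (use assms in \<open>auto simp: carrier_novikov_univ\<close>)
qed

lemma zero_closed_series: "(\<lambda>x. 0) \<in> carrier novikov_univ"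
  by (simp add: carrier_novikov_univ)

lemma l_distr_series:
  assumes "f \<in> carrier novikov_univ" "g \<in> carrier novikov_univ" "h \<in> carrier novikov_univ"
  shows "mult (novikov \<Gamma>) (\<lambda>x. f x + g x) h = (\<lambda>x. mult (novikov \<Gamma>) f h x + mult (novikov \<Gamma>) g h x)"
proof
  fix x
  let ?A = "{a. f a \<noteq> 0 \<and> h (x - a) \<noteq> 0} \<union> {a. g a \<noteq> 0 \<and> h (x - a) \<noteq> 0}"
  have fin: "finite ?A" using assms finite_mult_support by blast
  show "mult (novikov \<Gamma>) (\<lambda>x. f x + g x) h x = mult (novikov \<Gamma>) f h x + mult (novikov \<Gamma>) g h x"
    by (subst (1 2 3) mult_eq_sum[OF fin]) (auto simp: sum.distrib algebra_simps)
qed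

lemma cring_novikov_univ: "cring (novikov_univ :: 'k::field series ring)"
proof (rule cringI)
  show "abelian_group (novikov_univ :: 'k series ring)"
  proof (rule abelian_groupI)
    fix f :: "'k series" assume f: "f \<in> carrier novikov_univ"
    show "\<exists>y\<in>carrier novikov_univ. y \<oplus>\<^bsub>novikov_univ\<^esub> f = \<zero>\<^bsub>novikov_univ\<^esub>"
      by (rule bexI[of _ "\<lambda>x. - f x"]) (use f in \<open>auto simp: carrier_novikov_univ\<close>)
  qed (auto simp: add_closed_series zero_closed_series algebra_simps)
  show "Group.comm_monoid (novikov_univ :: 'k series ring)"
  proof (rule comm_monoidI)
    show "\<one>\<^bsub>novikov_univ\<^esub> \<otimes>\<^bsub>novikov_univ\<^esub> f = f" for f :: "'k series"
      by (simp add: T_power_mult)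
    show "f \<otimes>\<^bsub>novikov_univ\<^esub> g = g \<otimes>\<^bsub>novikov_univ\<^esub> f" for f g :: "'k series"
      by (rule mult_comm_series)
  qed (auto simp: mult_closed_series T_power_closed mult_assoc_series)
qed (auto simp: l_distr_series)

lemma a_inv_series:
  assumes "f \<in> carrier novikov_univ" shows "\<ominus>\<^bsub>novikov_univ\<^esub> f = (\<lambda>x. - f x)"
proof -
  interpret cring "novikov_univ :: 'a series ring" by (rule cring_novikov_univ)
  show ?thesis
    by (rule minus_equality) (use assms in \<open>auto simp: carrier_novikov_univ\<close>)
qed

lemma a_minus_series:
  assumes "f \<in> carrier novikov_univ" "h \<in> carrier novikov_univ"
  shows "h \<ominus>\<^bsub>novikov_univ\<^esub> f = (\<lambda>x. h x - f x)"
  using assms by (simp add: a_minus_def a_inv_series)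

lemma nu_mult_ge:
  assumes "ereal a \<le> nu f" "ereal b \<le> nu h"
  shows "ereal (a + b) \<le> nu (mult (novikov \<Gamma>) f h)"
  unfolding ereal_le_nu_iff
proof (intro allI impI)
  fix x assume x: "x < a + b"
  have "{g. f g \<noteq> 0 \<and> h (x - g) \<noteq> 0} = {}"
  proof safe
    fix g assume g: "h (x - g) \<noteq> 0" "f g \<noteq> 0"
    then have "a \<le> g" "b \<le> x - g" using assms by (meson ereal_le_nu_iff not_le)+
    then show "g \<in> {}" using x by simp
  qed
  then show "mult (novikov \<Gamma>) f h x = 0" unfolding mult_novikov_apply by (simp only: sum.empty)
qed

subsection \<open>The valuation ring\<close>

lemma carrier_novikov_univ0:
  "f \<in> carrier novikov_univ0 \<longleftrightarrow> f \<in> carrier novikov_univ \<and> (\<forall>x<0. f x = 0)"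
  using ereal_le_nu_iff[of 0 f] by (simp add: novikov_univ0_def zero_ereal_def)

lemma novikov_univ0_simps [simp]:
  "mult novikov_univ0 = mult novikov_univ"
  "\<one>\<^bsub>novikov_univ0\<^esub> = T_power 0"
  "\<zero>\<^bsub>novikov_univ0\<^esub> = (\<lambda>x. 0)"
  "f \<oplus>\<^bsub>novikov_univ0\<^esub> h = (\<lambda>x. f x + h x)"
  by (simp_all add: novikov_univ0_def)

lemma univ0_subset: "f \<in> carrier novikov_univ0 \<Longrightarrow> f \<in> carrier novikov_univ"
  by (simp add: carrier_novikov_univ0)

lemma T_power_closed_univ0: "a \<ge> 0 \<Longrightarrow> T_power a \<in> carrier novikov_univ0"
  by (simp add: carrier_novikov_univ0 T_power_closed) (simp add: T_power_def)

lemma mult_closed_univ0: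
  assumes "f \<in> carrier novikov_univ0" "h \<in> carrier novikov_univ0"
  shows "mult novikov_univ f h \<in> carrier novikov_univ0"
  using assms nu_mult_ge[of 0 f 0 h UNIV] mult_closed_series[of f h UNIV]
  by (simp add: carrier_novikov_univ0 ereal_le_nu_iff del: novikov_simps(1))

lemma cring_novikov_univ0: "cring (novikov_univ0 :: 'k::field series ring)"
proof (rule cringI)
  show "abelian_group (novikov_univ0 :: 'k series ring)"
  proof (rule abelian_groupI)
    fix f :: "'k series" assume f: "f \<in> carrier novikov_univ0"
    show "\<exists>y\<in>carrier novikov_univ0. y \<oplus>\<^bsub>novikov_univ0\<^esub> f = \<zero>\<^bsub>novikov_univ0\<^esub>"
      by (rule bexI[of _ "\<lambda>x. - f x"]) (use f in \<open>auto simp: carrier_novikov_univ carrier_novikov_univ0\<close>)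
  qed (auto simp: add_closed_series zero_closed_series algebra_simps carrier_novikov_univ0)
  show "Group.comm_monoid (novikov_univ0 :: 'k series ring)"
  proof (rule comm_monoidI)
    show "\<one>\<^bsub>novikov_univ0\<^esub> \<otimes>\<^bsub>novikov_univ0\<^esub> f = f" for f :: "'k series"
      by (simp add: T_power_mult)
    show "f \<otimes>\<^bsub>novikov_univ0\<^esub> g = g \<otimes>\<^bsub>novikov_univ0\<^esub> f" for f g :: "'k series"
      unfolding novikov_univ0_simps by (rule mult_comm_series)
  qed (auto simp: mult_closed_univ0 univ0_subset mult_assoc_series T_power_closed_univ0)
qed (auto simp: l_distr_series univ0_subset)

lemma shift_closed:
  assumes "f \<in> carrier novikov_univ" shows "(\<lambda>x. f (x - a)) \<in> carrier novikov_univ"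
  using mult_closed_series[OF T_power_closed[of a] assms, of UNIV] by (simp add: T_power_mult)

text \<open>When \<open>f\<close> has no negative exponents and \<open>h\<close> starts no earlier
  than \<open>a\<close>, the total exponent \<open>a\<close> is reached only as 0 + a. Leading
  coefficients thus turn scalars of the valuation ring into their constant terms, elements of the
  residue field.\<close>

lemma univ0_coeff_mult:
  assumes f: "f \<in> carrier novikov_univ0" and h: "\<forall>x<a. h x = 0"
  shows "mult novikov_univ f h a = f 0 * h a"
proof (subst mult_eq_sum[of "{0}"])
  have "g = 0" if "f g \<noteq> 0" "h (a - g) \<noteq> 0" for g
  proof -
    have "0 \<le> g" using f that(1) by (force simp: carrier_novikov_univ0 not_less[symmetric])
    moreover have "a \<le> a - g" using h that(2) by (meson not_le)
    ultimately show ?thesis by simp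
  qed
  then show "{g. f g \<noteq> 0 \<and> h (a - g) \<noteq> 0} \<subseteq> {0}" by auto
qed auto

subsection \<open>Linear relations\<close>

text \<open>A homogeneous system with equations \<open>j\<close> and unknowns \<open>i\<close>,
  fewer equations than unknowns, solved by induction on the equations: a pivot unknown
  \<open>p\<close> of equation \<open>j\<close> is eliminated, the smaller system is solved, and the
  value at \<open>p\<close> comes from back substitution.\<close>

lemma (in field) nontrivial_relation:
  assumes "finite B" "finite A" "card B < card A" "\<And>i j. i \<in> A \<Longrightarrow> j \<in> B \<Longrightarrow> v i j \<in> carrier R"
  shows "\<exists>d\<in>A \<rightarrow> carrier R. (\<exists>i\<in>A. d i \<noteq> \<zero>) \<and> (\<forall>j\<in>B. (\<Oplus>i\<in>A. d i \<otimes> v i j) = \<zero>)"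
  using assms
proof (induction B arbitrary: A v rule: finite_induct)
  case empty
  then have "A \<noteq> {}" by auto
  then show ?case by (intro bexI[of _ "\<lambda>_. \<one>"]) auto
next
  case (insert j B)
  show ?case
  proof (cases "\<forall>i\<in>A. v i j = \<zero>")
    case True
    have "card B < card A" using insert by auto
    then obtain d where d: "d \<in> A \<rightarrow> carrier R" "\<exists>i\<in>A. d i \<noteq> \<zero>"
      "\<forall>j\<in>B. (\<Oplus>i\<in>A. d i \<otimes> v i j) = \<zero>"
      using insert.IH[of A v] insert.prems by blast
    moreover have "(\<Oplus>i\<in>A. d i \<otimes> v i j) = (\<Oplus>i\<in>A. \<zero>)"
      by (rule finsum_cong') (use True d in \<open>auto simp: Pi_iff\<close>)
    ultimately show ?thesis by auto
  next
    case False
    then obtain p where p: "p \<in> A" "v p j \<noteq> \<zero>" by blast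
    have cancel: "x \<otimes> y = x \<otimes> (y \<ominus> z \<otimes> w) \<oplus> x \<otimes> z \<otimes> w"
      if "x \<in> carrier R" "y \<in> carrier R" "z \<in> carrier R" "w \<in> carrier R" for x y z w
      using that by algebra
    define A' where "A' = A - {p}"
    have A': "finite A'" "p \<notin> A'" "A = insert p A'" using p insert.prems by (auto simp: A'_def)
    have vc [simp]: "v i k \<in> carrier R" if "i \<in> A" "k \<in> insert j B" for i k
      using insert.prems that by blast
    have pj: "v p j \<in> Units R" using p by (simp add: field_Units)
    define u where "u i = v i j \<otimes> inv (v p j)" for i
    have uc [simp]: "u i \<in> carrier R" if "i \<in> A" for i using that pj by (simp add: u_def)
    have "card B < card A'" using insert p by (simp add: A'_def)
    moreover have "v i k \<ominus> u i \<otimes> v p k \<in> carrier R" if "i \<in> A'" "k \<in> B" for i k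
      using that p A' by auto
    ultimately obtain d where d: "d \<in> A' \<rightarrow> carrier R" "\<exists>i\<in>A'. d i \<noteq> \<zero>"
      "\<And>k. k \<in> B \<Longrightarrow> (\<Oplus>i\<in>A'. d i \<otimes> (v i k \<ominus> u i \<otimes> v p k)) = \<zero>"
      using insert.IH[of A' "\<lambda>i k. v i k \<ominus> u i \<otimes> v p k"] A'(1) by blast
    have dc [simp]: "d i \<in> carrier R" if "i \<in> A'" for i using d that by auto
    \<comment> \<open>The pivot unknown receives minus this sum, so that its contribution to each
      equation cancels what the elimination subtracted.\<close>
    define s where "s = (\<Oplus>i\<in>A'. d i \<otimes> u i)"
    have sc [simp]: "s \<in> carrier R" unfolding s_def by (rule finsum_closed) (use A' in auto)
    define e where "e i = (if i = p then \<ominus> s else d i)" for i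
    have "(\<Oplus>i\<in>A. e i \<otimes> v i k) = \<zero>" if k: "k \<in> insert j B" for k
    proof -
      have 0: "(\<Oplus>i\<in>A'. d i \<otimes> (v i k \<ominus> u i \<otimes> v p k)) = \<zero>"
      proof (cases "k \<in> B")
        \<comment> \<open>Here \<open>k = j\<close>, and the elimination has made every coefficient
          of this equation zero.\<close>
        case False
        have "(\<Oplus>i\<in>A'. d i \<otimes> (v i k \<ominus> u i \<otimes> v p k)) = (\<Oplus>i\<in>A'. \<zero>)"
        proof (rule finsum_cong')
          fix i assume "i \<in> A'"
          then show "d i \<otimes> (v i k \<ominus> u i \<otimes> v p k) = \<zero>"
            using False k pj p A' by (simp add: u_def m_assoc minus_eq r_neg)
        qed auto
        then show ?thesis by simp
      qed (use d in auto)
      have "(\<Oplus>i\<in>A'. e i \<otimes> v i k) = (\<Oplus>i\<in>A'. d i \<otimes> (v i k \<ominus> u i \<otimes> v p k) \<oplus> d i \<otimes> u i \<otimes> v p k)"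
      proof (rule finsum_cong')
        fix i assume i: "i \<in> A'"
        then have "i \<noteq> p" "i \<in> A" using A' by auto
        then show "e i \<otimes> v i k = d i \<otimes> (v i k \<ominus> u i \<otimes> v p k) \<oplus> d i \<otimes> u i \<otimes> v p k"
          using cancel[of "d i" "v i k" "u i" "v p k"] i k p by (simp add: e_def)
      qed (use A' k p in auto)
      also have "\<dots> = s \<otimes> v p k"
        unfolding s_def using A' k p 0
        by (subst finsum_addf) (auto simp: finsum_ldistr)
      finally have "(\<Oplus>i\<in>A. e i \<otimes> v i k) = \<ominus> s \<otimes> v p k \<oplus> s \<otimes> v p k"
        using A' k p by (subst A'(3), subst finsum_insert) (auto simp: e_def)
      then show ?thesis using k p by (simp add: l_minus l_neg)
    qed
    moreover have "e \<in> A \<rightarrow> carrier R" using d(1) A' by (auto simp: e_def)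
    moreover have "\<exists>i\<in>A. e i \<noteq> \<zero>" using d(2) A' by (metis e_def insertI2)
    ultimately show ?thesis by blast
  qed
qed

text \<open>With fewer vectors \<open>v j\<close> than indices, a nonzero functional
  \<open>d\<close> kills all of them and hence everything they span; but it does not kill the unit
  vector at an index with \<open>d i \<noteq> 0\<close>.\<close>

lemma card_le_of_spanning:
  fixes v :: "'b \<Rightarrow> 'a \<Rightarrow> 'k::field"
  assumes fin: "finite A" "finite B" and span: "\<And>c. \<exists>b. \<forall>i\<in>A. c i = (\<Sum>j\<in>B. b j * v j i)"
  shows "card A \<le> card B"
proof (rule ccontr)
  assume "\<not> card A \<le> card B"
  then have less: "card B < card A" by simp
  \<comment> \<open>The type class of fields is repackaged as a ring record, to which
    \<open>nontrivial_relation\<close> applies.\<close>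
  let ?R = "\<lparr>carrier = (UNIV::'k set), mult = (*), one = 1, zero = 0, add = (+)\<rparr> :: 'k ring"
  interpret R: cring ?R
    by (unfold_locales) (auto simp: Units_def algebra_simps intro: exI[of _ "- x" for x] add.right_inverse)
  interpret R: field ?R
  proof
    have "x \<in> Units ?R" if "x \<noteq> 0" for x :: 'k
      using that by (auto simp: Units_def intro!: exI[of _ "inverse x"])
    then show "Units ?R = carrier ?R - {\<zero>\<^bsub>?R\<^esub>}" by (auto simp: Units_def)
  qed auto
  have fs: "finsum ?R f S = sum f S" if "finite S" for f and S :: "'a set"
    using that by (induction S rule: finite_induct) auto
  obtain d i where i: "i \<in> A" "d i \<noteq> 0" and 0: "\<And>j. j \<in> B \<Longrightarrow> (\<Sum>i\<in>A. d i * v j i) = 0"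
    using R.nontrivial_relation[OF fin(2,1) less, of "\<lambda>i j. v j i"] fs[OF fin(1)] by auto
  obtain b where b: "\<forall>k\<in>A. (if k = i then 1 else 0) = (\<Sum>j\<in>B. b j * v j k)"
    using span[of "\<lambda>k. if k = i then 1 else 0"] by auto
  have "d i = (\<Sum>k\<in>A. d k * (if k = i then 1 else 0))"
    using i fin by (simp add: if_distrib cong: if_cong)
  also have "\<dots> = (\<Sum>k\<in>A. \<Sum>j\<in>B. b j * (d k * v j k))"
    by (rule sum.cong[OF refl]) (use b in \<open>simp add: sum_distrib_left ac_simps\<close>)
  also have "\<dots> = (\<Sum>j\<in>B. b j * (\<Sum>k\<in>A. d k * v j k))"
    by (subst sum.swap) (simp add: sum_distrib_left)
  also have "\<dots> = 0" using 0 by simp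
  finally show False using i by simp
qed

subsection \<open>Presentations of torsion modules\<close>

text \<open>\<open>M\<close> is the direct sum over \<open>i \<in> I\<close> of the cyclic modules \<open>\<Lambda>\<^sub>0 / T\<^bsup>\<lambda> i\<^esup> \<Lambda>\<^sub>0\<close>, where
  \<open>\<lambda> i = \<infinity>\<close> stands for a free summand. Here \<open>F\<close> sends coordinate vectors to elements of \<open>M\<close>.\<close>

definition presents ::
    "((real \<Rightarrow> 'k::field), 'm) module \<Rightarrow> 'i set \<Rightarrow> ('i \<Rightarrow> ereal) \<Rightarrow> (('i \<Rightarrow> 'k series) \<Rightarrow> 'm) \<Rightarrow> bool" where
  "presents M I lam F \<longleftrightarrow>
     F ` (I \<rightarrow> carrier novikov_univ0) = carrier M \<and>
     (\<forall>c\<in>I \<rightarrow> carrier novikov_univ0. \<forall>c'\<in>I \<rightarrow> carrier novikov_univ0.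
        F (\<lambda>i x. c i x + c' i x) = F c \<oplus>\<^bsub>M\<^esub> F c') \<and>
     (\<forall>r\<in>carrier novikov_univ0. \<forall>c\<in>I \<rightarrow> carrier novikov_univ0.
        F (\<lambda>i. mult novikov_univ r (c i)) = r \<odot>\<^bsub>M\<^esub> F c) \<and>
     (\<forall>c\<in>I \<rightarrow> carrier novikov_univ0. \<forall>c'\<in>I \<rightarrow> carrier novikov_univ0.
        F c = F c' \<longleftrightarrow> (\<forall>i\<in>I. lam i \<le> nu (\<lambda>x. c i x - c' i x)))"

lemma presents_cong:
  assumes "presents M I lam F" and "\<And>i. i \<in> I \<Longrightarrow> lam i = lam' i"
  shows "presents M I lam' F"
proof -
  have *: "(\<forall>i\<in>I. lam' i \<le> h i) \<longleftrightarrow> (\<forall>i\<in>I. lam i \<le> h i)" for h using assms(2) by simp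
  show ?thesis using assms(1) unfolding presents_def * .
qed

lemma presentsD:
  assumes "presents M I lam F"
  shows "F ` (I \<rightarrow> carrier novikov_univ0) = carrier M"
    and "\<And>c c'. c \<in> I \<rightarrow> carrier novikov_univ0 \<Longrightarrow> c' \<in> I \<rightarrow> carrier novikov_univ0 \<Longrightarrow>
      F (\<lambda>i x. c i x + c' i x) = F c \<oplus>\<^bsub>M\<^esub> F c'"
    and "\<And>r c. r \<in> carrier novikov_univ0 \<Longrightarrow> c \<in> I \<rightarrow> carrier novikov_univ0 \<Longrightarrow>
      F (\<lambda>i. mult novikov_univ r (c i)) = r \<odot>\<^bsub>M\<^esub> F c"
    and "\<And>c c'. c \<in> I \<rightarrow> carrier novikov_univ0 \<Longrightarrow> c' \<in> I \<rightarrow> carrier novikov_univ0 \<Longrightarrow>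
      F c = F c' \<longleftrightarrow> (\<forall>i\<in>I. lam i \<le> nu (\<lambda>x. c i x - c' i x))"
  using assms unfolding presents_def by blast+

lemma presents_closed:
  "presents M I lam F \<Longrightarrow> c \<in> I \<rightarrow> carrier novikov_univ0 \<Longrightarrow> F c \<in> carrier M"
  using presentsD(1) by blast

lemma presents_coordinates:
  assumes "presents M I lam F" "x \<in> carrier M"
  obtains c where "c \<in> I \<rightarrow> carrier novikov_univ0" "F c = x"
  using assms(2) unfolding presentsD(1)[OF assms(1), symmetric] by blast

lemma add_closed_univ0:
  "f \<in> carrier novikov_univ0 \<Longrightarrow> h \<in> carrier novikov_univ0 \<Longrightarrow> (\<lambda>x. f x + h x) \<in> carrier novikov_univ0"
  by (simp add: carrier_novikov_univ0 add_closed_series)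

lemma zero_closed_univ0: "(\<lambda>x. 0) \<in> carrier novikov_univ0"
  by (simp add: carrier_novikov_univ0 zero_closed_series)

lemma sum_closed_univ0:
  "(\<And>i. i \<in> S \<Longrightarrow> f i \<in> carrier novikov_univ0) \<Longrightarrow> (\<lambda>x. \<Sum>i\<in>S. f i x) \<in> carrier novikov_univ0"
  by (induction S rule: infinite_finite_induct) (auto simp: zero_closed_univ0 add_closed_univ0)

lemma presents_image:
  assumes "presents M I lam F" "f \<in> module_hom novikov_univ0 M N" "bij_betw f (carrier M) (carrier N)"
  shows "presents N I lam (f \<circ> F)"
proof -
  note p = presentsD[OF assms(1)]
  have FM: "F c \<in> carrier M" if "c \<in> I \<rightarrow> carrier novikov_univ0" for c using p(1) that by blast
  have inj: "F c = F c' \<longleftrightarrow> f (F c) = f (F c')"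
    if "c \<in> I \<rightarrow> carrier novikov_univ0" "c' \<in> I \<rightarrow> carrier novikov_univ0" for c c'
    using assms(3) FM that by (auto simp: bij_betw_def inj_on_def)
  have "(f \<circ> F) ` (I \<rightarrow> carrier novikov_univ0) = carrier N"
    using p(1) assms(3) by (metis bij_betw_imp_surj_on image_comp)
  then show ?thesis
    unfolding presents_def
    by (intro conjI ballI)
      (simp_all only: o_apply p(2,3) inj[symmetric] p(4) FM
        module_hom_add[OF assms(2)] module_hom_smult[OF assms(2)])
qed

text \<open>Equality of two images is the same condition on coordinates for \<open>F\<close> and for
  \<open>G\<close>, so \<open>F c \<mapsto> G c\<close> is well defined and injective. It is
  evaluated on a chosen coordinate vector of each element.\<close>

lemma presents_isomorphic:
  fixes M :: "('k::field series, 'm) module"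
  assumes M: "presents M I lam F" and N: "presents N I lam G"
  shows "module_isomorphic novikov_univ0 M N"
proof -
  note p = presentsD[OF M] and q = presentsD[OF N]
  let ?D = "I \<rightarrow> (carrier novikov_univ0 :: 'k series set)"
  define rep where "rep x = (SOME c. c \<in> ?D \<and> F c = x)" for x
  have rep: "rep x \<in> ?D \<and> F (rep x) = x" if "x \<in> carrier M" for x
  proof -
    have "\<exists>c. c \<in> ?D \<and> F c = x" using that unfolding p(1)[symmetric] by blast
    then show ?thesis unfolding rep_def by (rule someI_ex)
  qed
  have same: "F c = F c' \<longleftrightarrow> G c = G c'" if "c \<in> ?D" "c' \<in> ?D" for c c'
    using p(4) q(4) that by simp
  define f where "f x = G (rep x)" for x
  have fF: "f (F c) = G c" if "c \<in> ?D" for c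
  proof -
    have "F c \<in> carrier M" unfolding p(1)[symmetric] using that by (rule imageI)
    from rep[OF this] that show ?thesis unfolding f_def by (simp only: same[symmetric])
  qed
  have surj: "\<exists>c\<in>?D. x = F c" if "x \<in> carrier M" for x
    using that unfolding p(1)[symmetric] by blast
  have "f \<in> module_hom novikov_univ0 M N"
    unfolding module_hom_def
  proof (intro CollectI conjI allI impI; (elim conjE)?)
    show "f \<in> carrier M \<rightarrow> carrier N"
    proof
      fix x assume "x \<in> carrier M"
      then obtain c where c: "c \<in> ?D" "x = F c" using surj by blast
      then show "f x \<in> carrier N" unfolding q(1)[symmetric] by (simp only: fF) (rule imageI)
    qed
    fix x y assume "x \<in> carrier M" "y \<in> carrier M"
    then obtain c c' where c: "c \<in> ?D" "x = F c" "c' \<in> ?D" "y = F c'" using surj by blast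
    then have "(\<lambda>i x. c i x + c' i x) \<in> ?D" by (auto intro!: add_closed_univ0)
    then have "f (F (\<lambda>i x. c i x + c' i x)) = G c \<oplus>\<^bsub>N\<^esub> G c'" using c q(2) fF by simp
    then show "f (x \<oplus>\<^bsub>M\<^esub> y) = f x \<oplus>\<^bsub>N\<^esub> f y" using c p(2) fF by simp
  next
    fix r :: "'k series" and x assume r: "r \<in> carrier novikov_univ0" and "x \<in> carrier M"
    then obtain c where c: "c \<in> ?D" "x = F c" using surj by blast
    then have "(\<lambda>i. mult novikov_univ r (c i)) \<in> ?D" using r by (auto intro!: mult_closed_univ0)
    then have "f (F (\<lambda>i. mult novikov_univ r (c i))) = r \<odot>\<^bsub>N\<^esub> G c" using c r q(3) fF by simp
    then show "f (r \<odot>\<^bsub>M\<^esub> x) = r \<odot>\<^bsub>N\<^esub> f x" using c r p(3) fF by simp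
  qed
  moreover have "bij_betw f (carrier M) (carrier N)"
    unfolding bij_betw_def
  proof
    show "inj_on f (carrier M)"
    proof (rule inj_onI)
      fix x y assume "x \<in> carrier M" "y \<in> carrier M" "f x = f y"
      moreover then obtain c c' where "c \<in> ?D" "x = F c" "c' \<in> ?D" "y = F c'" using surj by blast
      ultimately show "x = y" using same fF by simp
    qed
    have "f ` carrier M = f ` F ` ?D" using p(1) by simp
    also have "\<dots> = G ` ?D" using fF by (simp add: image_image)
    finally show "f ` carrier M = carrier N" using q(1) by simp
  qed
  ultimately show ?thesis unfolding module_isomorphic_def by blast
qed

text \<open>A summand with exponent at most 0 vanishes, because elements of the valuation ring have
  valuation \<ge> 0. Such summands come from gaps equal to 0 and have to go before a comparison with
  the positive exponents that \<open>torsion_exponent\<close> asks for.\<close>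

lemma presents_reindex:
  fixes M :: "('k::field series, 'm) module" and I :: "'i set" and I' :: "'j set"
  assumes M: "presents M I lam F" and g: "bij_betw g I' {i \<in> I. lam i > 0}"
  shows "\<exists>G. presents M I' (lam \<circ> g) G"
proof -
  note p = presentsD[OF M]
  let ?D = "I \<rightarrow> (carrier novikov_univ0 :: 'k series set)" and ?D' = "I' \<rightarrow> (carrier novikov_univ0 :: 'k series set)"
  define h where "h = inv_into I' g"
  have inj: "inj_on g I'" and img: "g ` I' = {i \<in> I. lam i > 0}" using g by (auto simp: bij_betw_def)
  have hg: "h (g i) = i" if "i \<in> I'" for i using inj that by (simp add: h_def)
  have gI: "g i \<in> I" "lam (g i) > 0" if "i \<in> I'" for i using img that by auto
  have h: "h i \<in> I'" "g (h i) = i" if "i \<in> I" "lam i > 0" for i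
    using img that inv_into_into[of i g I'] f_inv_into_f[of i g I'] by (auto simp: h_def)
  define E :: "('j \<Rightarrow> 'k series) \<Rightarrow> 'i \<Rightarrow> 'k series" where "E c = (\<lambda>i. if lam i > 0 then c (h i) else (\<lambda>x. 0 :: 'k))" for c
  have Ec: "E c \<in> ?D" if "c \<in> ?D'" for c
    using that h by (auto simp: E_def zero_closed_univ0 Pi_iff)
  have low: "lam i \<le> nu f" if "\<not> lam i > 0" "f \<in> carrier novikov_univ0" for f :: "'k series" and i
    using that ereal_le_nu_iff[of 0 f] carrier_novikov_univ0[of f] by (auto simp: zero_ereal_def)
  have sub: "(\<lambda>x. f x - f' x) \<in> carrier novikov_univ0"
    if "f \<in> carrier novikov_univ0" "f' \<in> carrier novikov_univ0" for f f' :: "'k series"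
  proof -
    have "(\<lambda>x. - f' x) \<in> carrier novikov_univ0"
      using that by (simp add: carrier_novikov_univ0 carrier_novikov_univ)
    then show ?thesis using add_closed_univ0[OF that(1)] by fastforce
  qed
  have "presents M I' (lam \<circ> g) (F \<circ> E)"
    unfolding presents_def
  proof (intro conjI ballI)
    show "(F \<circ> E) ` ?D' = carrier M"
    proof
      show "(F \<circ> E) ` ?D' \<subseteq> carrier M" unfolding p(1)[symmetric] using Ec by (auto simp del: Pi_iff)
      show "carrier M \<subseteq> (F \<circ> E) ` ?D'"
      proof
        fix x assume "x \<in> carrier M"
        then obtain c where c: "c \<in> ?D" "x = F c" unfolding p(1)[symmetric] by (rule imageE)
        have cg: "c \<circ> g \<in> ?D'" using c gI by auto
        \<comment> \<open>\<open>c\<close> and its truncation differ only at discarded summands,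
          where every difference has sufficiently large valuation.\<close>
        have "F (E (c \<circ> g)) = F c"
        proof (subst p(4)[OF Ec[OF cg] c(1)], intro ballI)
          fix i assume i: "i \<in> I"
          show "lam i \<le> nu (\<lambda>x. E (c \<circ> g) i x - c i x)"
          proof (cases "lam i > 0")
            case True
            then show ?thesis using h[OF i] by (simp add: E_def)
          next
            case False
            have "E (c \<circ> g) i \<in> carrier novikov_univ0" "c i \<in> carrier novikov_univ0"
              using Ec[OF cg] c i by auto
            then show ?thesis by (intro low[OF False] sub)
          qed
        qed
        then have "x = (F \<circ> E) (c \<circ> g)" using c(2) by simp
        then show "x \<in> (F \<circ> E) ` ?D'" using cg by (rule image_eqI)
      qed
    qed
  next
    fix c c' assume c: "c \<in> ?D'" "c' \<in> ?D'"
    have "E (\<lambda>i x. c i x + c' i x) = (\<lambda>i x. E c i x + E c' i x)" by (auto simp: E_def)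
    then show "(F \<circ> E) (\<lambda>i x. c i x + c' i x) = (F \<circ> E) c \<oplus>\<^bsub>M\<^esub> (F \<circ> E) c'"
      using p(2)[OF Ec Ec] c by simp
    have "(F (E c) = F (E c')) \<longleftrightarrow> (\<forall>i\<in>I. lam i \<le> nu (\<lambda>x. E c i x - E c' i x))"
      using p(4)[OF Ec Ec] c by simp
    also have "\<dots> \<longleftrightarrow> (\<forall>i\<in>I. lam i > 0 \<longrightarrow> lam i \<le> nu (\<lambda>x. c (h i) x - c' (h i) x))"
    proof (rule ball_cong[OF refl])
      fix i assume i: "i \<in> I"
      show "(lam i \<le> nu (\<lambda>x. E c i x - E c' i x)) = (0 < lam i \<longrightarrow> lam i \<le> nu (\<lambda>x. c (h i) x - c' (h i) x))"
      proof (cases "lam i > 0")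
        case False
        have "E c i \<in> carrier novikov_univ0" "E c' i \<in> carrier novikov_univ0" 
          using Ec c i by auto
        then have "lam i \<le> nu (\<lambda>x. E c i x - E c' i x)" by (intro low[OF False] sub)
        then show ?thesis using False by simp
      qed (simp add: E_def)
    qed
    also have "\<dots> \<longleftrightarrow> (\<forall>i\<in>g ` I'. lam i \<le> nu (\<lambda>x. c (h i) x - c' (h i) x))"
      unfolding img by blast
    also have "\<dots> \<longleftrightarrow> (\<forall>i\<in>I'. (lam \<circ> g) i \<le> nu (\<lambda>x. c i x - c' i x))"
      by (simp add: hg)
    finally show "((F \<circ> E) c = (F \<circ> E) c') = (\<forall>i\<in>I'. (lam \<circ> g) i \<le> nu (\<lambda>x. c i x - c' i x))"
      by simp
  next
    fix r :: "'k series" and c assume r: "r \<in> carrier novikov_univ0" and c: "c \<in> ?D'"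
    have "mult novikov_univ r (\<lambda>x. 0) = (\<lambda>x. 0)"
    proof -
      interpret cring "novikov_univ :: 'k series ring" by (rule cring_novikov_univ)
      show ?thesis using r_null[of r] r by (simp add: univ0_subset)
    qed
    then have "E (\<lambda>i. mult novikov_univ r (c i)) = (\<lambda>i. mult novikov_univ r (E c i))"
      by (auto simp: E_def)
    then show "(F \<circ> E) (\<lambda>i. mult novikov_univ r (c i)) = r \<odot>\<^bsub>M\<^esub> (F \<circ> E) c"
      using p(3)[OF r Ec[OF c]] by simp
  qed
  then show ?thesis by blast
qed

text \<open>Multiplying by \<open>T\<^sup>a\<close> kills the summands with \<open>\<lambda> i \<le> a\<close>, and the coefficients at \<open>a\<close> of the
  remaining coordinates map \<open>T\<^sup>a M\<close> onto a \<open>\<K>\<close>-vector space. Images of the generators of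
  another presentation span it.\<close>

lemma presents_card_le:
  fixes M :: "('k::field series, 'm) module" and I :: "'i set" and I' :: "'j set"
  assumes M: "presents M I lam F" and N: "presents M I' lam' G"
    and fin: "finite I" "finite I'" and a: "a \<ge> 0"
  shows "card {i \<in> I. lam i > ereal a} \<le> card {i \<in> I'. lam' i > ereal a}"
proof -
  note p = presentsD[OF M] and q = presentsD[OF N]
  interpret S: cring "novikov_univ :: 'k series ring" by (rule cring_novikov_univ)
  let ?R = "carrier novikov_univ0 :: 'k series set" and ?m = "mult (novikov_univ :: 'k series ring)"
  let ?A = "{i \<in> I. lam i > ereal a}" and ?B = "{i \<in> I'. lam' i > ereal a}"
  have null: "?m r (\<lambda>x. 0) = (\<lambda>x. 0)" "?m (\<lambda>x. 0) r = (\<lambda>x. 0)" if "r \<in> ?R" for r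
    using S.r_null[of r] S.l_null[of r] that by (simp_all add: univ0_subset)
  have one: "?m r (T_power 0) = r" if "r \<in> ?R" for r
    using S.r_one[of r] that by (simp add: univ0_subset)
  \<comment> \<open>Unit vectors of the second presentation; \<open>u i\<close> below gives the same
    generator in coordinates of the first. The constant terms \<open>u j i 0\<close> are the entries
    of the vectors that will turn out to span.\<close>
  define e :: "'j \<Rightarrow> 'j \<Rightarrow> 'k series" where "e i j = (if j = i then T_power 0 else (\<lambda>x. 0))" for i j
  have e: "e i \<in> I' \<rightarrow> ?R" for i by (auto simp: e_def T_power_closed_univ0 zero_closed_univ0)
  have "\<exists>u. u \<in> I \<rightarrow> ?R \<and> F u = G (e i)" for i
  proof -
    have "G (e i) \<in> carrier M" using presents_closed[OF N e] .
    then show ?thesis by (rule presents_coordinates[OF M]) blast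
  qed
  then obtain u where u: "\<And>i. u i \<in> I \<rightarrow> ?R" and Fu: "\<And>i. F (u i) = G (e i)" by metis
  have FG: "F (\<lambda>k x. \<Sum>j\<in>B. ?m (c j) (u j k) x) = G (\<lambda>j. if j \<in> B then c j else (\<lambda>x. 0))"
    if "finite B" "c \<in> B \<rightarrow> ?R" for B c
    using that
  proof (induction B rule: finite_induct)
    case empty
    let ?z = "\<lambda>_. (\<lambda>x. 0 :: 'k)"
    have z: "?z \<in> I' \<rightarrow> ?R" "?z \<in> I \<rightarrow> ?R" using zero_closed_univ0 by auto
    obtain w where w: "w \<in> I \<rightarrow> ?R" "F w = G ?z"
      using presents_coordinates[OF M presents_closed[OF N z(1)]] by blast
    \<comment> \<open>\<open>presents\<close> has no clause for zero, so the two images of the zero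
      vector are compared by multiplying one common element by the scalar 0.\<close>
    have "F (\<lambda>i. ?m (\<lambda>x. 0) (w i)) = G (\<lambda>i. ?m (\<lambda>x. 0) (\<lambda>x. 0))"
      using p(3)[OF zero_closed_univ0 w(1)] q(3)[OF zero_closed_univ0 z(1)] w(2) by simp
    moreover have "F (\<lambda>i. ?m (\<lambda>x. 0) (w i)) = F ?z"
    proof (subst p(4))
      show "(\<lambda>i. ?m (\<lambda>x. 0) (w i)) \<in> I \<rightarrow> ?R"
        using w zero_closed_univ0 by (auto intro!: mult_closed_univ0 simp: Pi_iff)
    qed (use w z in \<open>auto simp: null Pi_iff\<close>)
    ultimately show ?case using null[OF zero_closed_univ0] by simp
  next
    case (insert i B)
    have ci: "c i \<in> ?R" and cB: "c \<in> B \<rightarrow> ?R" using insert.prems by auto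
    have "F (\<lambda>k x. \<Sum>j\<in>insert i B. ?m (c j) (u j k) x) =
        F (\<lambda>k x. ?m (c i) (u i k) x + (\<Sum>j\<in>B. ?m (c j) (u j k) x))"
      using insert by simp
    also have "\<dots> = F (\<lambda>k. ?m (c i) (u i k)) \<oplus>\<^bsub>M\<^esub> F (\<lambda>k x. \<Sum>j\<in>B. ?m (c j) (u j k) x)"
      by (rule p(2)) (use ci cB u in \<open>auto intro!: mult_closed_univ0 sum_closed_univ0 simp: Pi_iff\<close>)
    also have "\<dots> = G (\<lambda>k. ?m (c i) (e i k)) \<oplus>\<^bsub>M\<^esub> G (\<lambda>j. if j \<in> B then c j else (\<lambda>x. 0))"
      using insert.IH[OF cB] p(3)[OF ci u] q(3)[OF ci e] Fu by simp
    also have "\<dots> = G (\<lambda>k x. ?m (c i) (e i k) x + (if k \<in> B then c k else (\<lambda>x. 0)) x)"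
      by (rule q(2)[symmetric]) (use ci cB e in \<open>auto intro!: mult_closed_univ0 zero_closed_univ0 simp: Pi_iff\<close>)
    also have "(\<lambda>k x. ?m (c i) (e i k) x + (if k \<in> B then c k else (\<lambda>x. 0)) x) =
        (\<lambda>j. if j \<in> insert i B then c j else (\<lambda>x. 0))"
      using insert.hyps ci by (auto simp: fun_eq_iff e_def one null)
    finally show ?case .
  qed
  have Ta: "T_power a \<in> ?R" using a by (rule T_power_closed_univ0)
  have span: "\<exists>b. \<forall>i\<in>?A. (c i :: 'k) = (\<Sum>j\<in>?B. b j * u j i 0)" for c
  proof -
    \<comment> \<open>The given scalars are read as constant series. The element \<open>F C\<close>
      is then rewritten in the second presentation, where its coordinates are
      \<open>c'\<close>.\<close>
    define C :: "'i \<Rightarrow> 'k series" where "C i = (\<lambda>x. c i * T_power 0 x)" for i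
    have C: "C \<in> I \<rightarrow> ?R"
    proof
      fix i
      have "finite {g. g < x \<and> C i g \<noteq> 0}" for x
        by (rule finite_subset[of _ "{0}"]) (auto simp: C_def T_power_def split: if_splits)
      then show "C i \<in> ?R" by (simp add: carrier_novikov_univ0 carrier_novikov_univ) (simp add: C_def T_power_def)
    qed
    obtain c' where c': "c' \<in> I' \<rightarrow> ?R" "G c' = F C"
      using presents_coordinates[OF N presents_closed[OF M C]] by blast
    let ?Tc = "\<lambda>j. ?m (T_power a) (c' j)"
    have Tc: "?Tc \<in> I' \<rightarrow> ?R" and TC: "(\<lambda>i. ?m (T_power a) (C i)) \<in> I \<rightarrow> ?R"
      using c' C Ta by (auto intro!: mult_closed_univ0 simp: Pi_iff)
    have W: "(\<lambda>k x. \<Sum>j\<in>?B. ?m (?Tc j) (u j k) x) \<in> I \<rightarrow> ?R"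
      using c' Ta u by (auto intro!: mult_closed_univ0 sum_closed_univ0 simp: Pi_iff)
    have "F (\<lambda>i. ?m (T_power a) (C i)) = G ?Tc"
      using p(3)[OF Ta C] q(3)[OF Ta c'(1)] c'(2) by simp
    \<comment> \<open>After multiplication by the power of T every coordinate has valuation at least
      \<open>a\<close>, so coordinates at exponents \<le> a may be replaced by 0 without changing
      the element.\<close>
    also have "\<dots> = G (\<lambda>j. if j \<in> ?B then ?Tc j else (\<lambda>x. 0))"
    proof (subst q(4)[OF Tc])
      show "(\<lambda>j. if j \<in> ?B then ?Tc j else (\<lambda>x. 0)) \<in> I' \<rightarrow> ?R"
        using Tc zero_closed_univ0 by (auto simp: Pi_iff)
      show "\<forall>i\<in>I'. lam' i \<le> nu (\<lambda>x. ?Tc i x - (if i \<in> ?B then ?Tc i else (\<lambda>x. 0)) x)"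
      proof
        fix i assume i: "i \<in> I'"
        show "lam' i \<le> nu (\<lambda>x. ?Tc i x - (if i \<in> ?B then ?Tc i else (\<lambda>x. 0)) x)"
        proof (cases "i \<in> ?B")
          case False
          have "\<forall>x<0. c' i x = 0" using c' i by (auto simp: Pi_iff carrier_novikov_univ0)
          then have "ereal a \<le> nu (?Tc i)" by (simp add: ereal_le_nu_iff T_power_mult)
          then show ?thesis using False i by auto
        qed simp
      qed
    qed
    also have "\<dots> = F (\<lambda>k x. \<Sum>j\<in>?B. ?m (?Tc j) (u j k) x)"
      by (rule FG[symmetric]) (use fin Tc in auto)
    finally have le: "\<forall>i\<in>I. lam i \<le> nu (\<lambda>x. ?m (T_power a) (C i) x - (\<Sum>j\<in>?B. ?m (?Tc j) (u j i) x))"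
      using p(4)[OF TC W] by blast
    show ?thesis
    \<comment> \<open>The constant terms of \<open>c'\<close> are the coefficients of the wanted
      combination; comparing coefficients at exponent \<open>a\<close> exhibits them.\<close>
    proof (intro exI[of _ "\<lambda>j. c' j 0"] ballI)
      fix i assume i: "i \<in> ?A"
      then have "ereal a < nu (\<lambda>x. ?m (T_power a) (C i) x - (\<Sum>j\<in>?B. ?m (?Tc j) (u j i) x))"
        using le by (auto intro: less_le_trans)
      \<comment> \<open>A real bound strictly above \<open>a\<close> makes the difference vanish at
        \<open>a\<close> itself, also when its valuation is infinite.\<close>
      then obtain b where b: "ereal a < ereal b"
          "ereal b < nu (\<lambda>x. ?m (T_power a) (C i) x - (\<Sum>j\<in>?B. ?m (?Tc j) (u j i) x))"
        by (blast dest: ereal_dense2)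
      then have "a < b" "ereal b \<le> nu (\<lambda>x. ?m (T_power a) (C i) x - (\<Sum>j\<in>?B. ?m (?Tc j) (u j i) x))"
        by simp_all
      then have "?m (T_power a) (C i) a = (\<Sum>j\<in>?B. ?m (?Tc j) (u j i) a)"
        by (simp add: ereal_le_nu_iff)
      moreover have "?m (?Tc j) (u j i) a = c' j 0 * u j i 0" if "j \<in> ?B" for j
      proof -
        have "u j i \<in> ?R" "\<forall>x<0. c' j x = 0"
          using u i c' that by (auto simp: Pi_iff carrier_novikov_univ0)
        then show ?thesis
          by (subst mult_comm_series, subst univ0_coeff_mult) (simp_all add: T_power_mult mult.commute)
      qed
      ultimately show "c i = (\<Sum>j\<in>?B. c' j 0 * u j i 0)"
        by (simp add: T_power_mult C_def) (simp add: T_power_def)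
    qed
  qed
  show ?thesis by (rule card_le_of_spanning[OF _ _ span]) (use fin in auto)
qed

subsection \<open>Quotients and the standard modules\<close>

lemma quot_module_facts:
  fixes G (structure)
  assumes G: "abelian_group G" and N: "subgroup N (add_monoid G)"
  shows quot_coset_eq_iff:
      "\<And>x y. x \<in> carrier G \<Longrightarrow> y \<in> carrier G \<Longrightarrow> N +> x = N +> y \<longleftrightarrow> x \<ominus> y \<in> N"
    and quot_coset_add:
      "\<And>x y. x \<in> carrier G \<Longrightarrow> y \<in> carrier G \<Longrightarrow>
        (N +> x) \<oplus>\<^bsub>quot_module G N\<^esub> (N +> y) = N +> (x \<oplus> y)"
    and quot_carrier: "carrier (quot_module G N) = (\<lambda>x. N +> x) ` carrier G"
proof -
  interpret abelian_subgroup N G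
    by (intro abelian_subgroupI3 additive_subgroupI G N)
  show "N +> x = N +> y \<longleftrightarrow> x \<ominus> y \<in> N" if x: "x \<in> carrier G" and y: "y \<in> carrier G" for x y
  proof
    assume "N +> x = N +> y"
    then have "x \<in> N +> y" using a_rcos_self[OF x] by simp
    then show "x \<ominus> y \<in> N" using a_rcos_module_imp[OF y] by (simp add: minus_eq)
  next
    assume "x \<ominus> y \<in> N"
    then have "x \<in> N +> y" using a_rcos_module_rev[OF y x] by (simp add: minus_eq)
    then show "N +> x = N +> y" using a_repr_independence[OF _ y a_subgroup] by simp
  qed
  show "(N +> x) \<oplus>\<^bsub>quot_module G N\<^esub> (N +> y) = N +> (x \<oplus> y)"
    if "x \<in> carrier G" "y \<in> carrier G" for x y
    using a_rcos_sum[OF that] by (simp add: quot_module_def)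
  show "carrier (quot_module G N) = (\<lambda>x. N +> x) ` carrier G"
    by (auto simp: quot_module_def A_RCOSETS_def')
qed

text \<open>Multiplication by \<open>r\<close> preserves \<open>N\<close>, so all members of a coset
  are sent to the same coset and the union in \<open>quot_module\<close> collapses.\<close>

lemma quot_coset_smult:
  fixes G (structure)
  assumes G: "abelian_group G" and N: "subgroup N (add_monoid G)"
    and cl: "\<And>x. x \<in> carrier G \<Longrightarrow> r \<odot>\<^bsub>G\<^esub> x \<in> carrier G"
    and distr: "\<And>x y. x \<in> carrier G \<Longrightarrow> y \<in> carrier G \<Longrightarrow>
      r \<odot>\<^bsub>G\<^esub> (x \<oplus> y) = r \<odot>\<^bsub>G\<^esub> x \<oplus> r \<odot>\<^bsub>G\<^esub> y"
    and rN: "\<And>x. x \<in> N \<Longrightarrow> r \<odot>\<^bsub>G\<^esub> x \<in> N"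
    and x: "x \<in> carrier G"
  shows "r \<odot>\<^bsub>quot_module G N\<^esub> (N +> x) = N +> (r \<odot>\<^bsub>G\<^esub> x)"
proof -
  interpret abelian_subgroup N G
    by (intro abelian_subgroupI3 additive_subgroupI G N)
  have "N +> (r \<odot>\<^bsub>G\<^esub> y) = N +> (r \<odot>\<^bsub>G\<^esub> x)" if y: "y \<in> N +> x" for y
  proof -
    obtain n where n: "n \<in> N" "y = n \<oplus> x" using y by (auto simp: a_r_coset_def')
    have nG: "n \<in> carrier G" using n a_subset by auto
    have "r \<odot>\<^bsub>G\<^esub> y = r \<odot>\<^bsub>G\<^esub> n \<oplus> r \<odot>\<^bsub>G\<^esub> x" using n nG x distr by simp
    then have "r \<odot>\<^bsub>G\<^esub> y \<in> N +> (r \<odot>\<^bsub>G\<^esub> x)" using rN[OF n(1)] by (auto simp: a_r_coset_def')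
    then show ?thesis using a_repr_independence[OF _ cl[OF x] a_subgroup] by simp
  qed
  then have "(\<Union>y\<in>N +> x. N +> (r \<odot>\<^bsub>G\<^esub> y)) = (\<Union>y\<in>N +> x. N +> (r \<odot>\<^bsub>G\<^esub> x))"
    by (intro SUP_cong refl)
  also have "\<dots> = N +> (r \<odot>\<^bsub>G\<^esub> x)" using a_rcos_self[OF x] by auto
  finally show ?thesis by (simp add: quot_module_def)
qed

text \<open>The conditions on scalar multiplication range over the valuation ring only, because the
  unit ball to which this is applied inherits its operations from a module over the universal field
  and is not closed under that field.\<close>

lemma presents_quotient:
  fixes G (structure) and E :: "('i \<Rightarrow> 'k::field series) \<Rightarrow> 'm"
  assumes G: "abelian_group G" and N: "subgroup N (add_monoid G)"
    and cl: "\<And>r x. r \<in> carrier novikov_univ0 \<Longrightarrow> x \<in> carrier G \<Longrightarrow> r \<odot>\<^bsub>G\<^esub> x \<in> carrier G"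
    and distr: "\<And>r x y. r \<in> carrier novikov_univ0 \<Longrightarrow> x \<in> carrier G \<Longrightarrow> y \<in> carrier G \<Longrightarrow>
      r \<odot>\<^bsub>G\<^esub> (x \<oplus> y) = r \<odot>\<^bsub>G\<^esub> x \<oplus> r \<odot>\<^bsub>G\<^esub> y"
    and rN: "\<And>r x. r \<in> carrier novikov_univ0 \<Longrightarrow> x \<in> N \<Longrightarrow> r \<odot>\<^bsub>G\<^esub> x \<in> N"
    and surj: "E ` (I \<rightarrow> carrier novikov_univ0) = carrier G"
    and add: "\<And>c c'. c \<in> I \<rightarrow> carrier novikov_univ0 \<Longrightarrow> c' \<in> I \<rightarrow> carrier novikov_univ0 \<Longrightarrow>
      E (\<lambda>i x. c i x + c' i x) = E c \<oplus> E c'"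
    and smult: "\<And>r c. r \<in> carrier novikov_univ0 \<Longrightarrow> c \<in> I \<rightarrow> carrier novikov_univ0 \<Longrightarrow>
      E (\<lambda>i. mult novikov_univ r (c i)) = r \<odot>\<^bsub>G\<^esub> E c"
    and ker: "\<And>c c'. c \<in> I \<rightarrow> carrier novikov_univ0 \<Longrightarrow> c' \<in> I \<rightarrow> carrier novikov_univ0 \<Longrightarrow>
      E c \<ominus> E c' \<in> N \<longleftrightarrow> (\<forall>i\<in>I. lam i \<le> nu (\<lambda>x. c i x - c' i x))"
  shows "presents (quot_module G N) I lam (\<lambda>c. N +> E c)"
proof -
  have EG: "E c \<in> carrier G" if "c \<in> I \<rightarrow> carrier novikov_univ0" for c
    unfolding surj[symmetric] using that by (rule imageI)
  show ?thesis
    unfolding presents_def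
  proof (intro conjI ballI)
    show "(\<lambda>c. N +> E c) ` (I \<rightarrow> carrier novikov_univ0) = carrier (quot_module G N)"
      unfolding quot_carrier[OF G N] surj[symmetric] by (simp add: image_image)
  next
    fix c c' assume c: "c \<in> I \<rightarrow> carrier (novikov_univ0 :: 'k series ring)"
      "c' \<in> I \<rightarrow> carrier (novikov_univ0 :: 'k series ring)"
    show "N +> E (\<lambda>i x. c i x + c' i x) = (N +> E c) \<oplus>\<^bsub>quot_module G N\<^esub> (N +> E c')"
      by (simp only: quot_coset_add[OF G N] EG c add)
    show "(N +> E c = N +> E c') = (\<forall>i\<in>I. lam i \<le> nu (\<lambda>x. c i x - c' i x))"
      by (simp only: quot_coset_eq_iff[OF G N] EG c ker)
  next
    fix r c assume r: "r \<in> carrier (novikov_univ0 :: 'k series ring)"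
      and c: "c \<in> I \<rightarrow> carrier (novikov_univ0 :: 'k series ring)"
    show "N +> E (\<lambda>i. mult novikov_univ r (c i)) = r \<odot>\<^bsub>quot_module G N\<^esub> (N +> E c)"
      unfolding smult[OF r c]
      by (rule quot_coset_smult[OF G N, symmetric]) (use cl distr rN r EG c in auto)
  qed
qed

lemma self_module_simps [simp]:
  "carrier (self_module R) = carrier R" "add (self_module R) = add R"
  "zero (self_module R) = zero R" "smult (self_module R) = mult R"
  by (simp_all add: self_module_def)

lemma abelian_group_self_module:
  fixes R (structure)
  assumes "abelian_group R" shows "abelian_group (self_module R)"
proof -
  interpret abelian_group R by fact
  show ?thesis
    by (rule abelian_groupI) (auto simp: a_ac intro: bexI[of _ "\<ominus> x" for x] l_neg)
qed

lemma (in abelian_group) add_subgroupI: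
  assumes "N \<subseteq> carrier G" "\<zero> \<in> N"
    and "\<And>x y. x \<in> N \<Longrightarrow> y \<in> N \<Longrightarrow> x \<oplus> y \<in> N" "\<And>x. x \<in> N \<Longrightarrow> \<ominus> x \<in> N"
  shows "subgroup N (add_monoid G)"
  using assms by (intro subgroup.intro) (auto simp: a_inv_def)

text \<open>Dividing by a power of T shifts the exponents down by \<open>a\<close>; the result lies
  in the valuation ring exactly when there is nothing below \<open>a\<close>.\<close>

lemma T_power_dvd_iff:
  assumes f: "f \<in> carrier novikov_univ" and a: "a \<ge> 0"
  shows "f \<in> PIdl\<^bsub>novikov_univ0\<^esub> (T_power a) \<longleftrightarrow> ereal a \<le> nu f"
proof
  assume "f \<in> PIdl\<^bsub>novikov_univ0\<^esub> (T_power a)"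
  then obtain g where "g \<in> carrier novikov_univ0" "f = mult novikov_univ g (T_power a)"
    by (auto simp: cgenideal_def)
  then show "ereal a \<le> nu f"
    by (simp add: mult_comm_series[of _ g] T_power_mult ereal_le_nu_iff carrier_novikov_univ0)
next
  assume le: "ereal a \<le> nu f"
  define g where "g = (\<lambda>x. f (x - (- a)))"
  have "g \<in> carrier novikov_univ0"
    using le shift_closed[OF f, of "-a"] by (simp add: carrier_novikov_univ0 ereal_le_nu_iff g_def)
  moreover have "f = mult novikov_univ g (T_power a)"
    unfolding mult_comm_series[of UNIV g "T_power a"] T_power_mult by (simp add: g_def)
  ultimately show "f \<in> PIdl\<^bsub>novikov_univ0\<^esub> (T_power a)" by (auto simp: cgenideal_def)
qed

lemma cyclic_quotient_facts:
  fixes a :: real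
  defines "N \<equiv> PIdl\<^bsub>novikov_univ0\<^esub> (T_power a :: 'k::field series)"
  defines "Q \<equiv> quot_module (self_module novikov_univ0) N"
  defines "cs \<equiv> (\<lambda>f. N +>\<^bsub>self_module novikov_univ0\<^esub> f)"
  assumes a: "a \<ge> 0"
  shows "\<And>f h. f \<in> carrier novikov_univ0 \<Longrightarrow> h \<in> carrier novikov_univ0 \<Longrightarrow>
      cs f = cs h \<longleftrightarrow> ereal a \<le> nu (\<lambda>x. f x - h x)"
    and "\<And>f h. f \<in> carrier novikov_univ0 \<Longrightarrow> h \<in> carrier novikov_univ0 \<Longrightarrow>
      cs f \<oplus>\<^bsub>Q\<^esub> cs h = cs (\<lambda>x. f x + h x)"
    and "carrier Q = cs ` carrier novikov_univ0"
    and "\<And>r f. r \<in> carrier novikov_univ0 \<Longrightarrow> f \<in> carrier novikov_univ0 \<Longrightarrow>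
      r \<odot>\<^bsub>Q\<^esub> cs f = cs (mult novikov_univ r f)"
proof -
  let ?R = "novikov_univ0 :: 'k series ring"
  let ?G = "self_module ?R"
  interpret R: cring ?R by (rule cring_novikov_univ0)
  have G: "abelian_group ?G" by (rule abelian_group_self_module) (rule R.abelian_group_axioms)
  interpret I: ideal N ?R
    unfolding N_def by (rule R.cgenideal_ideal) (rule T_power_closed_univ0[OF a])
  interpret G: abelian_group ?G by (rule G)
  have uminus: "\<ominus>\<^bsub>?G\<^esub> h = (\<lambda>x. - h x)" if "h \<in> carrier ?R" for h
    by (rule G.minus_equality) (use that in \<open>auto simp: carrier_novikov_univ0 carrier_novikov_univ\<close>)
  have uminus': "\<ominus>\<^bsub>?R\<^esub> h = (\<lambda>x. - h x)" if "h \<in> carrier ?R" for h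
    by (rule R.minus_equality) (use that in \<open>auto simp: carrier_novikov_univ0 carrier_novikov_univ\<close>)
  have N: "subgroup N (add_monoid ?G)"
  proof (rule G.add_subgroupI)
    show "\<ominus>\<^bsub>?G\<^esub> x \<in> N" if "x \<in> N" for x
      using I.a_inv_closed[OF that] I.a_subset that by (auto simp: uminus uminus')
  qed (use I.a_subset I.a_closed I.zero_closed in auto)
  have minus: "f \<ominus>\<^bsub>?G\<^esub> h = (\<lambda>x. f x - h x)" if "f \<in> carrier ?R" "h \<in> carrier ?R" for f h
    using that by (simp add: a_minus_def uminus)
  have minus_cl: "(\<lambda>x. f x - h x) \<in> carrier novikov_univ" if "f \<in> carrier ?R" "h \<in> carrier ?R" for f h
    using G.minus_closed[of f h] minus[OF that] that by (simp add: univ0_subset)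
  show "cs f = cs h \<longleftrightarrow> ereal a \<le> nu (\<lambda>x. f x - h x)" if "f \<in> carrier ?R" "h \<in> carrier ?R" for f h
    using quot_coset_eq_iff[OF G N, of f h] that T_power_dvd_iff[OF minus_cl[OF that] a]
    by (simp add: cs_def minus N_def)
  show "cs f \<oplus>\<^bsub>Q\<^esub> cs h = cs (\<lambda>x. f x + h x)" if "f \<in> carrier ?R" "h \<in> carrier ?R" for f h
    using quot_coset_add[OF G N, of f h] that by (simp add: cs_def Q_def)
  show "carrier Q = cs ` carrier ?R"
    using quot_carrier[OF G N] by (simp add: cs_def Q_def)
  show "r \<odot>\<^bsub>Q\<^esub> cs f = cs (mult novikov_univ r f)" if "r \<in> carrier ?R" "f \<in> carrier ?R" for r f
    using quot_coset_smult[OF G N, of r f] that I.I_l_closed[of _ r] R.r_distr[of _ _ r] R.m_closed[of r]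
    by (simp add: cs_def Q_def)
qed

lemma all_less_add:
  fixes m n :: nat
  shows "(\<forall>i\<in>{..<m + n}. P i) \<longleftrightarrow> (\<forall>i<m. P i) \<and> (\<forall>k<n. P (m + k))"
proof (intro iffI conjI ballI; (elim conjE)?)
  fix i assume i: "i \<in> {..<m + n}" and P: "\<forall>i<m. P i" "\<forall>k<n. P (m + k)"
  show "P i"
  proof (cases "i < m")
    case False
    then have "i = m + (i - m)" "i - m < n" using i by auto
    then show ?thesis using P(2) by metis
  qed (use P in blast)
qed auto

text \<open>The two blocks of the direct sum are put on one index set: indices below
  \<open>q\<close> are the free summands, the others point into \<open>ls\<close> after subtracting
  \<open>q\<close>.\<close>

lemma presents_standard_module:
  assumes ls: "\<forall>a\<in>set ls. a \<ge> 0"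
  shows "\<exists>F. presents (standard_module q ls :: ('k::field series, _) module) {..<q + length ls}
    (\<lambda>i. if i < q then \<infinity> else ereal (ls ! (i - q))) F"
proof -
  let ?S = "standard_module q ls :: ('k series, _) module"
  let ?R = "novikov_univ0 :: 'k series ring"
  interpret R: cring ?R by (rule cring_novikov_univ0)
  define N where "N k = PIdl\<^bsub>?R\<^esub> (T_power (ls ! k))" for k
  define cs where "cs k f = N k +>\<^bsub>self_module ?R\<^esub> f" for k f
  define Q where "Q k = quot_module (self_module ?R) (N k)" for k
  let ?D = "{..<q + length ls} \<rightarrow> carrier ?R"
  let ?lam = "\<lambda>i. if i < q then \<infinity> else ereal (ls ! (i - q))"
  note cyc = cyclic_quotient_facts[of "ls ! k" for k, where ?'k = 'k, folded N_def Q_def, folded cs_def]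
  have lsk: "ls ! k \<ge> 0" if "k < length ls" for k using ls that by simp
  define F where "F c = ((\<lambda>i\<in>{..<q}. c i), (\<lambda>k\<in>{..<length ls}. cs k (c (q + k))))" for c
  have std: "?S = direct_sum (R.func_space {..<q}) (direct_sum_family {..<length ls} Q)"
    unfolding standard_module_def Q_def[abs_def] N_def[abs_def] ..
  have cD: "c i \<in> carrier ?R" if "c \<in> ?D" "i < q + length ls" for c i using that by auto
  have "presents ?S {..<q + length ls} ?lam F"
    unfolding presents_def
  proof (intro conjI ballI)
    show "F ` ?D = carrier ?S"
    proof
      show "F ` ?D \<subseteq> carrier ?S"
      proof (rule image_subsetI)
        fix c assume c: "c \<in> ?D"
        have "cs k (c (q + k)) \<in> carrier (Q k)" if k: "k < length ls" for k
          unfolding cyc(3)[OF lsk[OF k]] by (rule imageI) (use c k in auto)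
        moreover have "restrict c {..<q} \<in> {..<q} \<rightarrow>\<^sub>E carrier ?R" using c by auto
        ultimately show "F c \<in> carrier ?S"
          by (simp add: F_def std direct_sum_def direct_sum_family_def R.func_space_def)
      qed
      show "carrier ?S \<subseteq> F ` ?D"
      proof
        fix y assume "y \<in> carrier ?S"
        then obtain u v where y: "y = (u, v)" and u: "u \<in> {..<q} \<rightarrow>\<^sub>E carrier ?R"
          and v: "v \<in> (\<Pi>\<^sub>E k\<in>{..<length ls}. carrier (Q k))"
          by (auto simp: std direct_sum_def direct_sum_family_def R.func_space_def)
        have "\<exists>w. w \<in> carrier ?R \<and> v k = cs k w" if "k < length ls" for k
        proof -
          have "v k \<in> carrier (Q k)" using v that by auto
          then show ?thesis unfolding cyc(3)[OF lsk[OF that]] by blast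
        qed
        then obtain w where w: "\<And>k. k < length ls \<Longrightarrow> w k \<in> carrier ?R"
          "\<And>k. k < length ls \<Longrightarrow> v k = cs k (w k)" by metis
        define c where "c i = (if i < q then u i else w (i - q))" for i
        have "c \<in> ?D" using u w by (auto simp: c_def)
        moreover have "F c = y"
          unfolding F_def y using u v w by (auto simp: c_def fun_eq_iff PiE_iff extensional_def)
        ultimately show "y \<in> F ` ?D" by blast
      qed
    qed
  next
    fix c c' assume c: "c \<in> ?D" "c' \<in> ?D"
    have "cs k (\<lambda>x. c (q + k) x + c' (q + k) x) = cs k (c (q + k)) \<oplus>\<^bsub>Q k\<^esub> cs k (c' (q + k))"
      if "k < length ls" for k
      using cyc(2)[OF lsk[OF that]] cD c that by simp
    then show "F (\<lambda>i x. c i x + c' i x) = F c \<oplus>\<^bsub>?S\<^esub> F c'"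
      by (simp add: F_def std direct_sum_def direct_sum_family_def R.func_space_def cong: restrict_cong)
    \<comment> \<open>For a free summand the threshold \<open>\<infinity>\<close> means equality: a
      valuation above every real bound forces all coefficients to vanish.\<close>
    have sub: "(\<lambda>x. c i x - c' i x) = (\<lambda>x. 0) \<longleftrightarrow> \<infinity> \<le> nu (\<lambda>x. c i x - c' i x)" if "i < q" for i
    proof
      assume "\<infinity> \<le> nu (\<lambda>x. c i x - c' i x)"
      then have "ereal r \<le> nu (\<lambda>x. c i x - c' i x)" for r by simp
      then show "(\<lambda>x. c i x - c' i x) = (\<lambda>x. 0)"
        unfolding ereal_le_nu_iff by (intro ext) (meson less_add_one)
    qed simp
    have "F c = F c' \<longleftrightarrow> (\<forall>i<q. c i = c' i) \<and> (\<forall>k<length ls. cs k (c (q + k)) = cs k (c' (q + k)))"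
      by (auto simp: F_def fun_eq_iff restrict_def)
    also have "\<dots> \<longleftrightarrow> (\<forall>i<q. ?lam i \<le> nu (\<lambda>x. c i x - c' i x)) \<and>
        (\<forall>k<length ls. ?lam (q + k) \<le> nu (\<lambda>x. c (q + k) x - c' (q + k) x))"
    proof (intro conj_cong all_cong)
      fix i assume "i < q"
      then show "c i = c' i \<longleftrightarrow> ?lam i \<le> nu (\<lambda>x. c i x - c' i x)"
        using sub[of i] by (auto simp: fun_eq_iff)
    next
      fix k assume "k < length ls"
      then show "cs k (c (q + k)) = cs k (c' (q + k)) \<longleftrightarrow> ?lam (q + k) \<le> nu (\<lambda>x. c (q + k) x - c' (q + k) x)"
        using cyc(1)[OF lsk] cD c by simp
    qed
    also have "\<dots> \<longleftrightarrow> (\<forall>i\<in>{..<q + length ls}. ?lam i \<le> nu (\<lambda>x. c i x - c' i x))"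
      by (rule all_less_add[symmetric])
    finally show "F c = F c' \<longleftrightarrow> (\<forall>i\<in>{..<q + length ls}. ?lam i \<le> nu (\<lambda>x. c i x - c' i x))" .
  next
    fix r c assume r: "r \<in> carrier ?R" and c: "c \<in> ?D"
    have "cs k (mult novikov_univ r (c (q + k))) = r \<odot>\<^bsub>Q k\<^esub> cs k (c (q + k))" if "k < length ls" for k
      using cyc(4)[OF lsk[OF that] r] cD c that by simp
    then show "F (\<lambda>i. mult novikov_univ r (c i)) = r \<odot>\<^bsub>?S\<^esub> F c"
      by (simp add: F_def std direct_sum_def direct_sum_family_def R.func_space_def cong: restrict_cong)
  qed
  then show ?thesis by blast
qed

subsection \<open>Invariance of the exponents\<close>

text \<open>In a decreasing list the entries above \<open>a\<close> form an initial segment. The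
  padding by 0 beyond the end of the list agrees with this since \<open>a \<ge> 0\<close>.\<close>

lemma sorted_desc_nth_gt_iff:
  fixes xs :: "real list"
  assumes "sorted_wrt (\<ge>) xs" "a \<ge> 0" "k > 0"
  shows "(if k \<le> length xs then xs ! (k - 1) else 0) > a \<longleftrightarrow> k \<le> length (filter (\<lambda>x. x > a) xs)"
  using assms
proof (induction xs arbitrary: k)
  case (Cons x xs)
  show ?case
  proof (cases "x > a")
    case True
    show ?thesis
    proof (cases "k = 1")
      case False
      then obtain j where j: "k = Suc j" "j > 0" using Cons.prems(3) by (cases k) auto
      then have "xs ! (j - 1) = (x # xs) ! j" by (cases j) auto
      then show ?thesis using Cons.IH[of j] Cons.prems j True by auto
    qed (use True in auto)
  next
    case False
    then have le: "\<forall>y\<in>set (x # xs). y \<le> a" using Cons.prems(1) by force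
    then have "filter (\<lambda>x. x > a) (x # xs) = []" by (simp add: filter_empty_conv not_less)
    moreover have "\<not> (if k \<le> length (x # xs) then (x # xs) ! (k - 1) else 0) > a"
    proof (cases "k \<le> length (x # xs)")
      case True
      then have "(x # xs) ! (k - 1) \<in> set (x # xs)" using Cons.prems(3) by (intro nth_mem) auto
      then show ?thesis using le True by auto
    qed (use Cons.prems in auto)
    ultimately show ?thesis using Cons.prems(3) by simp
  qed
qed auto

text \<open>Two nonnegative reals that exceed the same thresholds \<open>a \<ge> 0\<close> coincide,
  so the counts above all thresholds determine the \<open>k\<close>-th entry, padding
  included.\<close>

lemma sorted_desc_nth_cong:
  fixes xs ys :: "real list"
  assumes xs: "sorted_wrt (\<ge>) xs" "\<forall>x\<in>set xs. x \<ge> 0" and ys: "sorted_wrt (\<ge>) ys" "\<forall>x\<in>set ys. x \<ge> 0"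
    and k: "k > 0"
    and eq: "\<And>a. a \<ge> 0 \<Longrightarrow> length (filter (\<lambda>x. x > a) xs) = length (filter (\<lambda>x. x > a) ys)"
  shows "(if k \<le> length xs then xs ! (k - 1) else 0) = (if k \<le> length ys then ys ! (k - 1) else 0)"
    (is "?x = ?y")
proof -
  have "?x \<ge> 0" "?y \<ge> 0" using xs ys k by (auto intro!: bspec[OF xs(2)] bspec[OF ys(2)])
  moreover have "a < ?x \<longleftrightarrow> a < ?y" if "a \<ge> 0" for a
    using sorted_desc_nth_gt_iff[OF xs(1) that k] sorted_desc_nth_gt_iff[OF ys(1) that k] eq[OF that]
    by simp
  ultimately have "\<not> ?x < ?y" "\<not> ?y < ?x" by blast+
  then show ?thesis by linarith
qed

lemma card_standard_gt:
  assumes "a \<ge> 0"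
  shows "card {i \<in> {..<q + length ls}. (if i < q then \<infinity> else ereal (ls ! (i - q))) > ereal a}
    = q + length (filter (\<lambda>x. x > a) ls)"
proof -
  have "{i \<in> {..<q + length ls}. (if i < q then \<infinity> else ereal (ls ! (i - q))) > ereal a} =
     {..<q} \<union> (\<lambda>k. q + k) ` {k. k < length ls \<and> ls ! k > a}"
  proof (rule Set.set_eqI)
    fix i
    show "i \<in> {i \<in> {..<q + length ls}. (if i < q then \<infinity> else ereal (ls ! (i - q))) > ereal a} \<longleftrightarrow>
       i \<in> {..<q} \<union> (\<lambda>k. q + k) ` {k. k < length ls \<and> ls ! k > a}"
    proof (cases "i < q")
      case False
      then obtain k where k: "i = q + k" by (metis add_diff_inverse_nat)
      show ?thesis unfolding k by (simp add: image_iff)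
    qed auto
  qed
  also have "card \<dots> = q + card {k. k < length ls \<and> ls ! k > a}"
    by (subst card_Un_disjoint) (auto simp: card_image)
  finally show ?thesis by (simp add: length_filter_conv_card)
qed

text \<open>The isomorphism gives two presentations of one module, whose counts agree by
  \<open>presents_card_le\<close>. These counts contain the free summands at every threshold, so
  they yield the torsion counts once \<open>q = q'\<close> is known.\<close>

lemma exponents_unique:
  fixes M :: "('k::field series, 'm) module"
  assumes M: "presents M {..<q + length ls} (\<lambda>i. if i < q then \<infinity> else ereal (ls ! (i - q))) F"
    and iso: "module_isomorphic novikov_univ0 M (standard_module q' ls')"
    and ls': "\<forall>x\<in>set ls'. x > 0" and a: "a \<ge> 0"
  shows "length (filter (\<lambda>x. x > a) ls) = length (filter (\<lambda>x. x > a) ls')"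
proof -
  obtain f where f: "f \<in> module_hom novikov_univ0 M (standard_module q' ls')"
    "bij_betw f (carrier M) (carrier (standard_module q' ls'))"
    using iso unfolding module_isomorphic_def by blast
  note P = presents_image[OF M f]
  obtain G where G: "presents (standard_module q' ls' :: ('k series, _) module) {..<q' + length ls'}
    (\<lambda>i. if i < q' then \<infinity> else ereal (ls' ! (i - q'))) G"
    using presents_standard_module[of ls' q', where ?'k = 'k] ls' by force
  have eq: "q + length (filter (\<lambda>x. x > b) ls) = q' + length (filter (\<lambda>x. x > b) ls')" if "b \<ge> 0" for b
    using presents_card_le[OF P G finite_lessThan finite_lessThan that]
      presents_card_le[OF G P finite_lessThan finite_lessThan that]
    by (simp only: card_standard_gt[OF that])
  \<comment> \<open>A threshold that no exponent exceeds leaves only the free summands. Inserting 0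
    covers empty lists and keeps the threshold nonnegative.\<close>
  define b where "b = Max (insert 0 (set (ls @ ls')))"
  have "b \<ge> 0" "\<forall>x\<in>set (ls @ ls'). x \<le> b" by (auto simp: b_def)
  then have "filter (\<lambda>x. x > b) ls = []" "filter (\<lambda>x. x > b) ls' = []"
    by (auto simp: filter_empty_conv not_less)
  then have "q = q'" using eq[OF \<open>b \<ge> 0\<close>] by simp
  then show ?thesis using eq[OF a] by simp
qed

declare novikov_simps [simp del] novikov_univ0_simps [simp del]

subsection \<open>Orthogonal bases as indexed families\<close>

lemma nu_novikov_real:
  assumes "c \<in> carrier (novikov \<Gamma>)" "c \<noteq> \<zero>\<^bsub>novikov \<Gamma>\<^esub>"
  obtains r where "nu c = ereal r"
proof -
  have "c \<in> carrier novikov_univ" using assms(1) carrier_novikov_sub by blast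
  moreover have "c \<noteq> (\<lambda>x. 0)" using assms(2) by (simp add: novikov_simps)
  ultimately show ?thesis using nu_real that by blast
qed

locale nonarch = vectorspace "novikov \<Gamma>" C
  for \<Gamma> :: "real set" and C :: "('k::field series, 'c) module" +
  fixes l :: "'c \<Rightarrow> ereal"
  assumes l_not_inf: "x \<in> carrier C \<Longrightarrow> l x \<noteq> \<infinity>"
    and l_minf_iff: "x \<in> carrier C \<Longrightarrow> l x = -\<infinity> \<longleftrightarrow> x = \<zero>\<^bsub>C\<^esub>"
    and l_smult: "c \<in> carrier (novikov \<Gamma>) \<Longrightarrow> x \<in> carrier C \<Longrightarrow> l (c \<odot>\<^bsub>C\<^esub> x) = l x - nu c"
    and l_add: "x \<in> carrier C \<Longrightarrow> y \<in> carrier C \<Longrightarrow> l (x \<oplus>\<^bsub>C\<^esub> y) \<le> max (l x) (l y)"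
begin

abbreviation "K \<equiv> novikov \<Gamma> :: 'k series ring"

definition lcomb :: "'i set \<Rightarrow> ('i \<Rightarrow> 'c) \<Rightarrow> ('i \<Rightarrow> 'k series) \<Rightarrow> 'c" where
  "lcomb I w c = (\<Oplus>\<^bsub>C\<^esub>i\<in>I. c i \<odot>\<^bsub>C\<^esub> w i)"

text \<open>A family over an index set instead of a list, so that one vector is exchanged by a
  function update while all other indices stay put. Linear independence is encoded by orthogonality
  together with nonzero vectors; \<open>obasis_unique\<close> extracts it.\<close>

definition obasis :: "'i set \<Rightarrow> ('i \<Rightarrow> 'c) \<Rightarrow> bool" where
  "obasis I w \<longleftrightarrow> finite I \<and> w \<in> I \<rightarrow> carrier C \<and> (\<forall>i\<in>I. w i \<noteq> \<zero>\<^bsub>C\<^esub>) \<and>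
     (\<forall>x\<in>carrier C. \<exists>c\<in>I \<rightarrow> carrier K. x = lcomb I w c) \<and>
     (\<forall>c\<in>I \<rightarrow> carrier K. l (lcomb I w c) = (SUP i\<in>I. l (c i \<odot>\<^bsub>C\<^esub> w i)))"

definition coord :: "'i set \<Rightarrow> ('i \<Rightarrow> 'c) \<Rightarrow> 'c \<Rightarrow> 'i \<Rightarrow> 'k series" where
  "coord I w x = (SOME c. c \<in> I \<rightarrow> carrier K \<and> x = lcomb I w c)"

lemma l_real:
  assumes "x \<in> carrier C" "x \<noteq> \<zero>\<^bsub>C\<^esub>" obtains r where "l x = ereal r"
  using l_not_inf[OF assms(1)] l_minf_iff[OF assms(1)] assms(2) by (cases "l x") auto

lemma l_zero: "l \<zero>\<^bsub>C\<^esub> = -\<infinity>"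
  using l_minf_iff by auto

lemma smult_eq_zero:
  assumes "c \<in> carrier K" "x \<in> carrier C" "c \<odot>\<^bsub>C\<^esub> x = \<zero>\<^bsub>C\<^esub>" "x \<noteq> \<zero>\<^bsub>C\<^esub>"
  shows "c = \<zero>\<^bsub>K\<^esub>"
proof (rule ccontr)
  assume "c \<noteq> \<zero>\<^bsub>K\<^esub>"
  then obtain r where r: "nu c = ereal r" using nu_novikov_real assms(1) by blast
  obtain s where s: "l x = ereal s" using l_real assms(2,4) by blast
  have "l (c \<odot>\<^bsub>C\<^esub> x) = -\<infinity>" using assms(3) l_zero by simp
  then show False using l_smult[OF assms(1,2)] r s by simp
qed

lemma uminus_closed_novikov:
  assumes "c \<in> carrier K" shows "\<ominus>\<^bsub>K\<^esub> c = (\<lambda>x. - c x)"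
proof (rule R.minus_equality)
  show "(\<lambda>x. - c x) \<in> carrier K" using assms by (simp add: novikov_def)
qed (use assms in \<open>auto simp: novikov_simps\<close>)

lemma nu_uminus: "c \<in> carrier K \<Longrightarrow> nu (\<ominus>\<^bsub>K\<^esub> c) = nu c"
  by (simp add: uminus_closed_novikov nu_def)

lemma l_smult_uminus:
  "c \<in> carrier K \<Longrightarrow> x \<in> carrier C \<Longrightarrow> l ((\<ominus>\<^bsub>K\<^esub> c) \<odot>\<^bsub>C\<^esub> x) = l (c \<odot>\<^bsub>C\<^esub> x)"
  by (simp add: l_smult nu_uminus)

lemma l_smult_mono:
  "c \<in> carrier K \<Longrightarrow> x \<in> carrier C \<Longrightarrow> y \<in> carrier C \<Longrightarrow> l x \<le> l y \<Longrightarrow> l (c \<odot>\<^bsub>C\<^esub> x) \<le> l (c \<odot>\<^bsub>C\<^esub> y)"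
  by (simp add: l_smult ereal_minus_mono)

lemma lcomb_closed [simp]:
  "w \<in> I \<rightarrow> carrier C \<Longrightarrow> c \<in> I \<rightarrow> carrier K \<Longrightarrow> lcomb I w c \<in> carrier C"
  unfolding lcomb_def by (intro M.finsum_closed) (auto simp: Pi_iff)

lemma lcomb_cong:
  assumes "w' \<in> I \<rightarrow> carrier C" "c' \<in> I \<rightarrow> carrier K"
    "\<And>i. i \<in> I \<Longrightarrow> w i = w' i" "\<And>i. i \<in> I \<Longrightarrow> c i = c' i"
  shows "lcomb I w c = lcomb I w' c'"
  unfolding lcomb_def by (rule M.finsum_cong') (use assms in \<open>auto simp: Pi_iff\<close>)

lemma lcomb_add:
  assumes "w \<in> I \<rightarrow> carrier C" "c \<in> I \<rightarrow> carrier K" "c' \<in> I \<rightarrow> carrier K"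
  shows "lcomb I w (\<lambda>i. c i \<oplus>\<^bsub>K\<^esub> c' i) = lcomb I w c \<oplus>\<^bsub>C\<^esub> lcomb I w c'"
proof -
  have "lcomb I w (\<lambda>i. c i \<oplus>\<^bsub>K\<^esub> c' i) = (\<Oplus>\<^bsub>C\<^esub>i\<in>I. c i \<odot>\<^bsub>C\<^esub> w i \<oplus>\<^bsub>C\<^esub> c' i \<odot>\<^bsub>C\<^esub> w i)"
    unfolding lcomb_def by (rule M.finsum_cong') (use assms in \<open>auto simp: Pi_iff smult_l_distr\<close>)
  also have "\<dots> = lcomb I w c \<oplus>\<^bsub>C\<^esub> lcomb I w c'"
    unfolding lcomb_def by (rule M.finsum_addf) (use assms in \<open>auto simp: Pi_iff\<close>)
  finally show ?thesis .
qed

lemma lcomb_smult: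
  assumes "finite I" "w \<in> I \<rightarrow> carrier C" "c \<in> I \<rightarrow> carrier K" "a \<in> carrier K"
  shows "lcomb I w (\<lambda>i. a \<otimes>\<^bsub>K\<^esub> c i) = a \<odot>\<^bsub>C\<^esub> lcomb I w c"
proof -
  have "lcomb I w (\<lambda>i. a \<otimes>\<^bsub>K\<^esub> c i) = (\<Oplus>\<^bsub>C\<^esub>i\<in>I. a \<odot>\<^bsub>C\<^esub> (c i \<odot>\<^bsub>C\<^esub> w i))"
    unfolding lcomb_def by (rule M.finsum_cong') (use assms in \<open>auto simp: Pi_iff smult_assoc1\<close>)
  also have "\<dots> = a \<odot>\<^bsub>C\<^esub> lcomb I w c"
    unfolding lcomb_def by (rule finsum_smult_ldistr[symmetric]) (use assms in \<open>auto simp: Pi_iff\<close>)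
  finally show ?thesis .
qed

lemma lcomb_remove:
  assumes "finite I" "w \<in> I \<rightarrow> carrier C" "c \<in> I \<rightarrow> carrier K" "j \<in> I"
  shows "lcomb I w c = c j \<odot>\<^bsub>C\<^esub> w j \<oplus>\<^bsub>C\<^esub> lcomb (I - {j}) w c"
proof -
  have "lcomb (insert j (I - {j})) w c = c j \<odot>\<^bsub>C\<^esub> w j \<oplus>\<^bsub>C\<^esub> lcomb (I - {j}) w c"
    unfolding lcomb_def by (rule M.finsum_insert) (use assms in \<open>auto simp: Pi_iff\<close>)
  then show ?thesis using assms(4) by (simp add: insert_absorb)
qed

lemma lcomb_zero:
  assumes "w \<in> I \<rightarrow> carrier C" "\<And>i. i \<in> I \<Longrightarrow> c i = \<zero>\<^bsub>K\<^esub>"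
  shows "lcomb I w c = \<zero>\<^bsub>C\<^esub>"
proof -
  have "lcomb I w c = (\<Oplus>\<^bsub>C\<^esub>i\<in>I. \<zero>\<^bsub>C\<^esub>)"
    unfolding lcomb_def by (rule M.finsum_cong') (use assms in \<open>auto simp: Pi_iff\<close>)
  then show ?thesis by simp
qed

lemma lcomb_single:
  assumes "finite I" "w \<in> I \<rightarrow> carrier C" "j \<in> I" "a \<in> carrier K"
  shows "lcomb I w (\<lambda>i. if i = j then a else \<zero>\<^bsub>K\<^esub>) = a \<odot>\<^bsub>C\<^esub> w j"
proof -
  have wj: "w j \<in> carrier C" using assms by auto
  have "lcomb (I - {j}) w (\<lambda>i. if i = j then a else \<zero>\<^bsub>K\<^esub>) = \<zero>\<^bsub>C\<^esub>"
    by (rule lcomb_zero) (use assms in auto)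
  then show ?thesis
    using assms wj by (subst lcomb_remove[of _ _ _ j]) auto
qed

lemma obasisD:
  assumes "obasis I w"
  shows "finite I" "w \<in> I \<rightarrow> carrier C" "\<And>i. i \<in> I \<Longrightarrow> w i \<in> carrier C" "\<And>i. i \<in> I \<Longrightarrow> w i \<noteq> \<zero>\<^bsub>C\<^esub>"
    "\<And>x. x \<in> carrier C \<Longrightarrow> \<exists>c\<in>I \<rightarrow> carrier K. x = lcomb I w c"
    "\<And>c. c \<in> I \<rightarrow> carrier K \<Longrightarrow> l (lcomb I w c) = (SUP i\<in>I. l (c i \<odot>\<^bsub>C\<^esub> w i))"
proof -
  note B = assms[unfolded obasis_def]
  show "finite I" and w: "w \<in> I \<rightarrow> carrier C" using B by blast+
  show "w i \<in> carrier C" if "i \<in> I" for i using w that by (rule Pi_mem)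
  show "w i \<noteq> \<zero>\<^bsub>C\<^esub>" if "i \<in> I" for i using B that by blast
  show "\<exists>c\<in>I \<rightarrow> carrier K. x = lcomb I w c" if "x \<in> carrier C" for x using B that by blast
  show "l (lcomb I w c) = (SUP i\<in>I. l (c i \<odot>\<^bsub>C\<^esub> w i))" if "c \<in> I \<rightarrow> carrier K" for c using B that by blast
qed

text \<open>The difference of two expansions of one vector has level \<open>-\<infinity>\<close>. By
  orthogonality this level bounds every single term, so each term is zero, and so is its coefficient
  because the basis vectors are nonzero.\<close>

lemma obasis_unique:
  assumes B: "obasis I w" and c: "c \<in> I \<rightarrow> carrier K" "c' \<in> I \<rightarrow> carrier K"
    and eq: "lcomb I w c = lcomb I w c'" and i: "i \<in> I"
  shows "c i = c' i"
proof -
  note b = obasisD[OF B]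
  define e where "e i = c i \<oplus>\<^bsub>K\<^esub> (\<ominus>\<^bsub>K\<^esub> \<one>\<^bsub>K\<^esub>) \<otimes>\<^bsub>K\<^esub> c' i" for i
  have cc: "c i \<in> carrier K" "c' i \<in> carrier K" if "i \<in> I" for i using c that by auto
  have e: "e \<in> I \<rightarrow> carrier K" using cc by (auto simp: e_def)
  have "lcomb I w e = lcomb I w c \<oplus>\<^bsub>C\<^esub> (\<ominus>\<^bsub>K\<^esub> \<one>\<^bsub>K\<^esub>) \<odot>\<^bsub>C\<^esub> lcomb I w c'"
    unfolding e_def using b(1,2,3) c cc by (subst lcomb_add) (auto simp: lcomb_smult Pi_iff)
  also have "\<dots> = \<zero>\<^bsub>C\<^esub>"
    using eq b(2) c by (simp add: smult_l_minus M.r_neg)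
  finally have "(SUP i\<in>I. l (e i \<odot>\<^bsub>C\<^esub> w i)) = -\<infinity>" using b(6)[OF e] l_zero by simp
  moreover have "l (e i \<odot>\<^bsub>C\<^esub> w i) \<le> (SUP i\<in>I. l (e i \<odot>\<^bsub>C\<^esub> w i))" by (rule SUP_upper[OF i])
  ultimately have "l (e i \<odot>\<^bsub>C\<^esub> w i) = -\<infinity>" by simp
  then have "e i \<odot>\<^bsub>C\<^esub> w i = \<zero>\<^bsub>C\<^esub>" using l_minf_iff[of "e i \<odot>\<^bsub>C\<^esub> w i"] e b(3)[OF i] i by auto
  then have "e i = \<zero>\<^bsub>K\<^esub>" using smult_eq_zero[OF _ b(3)[OF i] _ b(4)[OF i]] e i by auto
  then have "c i \<ominus>\<^bsub>K\<^esub> c' i = \<zero>\<^bsub>K\<^esub>" using cc[OF i] by (simp add: e_def R.minus_eq R.l_minus)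
  then show ?thesis using cc[OF i] by simp
qed

lemma coord_closed:
  assumes "obasis I w" "x \<in> carrier C"
  shows "coord I w x \<in> I \<rightarrow> carrier K" and lcomb_coord: "lcomb I w (coord I w x) = x"
proof -
  have "\<exists>c. c \<in> I \<rightarrow> carrier K \<and> x = lcomb I w c" using obasisD(5)[OF assms] by blast
  then have "coord I w x \<in> I \<rightarrow> carrier K \<and> x = lcomb I w (coord I w x)"
    unfolding coord_def by (rule someI_ex)
  then show "coord I w x \<in> I \<rightarrow> carrier K" "lcomb I w (coord I w x) = x" by auto
qed

lemma coord_closed': "obasis I w \<Longrightarrow> x \<in> carrier C \<Longrightarrow> i \<in> I \<Longrightarrow> coord I w x i \<in> carrier K"
  by (rule Pi_mem[OF coord_closed(1)])

lemma coord_lcomb: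
  assumes "obasis I w" "c \<in> I \<rightarrow> carrier K" "i \<in> I"
  shows "coord I w (lcomb I w c) i = c i"
proof (rule obasis_unique[OF assms(1) _ assms(2) _ assms(3)])
  have "lcomb I w c \<in> carrier C" by (rule lcomb_closed[OF obasisD(2)[OF assms(1)] assms(2)])
  then show "coord I w (lcomb I w c) \<in> I \<rightarrow> carrier K"
    "lcomb I w (coord I w (lcomb I w c)) = lcomb I w c"
    by (rule coord_closed[OF assms(1)], rule lcomb_coord[OF assms(1)])
qed

lemma coord_add:
  assumes B: "obasis I w" and x: "x \<in> carrier C" and y: "y \<in> carrier C" and i: "i \<in> I"
  shows "coord I w (x \<oplus>\<^bsub>C\<^esub> y) i = coord I w x i \<oplus>\<^bsub>K\<^esub> coord I w y i"
proof -
  have c: "coord I w x \<in> I \<rightarrow> carrier K" "coord I w y \<in> I \<rightarrow> carrier K"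
    by (rule coord_closed[OF B x], rule coord_closed[OF B y])
  have "x \<oplus>\<^bsub>C\<^esub> y = lcomb I w (\<lambda>i. coord I w x i \<oplus>\<^bsub>K\<^esub> coord I w y i)"
    using lcomb_add[OF obasisD(2)[OF B] c] lcomb_coord[OF B x] lcomb_coord[OF B y] by simp
  then show ?thesis using coord_lcomb[OF B _ i, of "\<lambda>i. coord I w x i \<oplus>\<^bsub>K\<^esub> coord I w y i"] c
    by (auto simp: Pi_iff)
qed

lemma coord_smult:
  assumes B: "obasis I w" and x: "x \<in> carrier C" and a: "a \<in> carrier K" and i: "i \<in> I"
  shows "coord I w (a \<odot>\<^bsub>C\<^esub> x) i = a \<otimes>\<^bsub>K\<^esub> coord I w x i"
proof -
  have c: "coord I w x \<in> I \<rightarrow> carrier K"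
    by (rule coord_closed[OF B x])
  have "a \<odot>\<^bsub>C\<^esub> x = lcomb I w (\<lambda>i. a \<otimes>\<^bsub>K\<^esub> coord I w x i)"
    using lcomb_smult[OF obasisD(1,2)[OF B] c a] lcomb_coord[OF B x] by simp
  then show ?thesis using coord_lcomb[OF B _ i, of "\<lambda>i. a \<otimes>\<^bsub>K\<^esub> coord I w x i"] c a
    by (auto simp: Pi_iff)
qed

lemma coord_zero: "obasis I w \<Longrightarrow> i \<in> I \<Longrightarrow> coord I w \<zero>\<^bsub>C\<^esub> i = \<zero>\<^bsub>K\<^esub>"
  using coord_smult[of I w "\<zero>\<^bsub>C\<^esub>" "\<zero>\<^bsub>K\<^esub>" i] coord_closed'[of I w "\<zero>\<^bsub>C\<^esub>" i] by simp

lemma coord_basis: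
  assumes B: "obasis I w" and "i \<in> I" "j \<in> I"
  shows "coord I w (w j) i = (if i = j then \<one>\<^bsub>K\<^esub> else \<zero>\<^bsub>K\<^esub>)"
proof -
  have "lcomb I w (\<lambda>i. if i = j then \<one>\<^bsub>K\<^esub> else \<zero>\<^bsub>K\<^esub>) = w j"
    using lcomb_single[OF obasisD(1,2)[OF B] assms(3) R.one_closed] obasisD(3)[OF B assms(3)] by simp
  then show ?thesis
    using coord_lcomb[OF B _ assms(2), of "\<lambda>i. if i = j then \<one>\<^bsub>K\<^esub> else \<zero>\<^bsub>K\<^esub>"] by simp
qed

lemma l_eq_SUP_coord:
  assumes "obasis I w" "x \<in> carrier C"
  shows "l x = (SUP i\<in>I. l (coord I w x i \<odot>\<^bsub>C\<^esub> w i))"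
  using obasisD(6)[OF assms(1) coord_closed(1)[OF assms]] lcomb_coord[OF assms] by simp

text \<open>The condition says that the \<open>j\<close>-th term attains the level of
  \<open>x\<close>. In a combination of the new family the cross terms brought in by
  \<open>x\<close> are dominated by \<open>c j \<odot> x\<close>, which has the level of the
  \<open>j\<close>-th term in the old basis. Hence the maxima over the old and the new terms
  agree.\<close>

lemma obasis_exchange:
  assumes B: "obasis I w" and j: "j \<in> I" and x: "x \<in> carrier C"
    and nz: "coord I w x j \<noteq> \<zero>\<^bsub>K\<^esub>"
    and max: "\<And>i. i \<in> I \<Longrightarrow> l (coord I w x i \<odot>\<^bsub>C\<^esub> w i) \<le> l (coord I w x j \<odot>\<^bsub>C\<^esub> w j)"
  shows "obasis I (w(j := x))"
proof -
  note b = obasisD[OF B]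
  define a where "a = coord I w x"
  have a: "a i \<in> carrier K" if "i \<in> I" for i unfolding a_def by (rule coord_closed'[OF B x that])
  have aPi: "a \<in> I \<rightarrow> carrier K" using a by auto
  have xa: "x = lcomb I w a" unfolding a_def by (rule lcomb_coord[OF B x, symmetric])
  have aj: "a j \<noteq> \<zero>\<^bsub>K\<^esub>" using nz by (simp add: a_def)
  let ?w = "w(j := x)"
  have w': "?w \<in> I \<rightarrow> carrier C" using b(2) x by auto
  \<comment> \<open>Old coordinates of the combination with new coordinates \<open>c\<close>:
    expanding \<open>x\<close> adds \<open>c j \<otimes> a i\<close> in every slot other than
    \<open>j\<close>.\<close>
  define e where "e c i = (if i = j then c j \<otimes>\<^bsub>K\<^esub> a j else c i \<oplus>\<^bsub>K\<^esub> c j \<otimes>\<^bsub>K\<^esub> a i)" for c i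
  have e: "e c \<in> I \<rightarrow> carrier K" if "c \<in> I \<rightarrow> carrier K" for c
    using that a j by (auto simp: e_def Pi_iff)
  have lx: "l x = l (a j \<odot>\<^bsub>C\<^esub> w j)"
  proof (rule antisym)
    show "l x \<le> l (a j \<odot>\<^bsub>C\<^esub> w j)"
      unfolding l_eq_SUP_coord[OF B x] a_def by (rule SUP_least) (rule max)
    show "l (a j \<odot>\<^bsub>C\<^esub> w j) \<le> l x"
      unfolding l_eq_SUP_coord[OF B x] a_def by (rule SUP_upper[OF j])
  qed
  have lc: "lcomb I ?w c = lcomb I w (e c)" if c: "c \<in> I \<rightarrow> carrier K" for c
  proof -
    have cI: "c i \<in> carrier K" if "i \<in> I" for i using c that by (rule Pi_mem)
    note cj = cI[OF j]
    let ?c0 = "\<lambda>i. if i = j then \<zero>\<^bsub>K\<^esub> else c i"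
    have "lcomb (I - {j}) ?w c = lcomb (I - {j}) w ?c0"
      by (rule lcomb_cong) (use b(1,2,3) cI in auto)
    also have "\<dots> = lcomb I w ?c0"
      using b(1,2,3) cI j by (subst lcomb_remove[of I w ?c0 j]) (auto intro!: lcomb_closed)
    finally have "lcomb I ?w c = c j \<odot>\<^bsub>C\<^esub> x \<oplus>\<^bsub>C\<^esub> lcomb I w ?c0"
      using lcomb_remove[OF b(1) w' c j] by simp
    also have "c j \<odot>\<^bsub>C\<^esub> x = lcomb I w (\<lambda>i. c j \<otimes>\<^bsub>K\<^esub> a i)"
      using lcomb_smult[OF b(1,2) aPi cj] xa by simp
    also have "lcomb I w (\<lambda>i. c j \<otimes>\<^bsub>K\<^esub> a i) \<oplus>\<^bsub>C\<^esub> lcomb I w ?c0 =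
        lcomb I w (\<lambda>i. c j \<otimes>\<^bsub>K\<^esub> a i \<oplus>\<^bsub>K\<^esub> ?c0 i)"
      by (rule lcomb_add[symmetric]) (use b(1,2,3) cj a cI in auto)
    also have "\<dots> = lcomb I w (e c)"
      by (rule lcomb_cong) (use b(1,2,3) e[OF c] cj cI a R.a_comm j in \<open>auto simp: e_def Pi_iff\<close>)
    finally show ?thesis .
  qed
  have "x \<noteq> \<zero>\<^bsub>C\<^esub>"
  proof
    assume "x = \<zero>\<^bsub>C\<^esub>"
    then have "l (a j \<odot>\<^bsub>C\<^esub> w j) = -\<infinity>" using lx l_zero by simp
    then have "a j \<odot>\<^bsub>C\<^esub> w j = \<zero>\<^bsub>C\<^esub>" using l_minf_iff[of "a j \<odot>\<^bsub>C\<^esub> w j"] a[OF j] b(3)[OF j] by simp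
    then show False using smult_eq_zero[OF a[OF j] b(3)[OF j] _ b(4)[OF j]] aj by simp
  qed
  moreover have "\<exists>c\<in>I \<rightarrow> carrier K. y = lcomb I ?w c" if y: "y \<in> carrier C" for y
  proof -
    obtain f where f: "f \<in> I \<rightarrow> carrier K" "y = lcomb I w f" using b(5)[OF y] by blast
    have fc: "f i \<in> carrier K" if "i \<in> I" for i using f(1) that by (rule Pi_mem)
    have aU: "a j \<in> Units K" using a[OF j] aj by (simp add: field_Units)
    define cj where "cj = f j \<otimes>\<^bsub>K\<^esub> inv\<^bsub>K\<^esub> a j"
    have cj: "cj \<in> carrier K" "cj \<otimes>\<^bsub>K\<^esub> a j = f j"
      using aU fc[OF j] a[OF j] by (auto simp: cj_def R.m_assoc)
    \<comment> \<open>The inverse of the triangular substitution \<open>e\<close>, available because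
      \<open>a j\<close> is a unit.\<close>
    define c where "c i = (if i = j then cj else f i \<ominus>\<^bsub>K\<^esub> cj \<otimes>\<^bsub>K\<^esub> a i)" for i
    have c: "c \<in> I \<rightarrow> carrier K" using fc cj a by (auto simp: c_def)
    have "e c i = f i" if "i \<in> I" for i
      using fc[OF that] cj a[OF that] by (auto simp: e_def c_def R.minus_eq R.a_assoc R.l_neg)
    then have "lcomb I w (e c) = lcomb I w f" by (intro lcomb_cong) (use b(1,2,3) f in auto)
    then have "y = lcomb I ?w c" using lc[OF c] f(2) by simp
    then show ?thesis using c by (rule bexI)
  qed
  moreover have "l (lcomb I ?w c) = (SUP i\<in>I. l (c i \<odot>\<^bsub>C\<^esub> ?w i))" if c: "c \<in> I \<rightarrow> carrier K" for c
  proof -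
    have cc: "c i \<in> carrier K" if "i \<in> I" for i using c that by (rule Pi_mem)
    have ec: "e c i \<in> carrier K" if "i \<in> I" for i using e[OF c] that by (rule Pi_mem)
    have jj: "l (c j \<odot>\<^bsub>C\<^esub> x) = l (e c j \<odot>\<^bsub>C\<^esub> w j)"
      using lx x cc[OF j] a[OF j] b(3)[OF j] by (simp add: e_def smult_assoc1 l_smult)
    have small: "l ((c j \<otimes>\<^bsub>K\<^esub> a i) \<odot>\<^bsub>C\<^esub> w i) \<le> l (c j \<odot>\<^bsub>C\<^esub> x)" if i: "i \<in> I" for i
      using max[OF i] cc[OF j] a[OF i] b(3)[OF i] x lx
      by (simp add: smult_assoc1 a_def[symmetric]) (simp add: l_smult_mono)
    have "l (lcomb I ?w c) = (SUP i\<in>I. l (e c i \<odot>\<^bsub>C\<^esub> w i))"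
      unfolding lc[OF c] by (rule b(6)[OF e[OF c]])
    also have "\<dots> = (SUP i\<in>I. l (c i \<odot>\<^bsub>C\<^esub> ?w i))"
    \<comment> \<open>Each maximum is bounded by the other through the ultrametric inequality, used
      once to add the cross term and once to subtract it.\<close>
    proof (rule antisym; rule SUP_least)
      fix i assume i: "i \<in> I"
      have up: "l (c k \<odot>\<^bsub>C\<^esub> ?w k) \<le> (SUP i\<in>I. l (c i \<odot>\<^bsub>C\<^esub> ?w i))" if "k \<in> I" for k
        by (rule SUP_upper[OF that])
      show "l (e c i \<odot>\<^bsub>C\<^esub> w i) \<le> (SUP i\<in>I. l (c i \<odot>\<^bsub>C\<^esub> ?w i))"
      proof (cases "i = j")
        case True
        then show ?thesis using up[OF j] jj by simp
      next
        case False
        have "e c i \<odot>\<^bsub>C\<^esub> w i = c i \<odot>\<^bsub>C\<^esub> w i \<oplus>\<^bsub>C\<^esub> (c j \<otimes>\<^bsub>K\<^esub> a i) \<odot>\<^bsub>C\<^esub> w i"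
          using False cc i j a b(1,2,3) by (simp add: e_def smult_l_distr)
        then have "l (e c i \<odot>\<^bsub>C\<^esub> w i) \<le> max (l (c i \<odot>\<^bsub>C\<^esub> w i)) (l ((c j \<otimes>\<^bsub>K\<^esub> a i) \<odot>\<^bsub>C\<^esub> w i))"
          using l_add[of "c i \<odot>\<^bsub>C\<^esub> w i" "(c j \<otimes>\<^bsub>K\<^esub> a i) \<odot>\<^bsub>C\<^esub> w i"] cc i j a b(1,2,3) by simp
        also have "\<dots> \<le> (SUP i\<in>I. l (c i \<odot>\<^bsub>C\<^esub> ?w i))"
          using up[OF i] up[OF j] small[OF i] False by (auto intro: order_trans)
        finally show ?thesis .
      qed
    next
      fix i assume i: "i \<in> I"
      have up: "l (e c k \<odot>\<^bsub>C\<^esub> w k) \<le> (SUP i\<in>I. l (e c i \<odot>\<^bsub>C\<^esub> w i))" if "k \<in> I" for k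
        by (rule SUP_upper[OF that])
      show "l (c i \<odot>\<^bsub>C\<^esub> ?w i) \<le> (SUP i\<in>I. l (e c i \<odot>\<^bsub>C\<^esub> w i))"
      proof (cases "i = j")
        case True
        then show ?thesis using up[OF j] jj by simp
      next
        case False
        have "c i = e c i \<oplus>\<^bsub>K\<^esub> \<ominus>\<^bsub>K\<^esub> (c j \<otimes>\<^bsub>K\<^esub> a i)"
          using False cc i j a by (simp add: e_def R.a_assoc R.r_neg)
        then have "c i \<odot>\<^bsub>C\<^esub> w i = e c i \<odot>\<^bsub>C\<^esub> w i \<oplus>\<^bsub>C\<^esub> (\<ominus>\<^bsub>K\<^esub> (c j \<otimes>\<^bsub>K\<^esub> a i)) \<odot>\<^bsub>C\<^esub> w i"
          using smult_l_distr[of "e c i" "\<ominus>\<^bsub>K\<^esub> (c j \<otimes>\<^bsub>K\<^esub> a i)" "w i"] cc i j a b(1,2,3) ec by simp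
        then have "l (c i \<odot>\<^bsub>C\<^esub> w i) \<le> max (l (e c i \<odot>\<^bsub>C\<^esub> w i)) (l ((\<ominus>\<^bsub>K\<^esub> (c j \<otimes>\<^bsub>K\<^esub> a i)) \<odot>\<^bsub>C\<^esub> w i))"
          using l_add[of "e c i \<odot>\<^bsub>C\<^esub> w i" "(\<ominus>\<^bsub>K\<^esub> (c j \<otimes>\<^bsub>K\<^esub> a i)) \<odot>\<^bsub>C\<^esub> w i"] cc i j a b(1,2,3) ec by simp
        also have "l ((\<ominus>\<^bsub>K\<^esub> (c j \<otimes>\<^bsub>K\<^esub> a i)) \<odot>\<^bsub>C\<^esub> w i) = l ((c j \<otimes>\<^bsub>K\<^esub> a i) \<odot>\<^bsub>C\<^esub> w i)"
          by (rule l_smult_uminus) (use cc i j a b(1,2,3) in auto)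
        also have "max (l (e c i \<odot>\<^bsub>C\<^esub> w i)) \<dots> \<le> (SUP i\<in>I. l (e c i \<odot>\<^bsub>C\<^esub> w i))"
          using up[OF i] up[OF j] small[OF i] jj by (auto intro: order_trans)
        finally show ?thesis using False by simp
      qed
    qed
    finally show ?thesis .
  qed
  ultimately show ?thesis
    unfolding obasis_def using b(1,4) w' by (intro conjI ballI) auto
qed

text \<open>The vectors are changed one at a time. In the current basis the new vector has
  coordinate 1 at \<open>s\<close> and \<open>c s\<close> at \<open>p\<close>, and the level
  condition makes the term at \<open>s\<close> maximal, so each change is an exchange. As
  \<open>p\<close> lies outside \<open>S\<close>, the vector \<open>w p\<close> stays fixed
  throughout.\<close>

lemma obasis_shear:
  assumes B: "obasis I w" and p: "p \<in> I" and S: "S \<subseteq> I - {p}"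
    and c: "\<And>i. i \<in> S \<Longrightarrow> c i \<in> carrier K"
    and le: "\<And>i. i \<in> S \<Longrightarrow> l (c i \<odot>\<^bsub>C\<^esub> w p) \<le> l (w i)"
  shows "obasis I (\<lambda>i. if i \<in> S then w i \<oplus>\<^bsub>C\<^esub> c i \<odot>\<^bsub>C\<^esub> w p else w i)"
proof -
  have "finite S" by (rule finite_subset[OF S]) (simp add: obasisD(1)[OF B])
  then show ?thesis using S c le
  proof (induction S rule: finite_induct)
    case empty
    then show ?case using B by simp
  next
    case (insert s S)
    let ?u = "\<lambda>i. if i \<in> S then w i \<oplus>\<^bsub>C\<^esub> c i \<odot>\<^bsub>C\<^esub> w p else w i"
    have U: "obasis I ?u" using insert by auto
    note b = obasisD[OF B] and u = obasisD[OF U]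
    have s: "s \<in> I" "s \<noteq> p" "p \<notin> S" "c s \<in> carrier K" using insert.prems by auto
    define a where "a i = (if i = s then \<one>\<^bsub>K\<^esub> else \<zero>\<^bsub>K\<^esub>) \<oplus>\<^bsub>K\<^esub> (if i = p then c s else \<zero>\<^bsub>K\<^esub>)" for i
    have a: "a \<in> I \<rightarrow> carrier K" using s by (auto simp: a_def)
    let ?x = "w s \<oplus>\<^bsub>C\<^esub> c s \<odot>\<^bsub>C\<^esub> w p"
    have "lcomb I ?u a = \<one>\<^bsub>K\<^esub> \<odot>\<^bsub>C\<^esub> ?u s \<oplus>\<^bsub>C\<^esub> c s \<odot>\<^bsub>C\<^esub> ?u p"
      unfolding a_def
      by (subst lcomb_add) (use u(1,2) s p in \<open>auto simp: lcomb_single\<close>)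
    then have xa: "lcomb I ?u a = ?x" using insert.hyps s b(3)[OF s(1)] by simp
    have x: "?x \<in> carrier C" using s b(3)[OF s(1)] b(3)[OF p] by simp
    have co: "coord I ?u ?x i = a i" if "i \<in> I" for i
      using coord_lcomb[OF U a that] xa by simp
    have as: "a s = \<one>\<^bsub>K\<^esub>" using s by (simp add: a_def)
    have "obasis I (?u(s := ?x))"
    proof (rule obasis_exchange[OF U s(1) x])
      show "coord I ?u ?x s \<noteq> \<zero>\<^bsub>K\<^esub>" using co[OF s(1)] as by simp
      fix i assume i: "i \<in> I"
      have "l (a i \<odot>\<^bsub>C\<^esub> ?u i) \<le> l (w s)"
      proof (cases "i = s \<or> i = p")
        case True
        then show ?thesis
          using insert.hyps insert.prems(3)[of s] s b(3)[OF s(1)] as by (auto simp: a_def)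
      next
        case False
        then have "a i = \<zero>\<^bsub>K\<^esub>" by (simp add: a_def)
        then show ?thesis using u(3)[OF i] l_zero by simp
      qed
      also have "l (w s) = l (a s \<odot>\<^bsub>C\<^esub> ?u s)" using as insert.hyps b(3)[OF s(1)] by simp
      finally show "l (coord I ?u ?x i \<odot>\<^bsub>C\<^esub> ?u i) \<le> l (coord I ?u ?x s \<odot>\<^bsub>C\<^esub> ?u s)"
        using co[OF i] co[OF s(1)] by simp
    qed
    moreover have "?u(s := ?x) = (\<lambda>i. if i \<in> insert s S then w i \<oplus>\<^bsub>C\<^esub> c i \<odot>\<^bsub>C\<^esub> w p else w i)"
      using insert.hyps by auto
    ultimately show ?case by simp
  qed
qed

end

subsection \<open>Singular value decomposition\<close>

locale floer =
  C1: nonarch \<Gamma> C1 l1 + C0: nonarch \<Gamma> C0 l0 + linear_map "novikov \<Gamma>" C1 C0 d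
  for \<Gamma> :: "real set" and C1 :: "('k::field series, 'a) module" and l1
    and C0 :: "('k series, 'b) module" and l0 and d +
  assumes l_d: "x \<in> carrier C1 \<Longrightarrow> l0 (d x) \<le> l1 x"
begin

lemma d_closed: "x \<in> carrier C1 \<Longrightarrow> d x \<in> carrier C0"
  using T_im .

lemma d_lcomb:
  assumes "finite I" "w \<in> I \<rightarrow> carrier C1" "c \<in> I \<rightarrow> carrier (novikov \<Gamma>)"
  shows "d (C1.lcomb I w c) = C0.lcomb I (\<lambda>i. d (w i)) c"
  using assms
proof (induction I rule: finite_induct)
  case empty
  then show ?case by (simp add: C1.lcomb_def C0.lcomb_def)
next
  case (insert i I)
  have wi: "w i \<in> carrier C1" "c i \<in> carrier (novikov \<Gamma>)" using insert.prems by auto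
  have wI: "w \<in> I \<rightarrow> carrier C1" "c \<in> I \<rightarrow> carrier (novikov \<Gamma>)" using insert.prems by auto
  have "C1.lcomb (insert i I) w c = c i \<odot>\<^bsub>C1\<^esub> w i \<oplus>\<^bsub>C1\<^esub> C1.lcomb I w c"
    unfolding C1.lcomb_def
    by (rule C1.M.finsum_insert) (use insert wi wI in \<open>auto simp: Pi_iff\<close>)
  then have "d (C1.lcomb (insert i I) w c) = c i \<odot>\<^bsub>C0\<^esub> d (w i) \<oplus>\<^bsub>C0\<^esub> d (C1.lcomb I w c)"
    using wi wI by (simp add: T_add T_smult)
  also have "\<dots> = C0.lcomb (insert i I) (\<lambda>i. d (w i)) c"
    unfolding insert.IH[OF wI] C0.lcomb_def
    by (rule C0.M.finsum_insert[symmetric]) (use insert wi wI d_closed in \<open>auto simp: Pi_iff\<close>)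
  finally show ?case .
qed

text \<open>The invariant of the elimination: the basis vectors indexed by \<open>D\<close> have been processed.\<close>

definition partial_svd ::
    "'i set \<Rightarrow> ('i \<Rightarrow> 'a) \<Rightarrow> 'j set \<Rightarrow> ('j \<Rightarrow> 'b) \<Rightarrow> 'i set \<Rightarrow> ('i \<Rightarrow> 'j) \<Rightarrow> bool" where
  "partial_svd I w J v D \<sigma> \<longleftrightarrow> C1.obasis I w \<and> C0.obasis J v \<and> D \<subseteq> I \<and> inj_on \<sigma> D \<and> \<sigma> ` D \<subseteq> J \<and>
     (\<forall>i\<in>D. d (w i) = v (\<sigma> i)) \<and>
     (\<forall>i\<in>I - D. \<forall>j\<in>\<sigma> ` D. C0.coord J v (d (w i)) j = \<zero>\<^bsub>novikov \<Gamma>\<^esub>)"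

text \<open>The pivot maximises \<open>l0 (v j) - nu a\<^sub>i\<^sub>j - l1 (w i)\<close>; then both the column and the row operation
  preserve orthogonality.\<close>

lemma partial_svd_step:
  assumes P: "partial_svd I w J v D \<sigma>" and i0: "i0 \<in> I - D" "d (w i0) \<noteq> \<zero>\<^bsub>C0\<^esub>"
  shows "\<exists>w' v' i j. i \<in> I - D \<and> partial_svd I w' J v' (insert i D) (\<sigma>(i := j))"
proof -
  let ?K = "novikov \<Gamma> :: 'k series ring"
  have B1: "C1.obasis I w" and B0: "C0.obasis J v" and D: "D \<subseteq> I" and inj: "inj_on \<sigma> D"
    and sJ: "\<sigma> ` D \<subseteq> J" and dD: "\<And>i. i \<in> D \<Longrightarrow> d (w i) = v (\<sigma> i)"
    and zD: "\<And>i j. i \<in> I - D \<Longrightarrow> j \<in> \<sigma> ` D \<Longrightarrow> C0.coord J v (d (w i)) j = \<zero>\<^bsub>?K\<^esub>"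
    using P unfolding partial_svd_def by blast+
  note b1 = C1.obasisD[OF B1] and b0 = C0.obasisD[OF B0]
  define A where "A i j = C0.coord J v (d (w i)) j" for i j
  have dw: "d (w i) \<in> carrier C0" if "i \<in> I" for i using b1(3)[OF that] by (rule d_closed)
  have A: "A i j \<in> carrier ?K" if "i \<in> I" "j \<in> J" for i j
    unfolding A_def by (rule C0.coord_closed'[OF B0 dw[OF that(1)] that(2)])
  \<comment> \<open>The level of the term \<open>A i j \<odot> v j\<close> of \<open>d (w i)\<close>
    minus the level of \<open>w i\<close>; the pivot is the nonzero entry at which the least level
    is lost.\<close>
  define f where "f p = l0 (v (snd p)) - nu (A (fst p) (snd p)) - l1 (w (fst p))" for p
  define S where "S = {p \<in> (I - D) \<times> J. A (fst p) (snd p) \<noteq> \<zero>\<^bsub>?K\<^esub>}"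
  have finS: "finite S" unfolding S_def using b1(1) b0(1) by auto
  have "\<exists>j\<in>J. A i0 j \<noteq> \<zero>\<^bsub>?K\<^esub>"
  proof (rule ccontr)
    assume "\<not> ?thesis"
    then have "C0.lcomb J v (A i0) = \<zero>\<^bsub>C0\<^esub>" by (intro C0.lcomb_zero b0(2)) blast
    moreover have "A i0 = C0.coord J v (d (w i0))" by (simp add: A_def fun_eq_iff)
    ultimately show False using C0.lcomb_coord[OF B0 dw, of i0] i0 by simp
  qed
  then have "S \<noteq> {}" using i0(1) by (auto simp: S_def)
  then obtain p where p: "p \<in> S" "\<And>p'. p' \<in> S \<Longrightarrow> f p' \<le> f p"
  proof -
    have "Max (f ` S) \<in> f ` S" using finS \<open>S \<noteq> {}\<close> by simp
    then obtain p where "p \<in> S" "f p = Max (f ` S)" by force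
    then show ?thesis using that finS by simp
  qed
  obtain i j where ij: "p = (i, j)" by (cases p)
  have i: "i \<in> I" "i \<in> I - D" "i \<notin> D" and j: "j \<in> J" and nz: "A i j \<noteq> \<zero>\<^bsub>?K\<^esub>"
    using p(1) by (auto simp: S_def ij)
  \<comment> \<open>Columns already used are zero in all remaining rows, so a nonzero pivot lies in
    a fresh column.\<close>
  have jD: "j \<notin> \<sigma> ` D" using nz zD[OF i(2)] by (auto simp: A_def)
  have max: "l0 (v j') - nu (A i' j') - l1 (w i') \<le> l0 (v j) - nu (A i j) - l1 (w i)"
    if "i' \<in> I - D" "j' \<in> J" "A i' j' \<noteq> \<zero>\<^bsub>?K\<^esub>" for i' j'
    using p(2)[of "(i', j')"] that by (simp add: S_def f_def ij)
  obtain aij where aij: "nu (A i j) = ereal aij" using nu_novikov_real[OF A[OF i(1) j] nz] .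
  obtain r where r: "l1 (w i) = ereal r" using C1.l_real[OF b1(3) b1(4)] i(1) by blast
  obtain s where s: "l0 (v j) = ereal s" using C0.l_real[OF b0(3) b0(4)] j by blast
  define v' where "v' = v(j := d (w i))"
  \<comment> \<open>Within row \<open>i\<close> the level of \<open>w i\<close> cancels from the
    pivot inequality, which leaves precisely the condition of the exchange.\<close>
  have B0': "C0.obasis J v'"
    unfolding v'_def
  proof (rule C0.obasis_exchange[OF B0 j dw[OF i(1)]])
    show "C0.coord J v (d (w i)) j \<noteq> \<zero>\<^bsub>?K\<^esub>" using nz by (simp add: A_def)
    fix j' assume j': "j' \<in> J"
    show "l0 (C0.coord J v (d (w i)) j' \<odot>\<^bsub>C0\<^esub> v j') \<le> l0 (C0.coord J v (d (w i)) j \<odot>\<^bsub>C0\<^esub> v j)"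
      unfolding A_def[symmetric]
    proof (cases "A i j' = \<zero>\<^bsub>?K\<^esub>")
      case True
      then show "l0 (A i j' \<odot>\<^bsub>C0\<^esub> v j') \<le> l0 (A i j \<odot>\<^bsub>C0\<^esub> v j)"
        using b0(3)[OF j'] C0.l_zero by simp
    next
      case False
      obtain b where b: "nu (A i j') = ereal b" using nu_novikov_real[OF A[OF i(1) j'] False] .
      obtain s' where s': "l0 (v j') = ereal s'" using C0.l_real[OF b0(3) b0(4)] j' by blast
      show "l0 (A i j' \<odot>\<^bsub>C0\<^esub> v j') \<le> l0 (A i j \<odot>\<^bsub>C0\<^esub> v j)"
        using max[OF i(2) j' False]
        by (simp add: C0.l_smult[OF A[OF i(1) j'] b0(3)[OF j']] C0.l_smult[OF A[OF i(1) j] b0(3)[OF j]]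
            b aij s s' r)
    qed
  qed
  have Au: "A i j \<in> Units ?K" using A[OF i(1) j] nz by (simp add: C1.field_Units)
  have inv: "inv\<^bsub>?K\<^esub> (A i j) \<in> carrier ?K" using Au by simp
  \<comment> \<open>The coefficient that clears entry \<open>j\<close> of row \<open>i'\<close>.
    Within column \<open>j\<close> the level of \<open>v j\<close> cancels from the pivot
    inequality, which leaves the level condition of the shear.\<close>
  define c where "c i' = \<ominus>\<^bsub>?K\<^esub> (A i' j \<otimes>\<^bsub>?K\<^esub> inv\<^bsub>?K\<^esub> (A i j))" for i'
  have c: "c i' \<in> carrier ?K" if "i' \<in> I" for i' using A[OF that j] inv by (simp add: c_def)
  define S' where "S' = I - D - {i}"
  define w' where "w' i' = (if i' \<in> S' then w i' \<oplus>\<^bsub>C1\<^esub> c i' \<odot>\<^bsub>C1\<^esub> w i else w i')" for i'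
  have "C1.obasis I w'"
    unfolding w'_def
  proof (rule C1.obasis_shear[OF B1 i(1)])
    show "S' \<subseteq> I - {i}" by (auto simp: S'_def)
    fix i' assume "i' \<in> S'"
    then have i': "i' \<in> I" "i' \<in> I - D" by (auto simp: S'_def)
    show "c i' \<in> carrier ?K" by (rule c[OF i'(1)])
    show "l1 (c i' \<odot>\<^bsub>C1\<^esub> w i) \<le> l1 (w i')"
    proof (cases "A i' j = \<zero>\<^bsub>?K\<^esub>")
      case True
      then have "c i' = \<zero>\<^bsub>?K\<^esub>" using inv by (simp add: c_def)
      then show ?thesis using b1(3)[OF i(1)] C1.l_zero by simp
    next
      case False
      obtain b where b: "nu (A i' j) = ereal b" using nu_novikov_real[OF A[OF i'(1) j] False] .
      obtain r' where r': "l1 (w i') = ereal r'" using C1.l_real[OF b1(3) b1(4)] i'(1) by blast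
      note wi = b1(3)[OF i(1)]
      have iw: "inv\<^bsub>?K\<^esub> (A i j) \<odot>\<^bsub>C1\<^esub> w i \<in> carrier C1" using inv wi by simp
      \<comment> \<open>Multiplying the inverse back shows its effect on levels without a formula
        for the valuation of an inverse.\<close>
      have "w i = A i j \<odot>\<^bsub>C1\<^esub> (inv\<^bsub>?K\<^esub> (A i j) \<odot>\<^bsub>C1\<^esub> w i)"
        using Au wi A[OF i(1) j] inv by (simp add: C1.smult_assoc1[symmetric] C1.Units_r_inv)
      then have "l1 (w i) = l1 (inv\<^bsub>?K\<^esub> (A i j) \<odot>\<^bsub>C1\<^esub> w i) - nu (A i j)"
        using C1.l_smult[OF A[OF i(1) j] iw] by simp
      then have liw: "l1 (inv\<^bsub>?K\<^esub> (A i j) \<odot>\<^bsub>C1\<^esub> w i) = ereal (r + aij)"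
        using aij r by (cases "l1 (inv\<^bsub>?K\<^esub> (A i j) \<odot>\<^bsub>C1\<^esub> w i)") auto
      have "l1 (c i' \<odot>\<^bsub>C1\<^esub> w i) = l1 ((A i' j \<otimes>\<^bsub>?K\<^esub> inv\<^bsub>?K\<^esub> (A i j)) \<odot>\<^bsub>C1\<^esub> w i)"
        unfolding c_def by (rule C1.l_smult_uminus) (use A[OF i'(1) j] inv wi in auto)
      also have "\<dots> = l1 (A i' j \<odot>\<^bsub>C1\<^esub> (inv\<^bsub>?K\<^esub> (A i j) \<odot>\<^bsub>C1\<^esub> w i))"
        using A[OF i'(1) j] inv wi by (simp add: C1.smult_assoc1)
      also have "\<dots> = ereal (r + aij - b)"
        using C1.l_smult[OF A[OF i'(1) j] iw] liw b by simp
      also have "\<dots> \<le> l1 (w i')"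
        using max[OF i'(2) j False] by (simp add: b aij r r' s)
      finally show ?thesis .
    qed
  qed
  moreover have "d (w' i') = v' ((\<sigma>(i := j)) i')" if "i' \<in> insert i D" for i'
  proof (cases "i' = i")
    case False
    then have "i' \<in> D" using that by simp
    then have "\<sigma> i' \<noteq> j" using jD by blast
    then show ?thesis using False dD[OF \<open>i' \<in> D\<close>] \<open>i' \<in> D\<close> by (simp add: w'_def v'_def S'_def)
  qed (simp add: w'_def v'_def S'_def)
  moreover have "C0.coord J v' (d (w' i')) j' = \<zero>\<^bsub>?K\<^esub>"
    if "i' \<in> I - insert i D" "j' \<in> (\<sigma>(i := j)) ` insert i D" for i' j'
  proof -
    have i': "i' \<in> I" "i' \<in> I - D" "i' \<in> S'" using that by (auto simp: S'_def)
    have j': "j' = j \<or> j' \<in> \<sigma> ` D" using that(2) i(3) by (auto split: if_splits)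
    then have j'J: "j' \<in> J" using j sJ by auto
    have dw': "d (w' i') = d (w i') \<oplus>\<^bsub>C0\<^esub> c i' \<odot>\<^bsub>C0\<^esub> d (w i)"
      using i' b1(3)[OF i'(1)] b1(3)[OF i(1)] c[OF i'(1)] by (simp add: w'_def T_add T_smult)
    have dw'C: "d (w' i') \<in> carrier C0" unfolding dw' using dw[OF i'(1)] dw[OF i(1)] c[OF i'(1)] by simp
    define e where "e = C0.coord J v (d (w' i'))"
    have e: "e \<in> J \<rightarrow> carrier ?K" unfolding e_def by (rule C0.coord_closed(1)[OF B0 dw'C])
    have ek: "e k = A i' k \<oplus>\<^bsub>?K\<^esub> c i' \<otimes>\<^bsub>?K\<^esub> A i k" if "k \<in> J" for k
      unfolding e_def dw' A_def
      using dw[OF i'(1)] dw[OF i(1)] c[OF i'(1)] that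
      by (simp add: C0.coord_add[OF B0] C0.coord_smult[OF B0])
    have "e j = A i' j \<oplus>\<^bsub>?K\<^esub> \<ominus>\<^bsub>?K\<^esub> (A i' j \<otimes>\<^bsub>?K\<^esub> (inv\<^bsub>?K\<^esub> (A i j) \<otimes>\<^bsub>?K\<^esub> A i j))"
      using ek[OF j] A[OF i'(1) j] A[OF i(1) j] inv by (simp add: c_def C1.R.l_minus C1.R.m_assoc)
    then have ej: "e j = \<zero>\<^bsub>?K\<^esub>"
      using A[OF i'(1) j] Au by (simp add: C1.R.r_neg)
    \<comment> \<open>\<open>v\<close> and \<open>v'\<close> differ only at \<open>j\<close>, where
      the coefficient is zero, so the cleared row has the same coordinates in both families.\<close>
    have "C0.lcomb J v' e = C0.lcomb J v e"
    proof -
      have "C0.lcomb (J - {j}) v' e = C0.lcomb (J - {j}) v e"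
        by (rule C0.lcomb_cong) (use b0(2) e in \<open>auto simp: v'_def Pi_iff\<close>)
      then show ?thesis
        using C0.lcomb_remove[OF b0(1,2) e j] C0.lcomb_remove[OF b0(1) C0.obasisD(2)[OF B0'] e j]
          ej b0(3)[OF j] C0.obasisD(3)[OF B0' j] by simp
    qed
    then have "d (w' i') = C0.lcomb J v' e" using C0.lcomb_coord[OF B0 dw'C] by (simp add: e_def)
    then have "C0.coord J v' (d (w' i')) j' = e j'" using C0.coord_lcomb[OF B0' e j'J] by simp
    also have "\<dots> = \<zero>\<^bsub>?K\<^esub>"
      using j'
    proof
      assume j'D: "j' \<in> \<sigma> ` D"
      have "A i' j' = \<zero>\<^bsub>?K\<^esub>" "A i j' = \<zero>\<^bsub>?K\<^esub>"
        unfolding A_def by (rule zD[OF i'(2) j'D], rule zD[OF i(2) j'D])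
      then show ?thesis using ek[OF j'J] c[OF i'(1)] by simp
    qed (use ej in simp)
    finally show ?thesis .
  qed
  moreover have "inj_on (\<sigma>(i := j)) (insert i D)"
    using inj jD i(3) by (auto simp: inj_on_def)
  moreover have "(\<sigma>(i := j)) ` insert i D \<subseteq> J" using sJ j by auto
  ultimately have "partial_svd I w' J v' (insert i D) (\<sigma>(i := j))"
    unfolding partial_svd_def using B0' D i(1) by blast
  then show ?thesis using i(2) by blast
qed

lemma svd_exists:
  assumes "partial_svd I w J v D \<sigma>"
  shows "\<exists>w v D \<sigma>. partial_svd I w J v D \<sigma> \<and> (\<forall>i\<in>I - D. d (w i) = \<zero>\<^bsub>C0\<^esub>)"
  using assms
proof (induction "card (I - D)" arbitrary: w v D \<sigma> rule: less_induct)
  case less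
  show ?case
  proof (cases "\<forall>i\<in>I - D. d (w i) = \<zero>\<^bsub>C0\<^esub>")
    case False
    then obtain i0 where "i0 \<in> I - D" "d (w i0) \<noteq> \<zero>\<^bsub>C0\<^esub>" by blast
    then have "\<exists>w' v' i j. i \<in> I - D \<and> partial_svd I w' J v' (insert i D) (\<sigma>(i := j))"
      by (rule partial_svd_step[OF less.prems])
    then obtain w' v' i j
      where i: "i \<in> I - D" and P: "partial_svd I w' J v' (insert i D) (\<sigma>(i := j))"
      by (elim exE conjE)
    have "C1.obasis I w" using less.prems by (simp add: partial_svd_def)
    then have "finite (I - D)" by (simp add: C1.obasisD(1))
    then have "card (I - insert i D) < card (I - D)"
      using i by (intro psubset_card_mono) auto
    from less.hyps[OF this P] show ?thesis .
  next
    case True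
    with less.prems show ?thesis by (intro exI conjI)
  qed
qed

end

subsection \<open>Boundary depth in terms of singular values\<close>

text \<open>Independent subsets of \<open>W\<close> are independent in the ambient space, so their
  sizes are bounded by its dimension and a maximal one exists. This ties the dimension of a robust
  subspace to an actual finite basis.\<close>

lemma (in vectorspace) subspace_finite_basis:
  assumes fd: "fin_dim" and W: "subspace K W V"
  shows "\<exists>A. finite A \<and> vectorspace.basis K (vs W) A"
proof -
  interpret W: vectorspace K "vs W" by (rule subspace_is_vs[OF W])
  have sub: "submodule K W V" using W by simp
  have WV: "W \<subseteq> carrier V" using submodule.subset[OF sub] .
  have "\<exists>A. finite A \<and> maximal A (\<lambda>S. S \<subseteq> carrier (vs W) \<and> W.lin_indpt S)"
  proof (rule maximal_exists)
    show "{} \<subseteq> carrier (vs W) \<and> W.lin_indpt {}" by (simp add: W.lin_dep_def)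
    fix A assume A: "A \<subseteq> carrier (vs W) \<and> W.lin_indpt A"
    then have "A \<subseteq> W" by simp
    then have "lin_indpt A" "A \<subseteq> carrier V" using A WV span_li_not_depend(2)[OF _ sub] by auto
    then show "finite A \<and> card A \<le> dim" using li_le_dim[OF fd] by blast
  qed
  then obtain A where A: "finite A" "maximal A (\<lambda>S. S \<subseteq> carrier (vs W) \<and> W.lin_indpt S)" by blast
  have "W.gen_set A" by (rule W.max_li_is_gen[OF A(2)])
  moreover have "A \<subseteq> carrier (vs W)" "W.lin_indpt A" using A(2) by (auto simp: maximal_def)
  ultimately show ?thesis using A(1) by (auto simp: W.basis_def)
qed

context nonarch
begin

lemma coord_of_lcomb:
  assumes B: "obasis I w" and j: "j \<in> I" and "finite S" "u \<in> S \<rightarrow> carrier C" "c \<in> S \<rightarrow> carrier K"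
  shows "coord I w (lcomb S u c) j = (\<Oplus>\<^bsub>K\<^esub>s\<in>S. c s \<otimes>\<^bsub>K\<^esub> coord I w (u s) j)"
  using assms(3-5)
proof (induction S rule: finite_induct)
  case empty
  then show ?case using coord_zero[OF B j] by (simp add: lcomb_def)
next
  case (insert s S)
  have s: "u s \<in> carrier C" "c s \<in> carrier K" and S: "u \<in> S \<rightarrow> carrier C" "c \<in> S \<rightarrow> carrier K"
    using insert.prems by auto
  have "lcomb (insert s S) u c = c s \<odot>\<^bsub>C\<^esub> u s \<oplus>\<^bsub>C\<^esub> lcomb S u c"
    unfolding lcomb_def by (rule M.finsum_insert) (use insert.hyps s S in \<open>auto simp: Pi_iff\<close>)
  then have "coord I w (lcomb (insert s S) u c) j =
      c s \<otimes>\<^bsub>K\<^esub> coord I w (u s) j \<oplus>\<^bsub>K\<^esub> (\<Oplus>\<^bsub>K\<^esub>s\<in>S. c s \<otimes>\<^bsub>K\<^esub> coord I w (u s) j)"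
    using s S lcomb_closed[OF S] by (simp add: coord_add[OF B _ _ j] coord_smult[OF B _ _ j] insert.IH[OF S])
  also have "\<dots> = (\<Oplus>\<^bsub>K\<^esub>s\<in>insert s S. c s \<otimes>\<^bsub>K\<^esub> coord I w (u s) j)"
    by (rule R.finsum_insert[symmetric])
      (use insert.hyps s S coord_closed'[OF B _ j] in \<open>auto simp: Pi_iff\<close>)
  finally show ?case .
qed

lemma coord_eqI:
  assumes B: "obasis I w" and "x \<in> carrier C" "y \<in> carrier C"
    and eq: "\<And>i. i \<in> I \<Longrightarrow> coord I w x i = coord I w y i"
  shows "x = y"
proof -
  have "lcomb I w (coord I w x) = lcomb I w (coord I w y)"
    by (rule lcomb_cong) (use obasisD(2)[OF B] coord_closed(1)[OF B assms(3)] eq in auto)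
  then show ?thesis using lcomb_coord[OF B] assms by simp
qed

lemma l_coord_le:
  assumes "obasis I w" "x \<in> carrier C" "i \<in> I"
  shows "l (coord I w x i \<odot>\<^bsub>C\<^esub> w i) \<le> l x"
  unfolding l_eq_SUP_coord[OF assms(1,2)] by (rule SUP_upper[OF assms(3)])

lemma l_coord_attained:
  assumes B: "obasis I w" and x: "x \<in> carrier C" "x \<noteq> \<zero>\<^bsub>C\<^esub>"
  obtains i where "i \<in> I" "l x = l (coord I w x i \<odot>\<^bsub>C\<^esub> w i)"
proof -
  let ?f = "\<lambda>i. l (coord I w x i \<odot>\<^bsub>C\<^esub> w i)"
  have lx: "l x = Sup (?f ` I)" by (rule l_eq_SUP_coord[OF B x(1)])
  have "I \<noteq> {}"
  proof
    assume "I = {}"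
    then have "l x = -\<infinity>" using lx by (simp add: bot_ereal_def)
    then show False using x l_minf_iff by simp
  qed
  then have fin: "finite (?f ` I)" "?f ` I \<noteq> {}" using obasisD(1)[OF B] by auto
  have "Max (?f ` I) \<in> ?f ` I" by (rule Max_in[OF fin])
  then obtain i where "i \<in> I" "Max (?f ` I) = ?f i" by blast
  then show ?thesis using that[of i] lx Max_Sup[OF fin] by simp
qed

lemma obasis_inj: "obasis I w \<Longrightarrow> inj_on w I"
proof (rule inj_onI)
  fix i j assume "obasis I w" "i \<in> I" "j \<in> I" "w i = w j"
  then show "i = j" using coord_basis[of I w i i] coord_basis[of I w i j] by (auto split: if_splits)
qed

end

section \<open>The map in its reduced form and the robust subspaces of its image\<close>

locale floer_svd = floer \<Gamma> C1 l1 C0 l0 d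
  for \<Gamma> :: "real set" and C1 :: "('k::field series, 'a) module" and l1
    and C0 :: "('k series, 'b) module" and l0 and d +
  fixes I :: "'i set" and w :: "'i \<Rightarrow> 'a" and J :: "'j set" and v :: "'j \<Rightarrow> 'b" and D :: "'i set"
    and \<sigma> :: "'i \<Rightarrow> 'j"
  assumes B1: "C1.obasis I w" and B0: "C0.obasis J v" and D: "D \<subseteq> I" and inj: "inj_on \<sigma> D"
    and sJ: "\<sigma> ` D \<subseteq> J" and dD: "\<And>i. i \<in> D \<Longrightarrow> d (w i) = v (\<sigma> i)"
    and dz: "\<And>i. i \<in> I - D \<Longrightarrow> d (w i) = \<zero>\<^bsub>C0\<^esub>"
begin

abbreviation "K \<equiv> novikov \<Gamma> :: 'k series ring"

text \<open>The level lost by \<open>d\<close> at \<open>w i\<close>. Basis vectors have finite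
  level, so the difference may be taken in \<real>; it has this meaning for indices in
  \<open>D\<close>.\<close>

definition gap :: "'i \<Rightarrow> real" where
  "gap i = real_of_ereal (l1 (w i)) - real_of_ereal (l0 (v (\<sigma> i)))"

lemma D_mem: "i \<in> D \<Longrightarrow> i \<in> I" "i \<in> D \<Longrightarrow> \<sigma> i \<in> J"
  using D sJ by auto

lemma l1_eq_gap:
  assumes "i \<in> D" shows "l1 (w i) = l0 (v (\<sigma> i)) + ereal (gap i)"
proof -
  note i = D_mem[OF assms]
  obtain r where "l1 (w i) = ereal r"
    using C1.l_real[OF C1.obasisD(3,4)[OF B1]] i(1) by blast
  moreover obtain s where "l0 (v (\<sigma> i)) = ereal s"
    using C0.l_real[OF C0.obasisD(3,4)[OF B0]] i(2) by blast
  ultimately show ?thesis by (simp add: gap_def)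
qed

lemma gap_nonneg:
  assumes "i \<in> D" shows "gap i \<ge> 0"
proof -
  note i = D_mem[OF assms]
  obtain s where s: "l0 (v (\<sigma> i)) = ereal s"
    using C0.l_real[OF C0.obasisD(3,4)[OF B0]] i(2) by blast
  have "l0 (v (\<sigma> i)) \<le> l1 (w i)" using l_d[OF C1.obasisD(3)[OF B1 i(1)]] dD[OF assms] by simp
  then show ?thesis using l1_eq_gap[OF assms] s by simp
qed

lemma l1_smult_eq_gap:
  assumes "i \<in> D" "c \<in> carrier K"
  shows "l1 (c \<odot>\<^bsub>C1\<^esub> w i) = l0 (c \<odot>\<^bsub>C0\<^esub> v (\<sigma> i)) + ereal (gap i)"
proof -
  note i = D_mem[OF assms(1)]
  show ?thesis
    using C1.l_smult[OF assms(2) C1.obasisD(3)[OF B1 i(1)]]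
      C0.l_smult[OF assms(2) C0.obasisD(3)[OF B0 i(2)]] l1_eq_gap[OF assms(1)]
      C0.l_not_inf[OF C0.obasisD(3)[OF B0 i(2)]]
    by (cases "l0 (v (\<sigma> i))"; cases "nu c") auto
qed

text \<open>In the reduced bases the matrix of \<open>d\<close> is a partial permutation:
  coordinates are copied along \<open>\<sigma>\<close>, and target coordinates that are not hit are
  zero.\<close>

lemma coord_d:
  assumes y: "y \<in> carrier C1" and j: "j \<in> J"
  shows "i \<in> D \<Longrightarrow> j = \<sigma> i \<Longrightarrow> C0.coord J v (d y) j = C1.coord I w y i"
    and "j \<notin> \<sigma> ` D \<Longrightarrow> C0.coord J v (d y) j = \<zero>\<^bsub>K\<^esub>"
proof -
  let ?c = "C1.coord I w y"
  note b1 = C1.obasisD(1-3)[OF B1]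
  have c: "?c \<in> I \<rightarrow> carrier K" by (rule C1.coord_closed(1)[OF B1 y])
  have dw: "(\<lambda>i. d (w i)) \<in> I \<rightarrow> carrier C0" using b1(3) d_closed by auto
  have "d y = C0.lcomb I (\<lambda>i. d (w i)) ?c"
    using d_lcomb[OF b1(1,2) c] C1.lcomb_coord[OF B1 y] by simp
  then have eq: "C0.coord J v (d y) j = (\<Oplus>\<^bsub>K\<^esub>i\<in>I. ?c i \<otimes>\<^bsub>K\<^esub> C0.coord J v (d (w i)) j)"
    using C0.coord_of_lcomb[OF B0 j b1(1) dw c] by simp
  have co: "C0.coord J v (d (w i)) j = (if i \<in> D \<and> \<sigma> i = j then \<one>\<^bsub>K\<^esub> else \<zero>\<^bsub>K\<^esub>)" if "i \<in> I" for i
  proof (cases "i \<in> D")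
    case True
    then show ?thesis using C0.coord_basis[OF B0 j D_mem(2)[OF True]] dD by auto
  next
    case False
    then show ?thesis using C0.coord_zero[OF B0 j] dz that by simp
  qed
  {
    assume i: "i \<in> D" "j = \<sigma> i"
    have "C0.coord J v (d y) j = (\<Oplus>\<^bsub>K\<^esub>i'\<in>I. if i = i' then ?c i' else \<zero>\<^bsub>K\<^esub>)"
      unfolding eq
    proof (rule C1.R.finsum_cong')
      fix i' assume i': "i' \<in> I"
      have "?c i' \<in> carrier K" using c i' by (rule Pi_mem)
      moreover have "i' \<in> D \<and> \<sigma> i' = j \<longleftrightarrow> i = i'" using i inj by (auto simp: inj_on_def)
      ultimately show "?c i' \<otimes>\<^bsub>K\<^esub> C0.coord J v (d (w i')) j = (if i = i' then ?c i' else \<zero>\<^bsub>K\<^esub>)"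
        using co[OF i'] by auto
    qed (use c in auto)
    also have "\<dots> = ?c i"
      by (rule C1.R.finsum_singleton[OF D_mem(1)[OF i(1)] b1(1) c])
    finally show "C0.coord J v (d y) j = ?c i" .
  next
    assume j': "j \<notin> \<sigma> ` D"
    have "C0.coord J v (d y) j = (\<Oplus>\<^bsub>K\<^esub>i'\<in>I. \<zero>\<^bsub>K\<^esub>)"
      unfolding eq
    proof (rule C1.R.finsum_cong')
      fix i' assume i': "i' \<in> I"
      have "?c i' \<in> carrier K" using c i' by (rule Pi_mem)
      moreover have "C0.coord J v (d (w i')) j = \<zero>\<^bsub>K\<^esub>" using co[OF i'] j' by auto
      ultimately show "?c i' \<otimes>\<^bsub>K\<^esub> C0.coord J v (d (w i')) j = \<zero>\<^bsub>K\<^esub>" by simp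
    qed auto
    then show "C0.coord J v (d y) j = \<zero>\<^bsub>K\<^esub>" by simp
  }
qed

text \<open>By dimension, \<open>V\<close> contains a nonzero \<open>x\<close> whose coordinates at
  the \<open>k - 1\<close> largest gaps vanish. It has a preimage of level at most
  \<open>l0 x\<close> plus the \<open>k\<close>-th gap, whereas robustness puts every preimage
  strictly above \<open>l0 x + \<delta>\<close>.\<close>

lemma robust_dim_bound:
  assumes fd: "vectorspace.fin_dim K C0"
    and rob: "robust_subspace \<Gamma> C1 l1 C0 l0 d \<delta> V" and im: "V \<subseteq> d ` carrier C1"
    and dim: "vectorspace.dim K (C0\<lparr>carrier := V\<rparr>) = k" and k: "k > 0"
    and ds: "distinct ds" "set ds = D" "sorted_wrt (\<lambda>i j. gap i \<ge> gap j) ds"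
  shows "k \<le> length ds \<and> \<delta> < gap (ds ! (k - 1))"
proof -
  have sub: "subspace K V C0" using rob by (simp add: robust_subspace_def)
  have submod: "submodule K V C0" using C0.is_module[OF sub] .
  have VC: "V \<subseteq> carrier C0" by (rule submodule.subset[OF submod])
  interpret V: vectorspace K "C0\<lparr>carrier := V\<rparr>" by (rule C0.subspace_is_vs[OF sub])
  obtain B where B: "finite B" "V.basis B" using C0.subspace_finite_basis[OF fd sub] by blast
  have cardB: "card B = k" using V.dim_basis[OF B] dim by simp
  have BV: "B \<subseteq> V" and li: "V.lin_indpt B" using B(2) by (auto simp: V.basis_def)
  have BC: "(\<lambda>x. x) \<in> B \<rightarrow> carrier C0" using BV VC by auto
  \<comment> \<open>The indices of the \<open>k - 1\<close> largest gaps impose one condition fewer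
    than the dimension of \<open>V\<close>, so a nonzero vector survives.\<close>
  define P where "P = set (take (k - 1) ds)"
  have PD: "P \<subseteq> D" using set_take_subset[of "k - 1" ds] ds(2) by (auto simp: P_def)
  have "card P \<le> k - 1" unfolding P_def by (rule order_trans[OF card_length]) simp
  then have "card P < card B" using k cardB by simp
  moreover have "C0.coord J v x (\<sigma> i) \<in> carrier K" if "x \<in> B" "i \<in> P" for x i
    by (rule C0.coord_closed'[OF B0]) (use that BV VC PD D_mem in auto)
  ultimately obtain e where e: "e \<in> B \<rightarrow> carrier K" "\<exists>x\<in>B. e x \<noteq> \<zero>\<^bsub>K\<^esub>"
    and e0: "\<forall>i\<in>P. (\<Oplus>\<^bsub>K\<^esub>x\<in>B. e x \<otimes>\<^bsub>K\<^esub> C0.coord J v x (\<sigma> i)) = \<zero>\<^bsub>K\<^esub>"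
    using C1.nontrivial_relation[of P B "\<lambda>x i. C0.coord J v x (\<sigma> i)"] B(1) P_def by auto
  define x where "x = C0.lincomb e B"
  have xV: "x = V.lincomb e B"
    unfolding x_def by (rule C0.lincomb_not_depend[OF B(1) BV submod e(1)])
  have x: "x \<in> V" unfolding xV using V.lincomb_closed[of B e] BV e(1) by simp
  have xC: "x \<in> carrier C0" using x VC by auto
  have x0: "x \<noteq> \<zero>\<^bsub>C0\<^esub>"
  proof
    assume "x = \<zero>\<^bsub>C0\<^esub>"
    then have "V.lincomb e B = \<zero>\<^bsub>C0\<lparr>carrier := V\<rparr>\<^esub>" using xV by simp
    moreover obtain b where "b \<in> B" "e b \<noteq> \<zero>\<^bsub>K\<^esub>" using e(2) by blast
    ultimately have "V.lin_dep B" using V.lin_dep_crit[OF B(1) order_refl e(1)] by blast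
    then show False using li by simp
  qed
  have xl: "x = C0.lcomb B (\<lambda>x. x) e" by (simp add: x_def C0.lincomb_def C0.lcomb_def)
  obtain y where y: "y \<in> carrier C1" "d y = x" using im x by blast
  \<comment> \<open>Dropping the coordinates outside \<open>D\<close> removes the kernel part of
    \<open>y\<close>: the image is still \<open>x\<close>, and the level is now controlled by gaps
    alone.\<close>
  define c where "c i = (if i \<in> D then C1.coord I w y i else \<zero>\<^bsub>K\<^esub>)" for i
  have c: "c \<in> I \<rightarrow> carrier K" using C1.coord_closed'[OF B1 y(1)] by (auto simp: c_def)
  have cP: "c i = \<zero>\<^bsub>K\<^esub>" if "i \<in> P" for i
  proof -
    have i: "i \<in> D" using that PD by auto
    have "C1.coord I w y i = C0.coord J v x (\<sigma> i)"
      using coord_d(1)[OF y(1) D_mem(2)[OF i] i refl] y(2) by simp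
    also have "\<dots> = \<zero>\<^bsub>K\<^esub>"
      unfolding xl C0.coord_of_lcomb[OF B0 D_mem(2)[OF i] B(1) BC e(1)] using e0 that by blast
    finally show ?thesis by (simp add: c_def)
  qed
  note b1 = C1.obasisD(1-3)[OF B1]
  define y' where "y' = C1.lcomb I w c"
  have y': "y' \<in> carrier C1" unfolding y'_def by (rule C1.lcomb_closed[OF b1(2) c])
  have cy': "C1.coord I w y' i = c i" if "i \<in> I" for i
    unfolding y'_def by (rule C1.coord_lcomb[OF B1 c that])
  have dy': "d y' = x"
  proof (rule C0.coord_eqI[OF B0 d_closed[OF y'] xC])
    fix j assume j: "j \<in> J"
    show "C0.coord J v (d y') j = C0.coord J v x j"
    proof (cases "j \<in> \<sigma> ` D")
      case True
      then obtain i where i: "i \<in> D" "j = \<sigma> i" by blast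
      then show ?thesis
        using coord_d(1)[OF y' j i] coord_d(1)[OF y(1) j i] y(2) cy'[OF D_mem(1)[OF i(1)]] by (simp add: c_def)
    next
      case False
      then show ?thesis using coord_d(2)[OF y' j] coord_d(2)[OF y(1) j] y(2) by simp
    qed
  qed
  \<comment> \<open>Otherwise \<open>y'\<close> would vanish although its image is nonzero. An index
    of \<open>D\<close> therefore remains beyond the first \<open>k - 1\<close>, which gives
    \<open>k \<le> length ds\<close>.\<close>
  have "\<not> D \<subseteq> P"
  proof
    assume "D \<subseteq> P"
    then have "c i = \<zero>\<^bsub>K\<^esub>" if "i \<in> I" for i
      using cP[of i] by (cases "i \<in> D") (auto simp: c_def)
    then have "y' = \<zero>\<^bsub>C1\<^esub>" unfolding y'_def by (intro C1.lcomb_zero b1(2))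
    then show False using dy' x0 by simp
  qed
  have kl: "k \<le> length ds"
  proof (rule ccontr)
    assume "\<not> k \<le> length ds"
    then have "take (k - 1) ds = ds" by simp
    then show False using \<open>\<not> D \<subseteq> P\<close> ds(2) by (simp add: P_def)
  qed
  let ?b = "gap (ds ! (k - 1))"
  have small: "gap i \<le> ?b" if i: "i \<in> D" "i \<notin> P" for i
  proof -
    have "i \<in> set ds" using i(1) ds(2) by simp
    then obtain n where n: "n < length ds" "i = ds ! n" by (auto simp: in_set_conv_nth)
    have "k - 1 \<le> n"
    proof (rule ccontr)
      assume "\<not> k - 1 \<le> n"
      then have "i \<in> set (take (k - 1) ds)" using n by (auto simp: in_set_conv_nth)
      then show False using i(2) by (simp add: P_def)
    qed
    then show ?thesis
      using sorted_wrt_nth_less[OF ds(3), of "k - 1" n] n by (cases "k - 1 = n") auto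
  qed
  have "l1 y' \<le> l0 x + ereal ?b"
    unfolding C1.l_eq_SUP_coord[OF B1 y']
  proof (rule SUP_least)
    fix i assume i: "i \<in> I"
    show "l1 (C1.coord I w y' i \<odot>\<^bsub>C1\<^esub> w i) \<le> l0 x + ereal ?b"
    proof (cases "c i = \<zero>\<^bsub>K\<^esub>")
      case True
      then show ?thesis using cy'[OF i] b1(3)[OF i] C1.l_zero by simp
    next
      case False
      then have iD: "i \<in> D" "i \<notin> P" using cP by (auto simp: c_def)
      have ci: "c i \<in> carrier K" using c i by (rule Pi_mem)
      have "C0.coord J v x (\<sigma> i) = c i"
        using coord_d(1)[OF y' D_mem(2)[OF iD(1)] iD(1) refl] dy' cy'[OF i] by simp
      then have "l0 (c i \<odot>\<^bsub>C0\<^esub> v (\<sigma> i)) \<le> l0 x"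
        using C0.l_coord_le[OF B0 xC D_mem(2)[OF iD(1)]] by simp
      moreover have "ereal (gap i) \<le> ereal ?b" using small[OF iD] by simp
      ultimately show ?thesis
        using l1_smult_eq_gap[OF iD(1) ci] cy'[OF i] by (simp add: add_mono)
    qed
  qed
  moreover have "l0 x + ereal \<delta> < l1 y'"
    using rob x x0 y' dy' by (simp add: robust_subspace_def robust_element_def)
  ultimately have "l0 x + ereal \<delta> < l0 x + ereal ?b" by (rule less_le_trans[rotated])
  moreover obtain r where "l0 x = ereal r" using C0.l_real[OF xC x0] .
  ultimately have "\<delta> < ?b" by simp
  then show ?thesis using kl by simp
qed

text \<open>The level of a vector in the span of the \<open>k\<close> images with largest gaps is
  attained at one of their coordinates. Every preimage carries the same coordinate at the matching
  source index, where its term lies higher by the gap.\<close>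

lemma robust_subspace_exists:
  assumes \<delta>: "\<delta> < gap (ds ! (k - 1))" and k: "k \<le> length ds" "k > 0"
    and ds: "distinct ds" "set ds = D" "sorted_wrt (\<lambda>i j. gap i \<ge> gap j) ds"
  shows "\<exists>V. robust_subspace \<Gamma> C1 l1 C0 l0 d \<delta> V \<and> V \<subseteq> d ` carrier C1 \<and>
    vectorspace.dim K (C0\<lparr>carrier := V\<rparr>) = k"
proof -
  define P where "P = set (take k ds)"
  have PD: "P \<subseteq> D" using set_take_subset[of k ds] ds(2) by (auto simp: P_def)
  have cardP: "card P = k" unfolding P_def using ds(1) k(1) by (simp add: distinct_card)
  define T where "T = v ` \<sigma> ` P"
  have sPJ: "\<sigma> ` P \<subseteq> J" using PD D_mem by auto
  have injv: "inj_on v (\<sigma> ` P)" using C0.obasis_inj[OF B0] sPJ by (rule inj_on_subset)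
  have finT: "finite T" by (simp add: T_def P_def)
  have cardT: "card T = k"
    unfolding T_def using card_image[OF injv] card_image[OF inj_on_subset[OF inj PD]] cardP by simp
  have TC: "T \<subseteq> carrier C0" using sPJ C0.obasisD(3)[OF B0] by (auto simp: T_def)
  have TC': "(\<lambda>x. x) \<in> T \<rightarrow> carrier C0" using TC by auto
  \<comment> \<open>Each coordinate of a combination of \<open>T\<close> picks out a single
    coefficient. This gives the independence of \<open>T\<close>, and zero coordinates of its span
    at indices outside the image of \<open>P\<close>.\<close>
  have coT: "C0.coord J v (C0.lincomb a T) j = (\<Oplus>\<^bsub>K\<^esub>t\<in>T. if v j = t then a t else \<zero>\<^bsub>K\<^esub>)"
    if a: "a \<in> T \<rightarrow> carrier K" and j: "j \<in> J" for a j
  proof -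
    have "C0.lincomb a T = C0.lcomb T (\<lambda>x. x) a" by (simp add: C0.lincomb_def C0.lcomb_def)
    then have "C0.coord J v (C0.lincomb a T) j = (\<Oplus>\<^bsub>K\<^esub>t\<in>T. a t \<otimes>\<^bsub>K\<^esub> C0.coord J v t j)"
      using C0.coord_of_lcomb[OF B0 j finT TC' a] by simp
    also have "\<dots> = (\<Oplus>\<^bsub>K\<^esub>t\<in>T. if v j = t then a t else \<zero>\<^bsub>K\<^esub>)"
    proof (rule C1.R.finsum_cong')
      fix t assume t: "t \<in> T"
      have at: "a t \<in> carrier K" using a t by (rule Pi_mem)
      obtain j' where j': "j' \<in> J" "t = v j'" using t sPJ by (auto simp: T_def)
      have "v j = t \<longleftrightarrow> j = j'" using inj_on_eq_iff[OF C0.obasis_inj[OF B0] j j'(1)] j'(2) by simp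
      then show "a t \<otimes>\<^bsub>K\<^esub> C0.coord J v t j = (if v j = t then a t else \<zero>\<^bsub>K\<^esub>)"
        using C0.coord_basis[OF B0 j j'(1)] j' at by simp
    qed (use a in auto)
    finally show ?thesis .
  qed
  have li: "C0.lin_indpt T"
  proof (rule C0.finite_lin_indpt2[OF finT TC])
    fix a assume a: "a \<in> T \<rightarrow> carrier K" and 0: "C0.lincomb a T = \<zero>\<^bsub>C0\<^esub>"
    show "\<forall>t\<in>T. a t = \<zero>\<^bsub>K\<^esub>"
    proof
      fix t assume t: "t \<in> T"
      then obtain j where j: "j \<in> J" "t = v j" using sPJ by (auto simp: T_def)
      have "(\<Oplus>\<^bsub>K\<^esub>t\<in>T. if v j = t then a t else \<zero>\<^bsub>K\<^esub>) = \<zero>\<^bsub>K\<^esub>"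
        using coT[OF a j(1)] 0 C0.coord_zero[OF B0 j(1)] by simp
      then show "a t = \<zero>\<^bsub>K\<^esub>"
        using C1.R.finsum_singleton[of "v j" T a] t finT a j(2) by simp
    qed
  qed
  define V where "V = C0.span T"
  have sub: "subspace K V C0" unfolding V_def by (rule C0.span_is_subspace[OF TC])
  have submod: "submodule K V C0" by (rule C0.is_module[OF sub])
  have VC: "V \<subseteq> carrier C0" by (rule submodule.subset[OF submod])
  have TV: "T \<subseteq> V" unfolding V_def by (rule C0.in_own_span[OF TC])
  interpret V: vectorspace K "C0\<lparr>carrier := V\<rparr>" by (rule C0.subspace_is_vs[OF sub])
  have "V.basis T"
    unfolding V.basis_def using C0.span_li_not_depend[OF TV submod] li TV V_def by simp
  then have dim: "V.dim = k" using V.dim_basis[OF finT] cardT by simp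
  have "T \<subseteq> imT"
  proof
    fix t assume "t \<in> T"
    then obtain i where i: "i \<in> P" "t = v (\<sigma> i)" by (auto simp: T_def)
    then have "t = d (w i)" using dD PD by auto
    then show "t \<in> imT" using C1.obasisD(3)[OF B1] i PD D_mem(1) by (auto simp: im_def)
  qed
  then have "V \<subseteq> imT"
    unfolding V_def by (rule C0.span_is_subset) (use imT_is_subspace in \<open>simp add: subspace_def\<close>)
  then have im: "V \<subseteq> d ` carrier C1" by (simp add: im_def)
  have "robust_element C1 l1 l0 d \<delta> x" if xV: "x \<in> V" and x0: "x \<noteq> \<zero>\<^bsub>C0\<^esub>" for x
    unfolding robust_element_def
  proof (intro ballI impI)
    fix y assume y: "y \<in> carrier C1" "d y = x"
    have xC: "x \<in> carrier C0" using xV VC by auto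
    obtain j where j: "j \<in> J" "l0 x = l0 (C0.coord J v x j \<odot>\<^bsub>C0\<^esub> v j)"
      using C0.l_coord_attained[OF B0 xC x0] .
    obtain r where r: "l0 x = ereal r" using C0.l_real[OF xC x0] .
    \<comment> \<open>At any other index the coordinate is zero, so the attained level would be
      \<open>-\<infinity>\<close>, while \<open>l0 x\<close> is finite.\<close>
    have "j \<in> \<sigma> ` P"
    proof (rule ccontr)
      assume nj: "j \<notin> \<sigma> ` P"
      obtain a where a: "a \<in> T \<rightarrow> carrier K" "x = C0.lincomb a T"
        using C0.finite_in_span[OF finT TC] xV unfolding V_def by blast
      have "v j \<notin> T"
      proof
        assume "v j \<in> T"
        then obtain j' where j': "j' \<in> \<sigma> ` P" "v j = v j'" unfolding T_def by blast
        then have "j = j'" using inj_onD[OF C0.obasis_inj[OF B0] j'(2) j(1)] sPJ by blast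
        then show False using nj j'(1) by simp
      qed
      then have "(\<Oplus>\<^bsub>K\<^esub>t\<in>T. if v j = t then a t else \<zero>\<^bsub>K\<^esub>) = (\<Oplus>\<^bsub>K\<^esub>t\<in>T. \<zero>\<^bsub>K\<^esub>)"
        by (intro C1.R.finsum_cong') auto
      then have "C0.coord J v x j = \<zero>\<^bsub>K\<^esub>" using coT[OF a(1) j(1)] a(2) by simp
      then show False using j C0.obasisD(3)[OF B0 j(1)] C0.l_zero r by simp
    qed
    then obtain i where i: "i \<in> P" "j = \<sigma> i" by blast
    have iD: "i \<in> D" using i PD by auto
    let ?c = "C1.coord I w y i"
    have c: "?c \<in> carrier K" by (rule C1.coord_closed'[OF B1 y(1) D_mem(1)[OF iD]])
    have "C0.coord J v x j = ?c" using coord_d(1)[OF y(1) j(1) iD i(2)] y(2) by simp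
    then have "l1 (?c \<odot>\<^bsub>C1\<^esub> w i) = l0 x + ereal (gap i)"
      using l1_smult_eq_gap[OF iD c] j(2) i(2) by simp
    then have le: "l0 x + ereal (gap i) \<le> l1 y"
      using C1.l_coord_le[OF B1 y(1) D_mem(1)[OF iD]] by simp
    obtain n where n: "n < k" "i = ds ! n" using i(1) k(1) by (auto simp: P_def in_set_conv_nth)
    have "gap (ds ! (k - 1)) \<le> gap i"
      using sorted_wrt_nth_less[OF ds(3), of n "k - 1"] n k by (cases "n = k - 1") auto
    then have "l0 x + ereal \<delta> < l0 x + ereal (gap i)" using \<delta> r by simp
    then show "l0 x + ereal \<delta> < l1 y" using le by (rule less_le_trans)
  qed
  then have "robust_subspace \<Gamma> C1 l1 C0 l0 d \<delta> V" using sub by (simp add: robust_subspace_def)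
  then show ?thesis using im dim by blast
qed

text \<open>The admissible \<delta> \<ge> 0 are those strictly below the \<open>k\<close>-th gap,
  which is approached from below. For gap 0, or for fewer than \<open>k\<close> gaps, only the
  adjoined 0 remains.\<close>

lemma boundary_depth_eq:
  assumes fd: "vectorspace.fin_dim K C0" and k: "k > 0"
    and ds: "distinct ds" "set ds = D" "sorted_wrt (\<lambda>i j. gap i \<ge> gap j) ds"
  shows "boundary_depth \<Gamma> C1 l1 C0 l0 d k = ereal (if k \<le> length ds then gap (ds ! (k - 1)) else 0)"
proof -
  have "(\<exists>V. robust_subspace \<Gamma> C1 l1 C0 l0 d \<delta> V \<and> V \<subseteq> d ` carrier C1 \<and>
      vectorspace.dim K (C0\<lparr>carrier := V\<rparr>) = k) \<longleftrightarrow> k \<le> length ds \<and> \<delta> < gap (ds ! (k - 1))" for \<delta>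
    using robust_dim_bound[OF fd _ _ _ k ds] robust_subspace_exists[OF _ _ k ds] by blast
  then have eq: "boundary_depth \<Gamma> C1 l1 C0 l0 d k =
      Sup ({0} \<union> {ereal \<delta> |\<delta>. \<delta> \<ge> 0 \<and> k \<le> length ds \<and> \<delta> < gap (ds ! (k - 1))})"
    by (simp add: boundary_depth_def)
  show ?thesis
  proof (cases "k \<le> length ds")
    case True
    let ?b = "gap (ds ! (k - 1))"
    have b: "?b \<ge> 0" using True k ds(2) by (intro gap_nonneg) auto
    have "Sup ({0} \<union> {ereal \<delta> |\<delta>. \<delta> \<ge> 0 \<and> k \<le> length ds \<and> \<delta> < ?b}) = ereal ?b"
    proof (rule antisym)
      show "Sup ({0} \<union> {ereal \<delta> |\<delta>. \<delta> \<ge> 0 \<and> k \<le> length ds \<and> \<delta> < ?b}) \<le> ereal ?b"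
        using b by (intro Sup_least) auto
      show "ereal ?b \<le> Sup ({0} \<union> {ereal \<delta> |\<delta>. \<delta> \<ge> 0 \<and> k \<le> length ds \<and> \<delta> < ?b})"
      proof (rule dense_le)
        fix x assume x: "x < ereal ?b"
        show "x \<le> Sup ({0} \<union> {ereal \<delta> |\<delta>. \<delta> \<ge> 0 \<and> k \<le> length ds \<and> \<delta> < ?b})"
        proof (cases "x < 0")
          case True
          then show ?thesis by (intro Sup_upper2[of 0]) auto
        next
          case False
          then obtain \<delta> where "x = ereal \<delta>" using x by (cases x) auto
          then show ?thesis using False x True by (intro Sup_upper) auto
        qed
      qed
    qed
    then show ?thesis using eq True by simp
  qed (simp add: eq)
qed

end

subsection \<open>Coordinates on extensions of scalars\<close>

text \<open>The additive extension of \<open>f\<close> to formal sums, with integers acting through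
  \<open>of_int\<close>. Its values are coefficient functions added pointwise, as series
  are.\<close>

definition frag_lift :: "('z \<Rightarrow> real \<Rightarrow> 'k::field) \<Rightarrow> ('z \<Rightarrow>\<^sub>0 int) \<Rightarrow> real \<Rightarrow> 'k" where
  "frag_lift f p = (\<lambda>g. \<Sum>z\<in>Poly_Mapping.keys p. of_int (Poly_Mapping.lookup p z) * f z g)"

lemma frag_lift_0 [simp]: "frag_lift f 0 = (\<lambda>g. 0)"
  by (simp add: frag_lift_def)

lemma frag_lift_of [simp]: "frag_lift f (frag_of z) = f z"
  by (simp add: frag_lift_def)

lemma frag_lift_add: "frag_lift f (p + q) = (\<lambda>g. frag_lift f p g + frag_lift f q g)"
  unfolding frag_lift_def
  by (rule ext, rule setsum_keys_plus_distrib) (auto simp: distrib_right)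

lemma frag_lift_minus: "frag_lift f (- p) = (\<lambda>g. - frag_lift f p g)"
  by (simp add: frag_lift_def sum_negf)

lemma frag_lift_diff: "frag_lift f (p - q) = (\<lambda>g. frag_lift f p g - frag_lift f q g)"
  using frag_lift_add[of f p "- q"] by (simp add: frag_lift_minus)

lemma frag_lift_sum: "frag_lift f (\<Sum>i\<in>S. p i) = (\<lambda>g. \<Sum>i\<in>S. frag_lift f (p i) g)"
  by (induction S rule: infinite_finite_induct) (auto simp: frag_lift_add)

lemma frag_lift_extend:
  "frag_lift f (frag_extend (\<lambda>z. frag_of (h z)) p) = frag_lift (\<lambda>z. f (h z)) p"
  by (rule frag_induction[of p UNIV]) (simp_all add: frag_extend_diff frag_lift_diff)

lemma frag_lift_cong:
  "(\<And>z. z \<in> Poly_Mapping.keys p \<Longrightarrow> f z = f' z) \<Longrightarrow> frag_lift f p = frag_lift f' p"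
  unfolding frag_lift_def by (intro ext sum.cong) auto

lemma mult_diff_series:
  assumes "f \<in> carrier novikov_univ" "g \<in> carrier novikov_univ" "h \<in> carrier novikov_univ"
  shows "mult novikov_univ f (\<lambda>x. g x - h x) = (\<lambda>x. mult novikov_univ f g x - mult novikov_univ f h x)"
proof -
  interpret cring "novikov_univ :: 'a series ring" by (rule cring_novikov_univ)
  have "f \<otimes>\<^bsub>novikov_univ\<^esub> (g \<ominus>\<^bsub>novikov_univ\<^esub> h) =
      f \<otimes>\<^bsub>novikov_univ\<^esub> g \<ominus>\<^bsub>novikov_univ\<^esub> f \<otimes>\<^bsub>novikov_univ\<^esub> h"
    using assms by (simp add: minus_eq r_distr r_minus)
  then show ?thesis using assms by (simp add: a_minus_series)
qed

lemma mult_zero_series: "mult (novikov \<Gamma>) f (\<lambda>x. 0) = (\<lambda>x. 0)"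
  by (simp add: mult_novikov_apply fun_eq_iff)

section \<open>Formal sums modulo the bilinearity relations\<close>

context nonarch
begin

abbreviation "S \<equiv> novikov_univ :: 'k series ring"
abbreviation "F \<equiv> tensor_free S C"
abbreviation "N \<equiv> tensor_relations K S C"
abbreviation "cl \<equiv> tensor_class K S C"
abbreviation "TE \<equiv> extend_novikov \<Gamma> C"

definition gens :: "('c \<times> 'k series \<Rightarrow>\<^sub>0 int) set" where
  "gens = {frag_of (x \<oplus>\<^bsub>C\<^esub> y, s) - frag_of (x, s) - frag_of (y, s) | x y s.
         x \<in> carrier C \<and> y \<in> carrier C \<and> s \<in> carrier S} \<union>
      {frag_of (x, s \<oplus>\<^bsub>S\<^esub> t) - frag_of (x, s) - frag_of (x, t) | x s t.
         x \<in> carrier C \<and> s \<in> carrier S \<and> t \<in> carrier S} \<union>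
      {frag_of (r \<odot>\<^bsub>C\<^esub> x, s) - frag_of (x, r \<otimes>\<^bsub>S\<^esub> s) | r x s.
         r \<in> carrier K \<and> x \<in> carrier C \<and> s \<in> carrier S}"

lemma N_eq: "N = generate F gens"
  by (simp add: tensor_relations_def gens_def)

lemma K_S: "a \<in> carrier K \<Longrightarrow> a \<in> carrier S"
  using carrier_novikov_sub by blast

lemma F_simps [simp]:
  "x \<in> carrier F \<longleftrightarrow> Poly_Mapping.keys x \<subseteq> carrier C \<times> carrier S"
  "\<one>\<^bsub>F\<^esub> = 0" "x \<otimes>\<^bsub>F\<^esub> y = x + y"
  by (simp_all add: tensor_free_def)

lemma comm_group_F: "comm_group F"
  by (simp add: tensor_free_def abelian_free_Abelian_group)

lemma inv_F: "x \<in> carrier F \<Longrightarrow> inv\<^bsub>F\<^esub> x = - x"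
  unfolding tensor_free_def by (rule inv_free_Abelian_group) simp

lemma frag_of_F: "x \<in> carrier C \<Longrightarrow> s \<in> carrier S \<Longrightarrow> frag_of (x, s) \<in> carrier F"
  by simp

lemma F_add: "p \<in> carrier F \<Longrightarrow> q \<in> carrier F \<Longrightarrow> p + q \<in> carrier F"
  unfolding F_simps using keys_add[of p q] by blast

lemma F_diff: "p \<in> carrier F \<Longrightarrow> q \<in> carrier F \<Longrightarrow> p - q \<in> carrier F"
  unfolding F_simps using keys_diff[of p q] by blast

lemma F_induct [consumes 1, case_names zero diff gen]:
  assumes "p \<in> carrier F" and "P 0"
    and "\<And>p q. p \<in> carrier F \<Longrightarrow> q \<in> carrier F \<Longrightarrow> P p \<Longrightarrow> P q \<Longrightarrow> P (p - q)"
    and "\<And>x s. x \<in> carrier C \<Longrightarrow> s \<in> carrier S \<Longrightarrow> P (frag_of (x, s))"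
  shows "P p"
  by (rule free_Abelian_group_induct[of p "carrier C \<times> carrier S"]) (use assms in auto)

lemma gens_F: "gens \<subseteq> carrier F"
proof -
  interpret S: cring S by (rule cring_novikov_univ)
  show ?thesis
  proof
    fix g assume "g \<in> gens"
    then show "g \<in> carrier F"
      unfolding gens_def
    proof (elim UnE; elim CollectE exE conjE)
      fix x y s assume "g = frag_of (x \<oplus>\<^bsub>C\<^esub> y, s) - frag_of (x, s) - frag_of (y, s)"
        and x: "x \<in> carrier C" "y \<in> carrier C" "s \<in> carrier S"
      then show ?thesis by (simp only:) (intro F_diff frag_of_F M.a_closed x)
    next
      fix x s t assume "g = frag_of (x, s \<oplus>\<^bsub>S\<^esub> t) - frag_of (x, s) - frag_of (x, t)"
        and x: "x \<in> carrier C" "s \<in> carrier S" "t \<in> carrier S"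
      then show ?thesis by (simp only:) (intro F_diff frag_of_F S.a_closed x)
    next
      fix r x s assume "g = frag_of (r \<odot>\<^bsub>C\<^esub> x, s) - frag_of (x, r \<otimes>\<^bsub>S\<^esub> s)"
        and x: "r \<in> carrier K" "x \<in> carrier C" "s \<in> carrier S"
      then show ?thesis by (simp only:) (intro F_diff frag_of_F smult_closed S.m_closed K_S[OF x(1)] x)
    qed
  qed
qed

lemma N_subgroup: "subgroup N F"
  unfolding N_eq using group.generate_is_subgroup[OF comm_group.axioms(2)[OF comm_group_F] gens_F] .

lemma N_F: "p \<in> N \<Longrightarrow> p \<in> carrier F"
  by (rule subgroup.mem_carrier[OF N_subgroup])

lemma N_add: "p \<in> N \<Longrightarrow> q \<in> N \<Longrightarrow> p + q \<in> N"
  using subgroup.m_closed[OF N_subgroup] by simp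

lemma N_zero: "0 \<in> N"
  using subgroup.one_closed[OF N_subgroup] by simp

lemma N_minus: "p \<in> N \<Longrightarrow> - p \<in> N"
  using subgroup.m_inv_closed[OF N_subgroup, of p] inv_F[OF N_F, of p] by simp

lemma N_diff: "p \<in> N \<Longrightarrow> q \<in> N \<Longrightarrow> p - q \<in> N"
  using N_add[OF _ N_minus] by fastforce

lemma N_gens: "g \<in> gens \<Longrightarrow> g \<in> N"
  unfolding N_eq by (rule generate.incl)

lemma N_rel:
  shows "x \<in> carrier C \<Longrightarrow> y \<in> carrier C \<Longrightarrow> s \<in> carrier S \<Longrightarrow>
      frag_of (x \<oplus>\<^bsub>C\<^esub> y, s) - frag_of (x, s) - frag_of (y, s) \<in> N"
    and "x \<in> carrier C \<Longrightarrow> s \<in> carrier S \<Longrightarrow> t \<in> carrier S \<Longrightarrow>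
      frag_of (x, s \<oplus>\<^bsub>S\<^esub> t) - frag_of (x, s) - frag_of (x, t) \<in> N"
    and "r \<in> carrier K \<Longrightarrow> x \<in> carrier C \<Longrightarrow> s \<in> carrier S \<Longrightarrow>
      frag_of (r \<odot>\<^bsub>C\<^esub> x, s) - frag_of (x, r \<otimes>\<^bsub>S\<^esub> s) \<in> N"
  by (rule N_gens, unfold gens_def, blast)+

text \<open>The \<open>i\<close>-th coordinate of a tensor, sending x \<otimes> s to the
  \<open>i\<close>-th coordinate of x times s; it is taken on formal sums, before passing to
  cosets.\<close>

definition coh :: "'i set \<Rightarrow> ('i \<Rightarrow> 'c) \<Rightarrow> 'i \<Rightarrow> ('c \<times> 'k series \<Rightarrow>\<^sub>0 int) \<Rightarrow> 'k series" where
  "coh I w i = frag_lift (\<lambda>(x, s). mult S (coord I w x i) s)"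

lemma coh_gen [simp]: "coh I w i (frag_of (x, s)) = mult S (coord I w x i) s"
  by (simp add: coh_def)

lemma coh_simps:
  "coh I w i 0 = (\<lambda>g. 0)"
  "coh I w i (p + q) = (\<lambda>g. coh I w i p g + coh I w i q g)"
  "coh I w i (- p) = (\<lambda>g. - coh I w i p g)"
  "coh I w i (p - q) = (\<lambda>g. coh I w i p g - coh I w i q g)"
  "coh I w i (\<Sum>k\<in>A. f k) = (\<lambda>g. \<Sum>k\<in>A. coh I w i (f k) g)"
  by (simp_all add: coh_def frag_lift_add frag_lift_minus frag_lift_diff frag_lift_sum)

lemma diff_closed_S: "f \<in> carrier S \<Longrightarrow> h \<in> carrier S \<Longrightarrow> (\<lambda>x. f x - h x) \<in> carrier S"
proof -
  interpret S: cring S by (rule cring_novikov_univ)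
  show "f \<in> carrier S \<Longrightarrow> h \<in> carrier S \<Longrightarrow> (\<lambda>x. f x - h x) \<in> carrier S"
    using S.minus_closed[of f h] a_minus_series[of h f] by simp
qed

lemma sum_closed_S: "(\<And>i. i \<in> A \<Longrightarrow> f i \<in> carrier S) \<Longrightarrow> (\<lambda>x. \<Sum>i\<in>A. f i x) \<in> carrier S"
  by (induction A rule: infinite_finite_induct) (auto simp: zero_closed_series add_closed_series)

lemma coord_S: "obasis I w \<Longrightarrow> x \<in> carrier C \<Longrightarrow> i \<in> I \<Longrightarrow> coord I w x i \<in> carrier S"
  by (rule K_S[OF coord_closed'])

lemma coh_closed:
  assumes B: "obasis I w" and i: "i \<in> I" and p: "p \<in> carrier F"
  shows "coh I w i p \<in> carrier S"
  using p
proof (induction p rule: F_induct)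
  case (gen x s)
  then show ?case using coord_S[OF B _ i] by (simp add: mult_closed_series)
qed (auto simp: coh_simps zero_closed_series diff_closed_S)

text \<open>The functional is additive in both slots and balanced over \<open>K\<close>, so it kills
  each generating relation and with them the whole subgroup.\<close>

lemma coh_N:
  assumes B: "obasis I w" and i: "i \<in> I" and p: "p \<in> N"
  shows "coh I w i p = (\<lambda>g. 0)"
proof -
  interpret S: cring S by (rule cring_novikov_univ)
  have gens0: "coh I w i g = (\<lambda>g. 0)" if "g \<in> gens" for g
    using that unfolding gens_def
  proof (elim UnE; elim CollectE exE conjE)
    fix x y s
    assume *: "g = frag_of (x \<oplus>\<^bsub>C\<^esub> y, s) - frag_of (x, s) - frag_of (y, s)"
      "x \<in> carrier C" "y \<in> carrier C" "s \<in> carrier S"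
    have "mult S (coord I w (x \<oplus>\<^bsub>C\<^esub> y) i) s =
        (\<lambda>g. mult S (coord I w x i) s g + mult S (coord I w y i) s g)"
      using S.l_distr[OF coord_S[OF B *(2) i] coord_S[OF B *(3) i] *(4)] coord_add[OF B *(2,3) i]
      by (simp add: novikov_simps)
    then show ?thesis by (simp add: *(1) coh_simps)
  next
    fix x s t
    assume *: "g = frag_of (x, s \<oplus>\<^bsub>S\<^esub> t) - frag_of (x, s) - frag_of (x, t)"
      "x \<in> carrier C" "s \<in> carrier S" "t \<in> carrier S"
    have "mult S (coord I w x i) (s \<oplus>\<^bsub>S\<^esub> t) =
        (\<lambda>g. mult S (coord I w x i) s g + mult S (coord I w x i) t g)"
      using S.r_distr[OF *(3,4) coord_S[OF B *(2) i]] by (simp add: novikov_simps)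
    then show ?thesis by (simp add: *(1) coh_simps)
  next
    fix r x s
    assume *: "g = frag_of (r \<odot>\<^bsub>C\<^esub> x, s) - frag_of (x, r \<otimes>\<^bsub>S\<^esub> s)"
      "r \<in> carrier K" "x \<in> carrier C" "s \<in> carrier S"
    have "mult S (coord I w (r \<odot>\<^bsub>C\<^esub> x) i) s = mult S (mult S r (coord I w x i)) s"
      using coord_smult[OF B *(3,2) i] mult_novikov[of \<Gamma>, where ?'a = 'k] by simp
    also have "\<dots> = mult S (coord I w x i) (mult S r s)"
      using K_S[OF *(2)] *(4) coord_S[OF B *(3) i] by (simp add: S.m_ac)
    finally show ?thesis by (simp add: *(1) coh_simps)
  qed
  show ?thesis using p unfolding N_eq
  proof (induction p rule: generate.induct)
    case (inv h)
    have "h \<in> carrier F" using inv gens_F by blast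
    then show ?case using gens0[OF inv] by (simp add: inv_F coh_simps del: F_simps(1))
  qed (use gens0 in \<open>auto simp: coh_simps\<close>)
qed

lemma frag_zero_N:
  assumes "x \<in> carrier C" "s \<in> carrier S"
  shows "frag_of (x, \<zero>\<^bsub>S\<^esub>) \<in> N" and "frag_of (\<zero>\<^bsub>C\<^esub>, s) \<in> N"
proof -
  interpret S: cring S by (rule cring_novikov_univ)
  \<comment> \<open>Additivity with both summands zero reads 0 + 0 = 0, so this relation is minus
    the symbol itself.\<close>
  have "- frag_of (x, \<zero>\<^bsub>S\<^esub>) \<in> N" using N_rel(2)[OF assms(1) S.zero_closed S.zero_closed] by simp
  then show "frag_of (x, \<zero>\<^bsub>S\<^esub>) \<in> N" using N_minus by fastforce
  have "- frag_of (\<zero>\<^bsub>C\<^esub>, s) \<in> N" using N_rel(1)[OF M.zero_closed M.zero_closed assms(2)] by simp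
  then show "frag_of (\<zero>\<^bsub>C\<^esub>, s) \<in> N" using N_minus by fastforce
qed

lemma frag_lcomb_N:
  assumes "finite A" "w \<in> A \<rightarrow> carrier C" "c \<in> A \<rightarrow> carrier K" and s: "s \<in> carrier S"
  shows "frag_of (lcomb A w c, s) - (\<Sum>i\<in>A. frag_of (w i, mult S (c i) s)) \<in> N"
  using assms(1-3)
proof (induction A rule: finite_induct)
  case empty
  then show ?case using frag_zero_N(2)[OF M.zero_closed s] by (simp add: lcomb_def)
next
  case (insert i A)
  have i: "w i \<in> carrier C" "c i \<in> carrier K" and A: "w \<in> A \<rightarrow> carrier C" "c \<in> A \<rightarrow> carrier K"
    using insert.prems by auto
  let ?x = "c i \<odot>\<^bsub>C\<^esub> w i" and ?y = "lcomb A w c"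
  have xy: "?x \<in> carrier C" "?y \<in> carrier C" using i lcomb_closed[OF A] by auto
  have "lcomb (insert i A) w c = ?x \<oplus>\<^bsub>C\<^esub> ?y"
    unfolding lcomb_def by (rule M.finsum_insert) (use insert.hyps i A in \<open>auto simp: Pi_iff\<close>)
  then have "frag_of (lcomb (insert i A) w c, s) - (\<Sum>i\<in>insert i A. frag_of (w i, mult S (c i) s)) =
      (frag_of (?x \<oplus>\<^bsub>C\<^esub> ?y, s) - frag_of (?x, s) - frag_of (?y, s)) +
      (frag_of (?x, s) - frag_of (w i, mult S (c i) s)) +
      (frag_of (?y, s) - (\<Sum>i\<in>A. frag_of (w i, mult S (c i) s)))"
    using insert.hyps by simp
  also have "\<dots> \<in> N"
    by (intro N_add N_rel(1)[OF xy s] N_rel(3)[OF i(2,1) s] insert.IH[OF A])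
  finally show ?case .
qed

text \<open>Every formal sum is congruent to a normal form built from its coordinates. Together with
  \<open>coh_N\<close> this makes \<open>N\<close> the common kernel of the coordinate
  functionals.\<close>

lemma reduce_N:
  assumes B: "obasis I w" and p: "p \<in> carrier F"
  shows "p - (\<Sum>i\<in>I. frag_of (w i, coh I w i p)) \<in> N"
  using p
proof (induction p rule: F_induct)
  case zero
  have "(\<Sum>i\<in>A. frag_of (w i, \<zero>\<^bsub>S\<^esub>)) \<in> N" if "A \<subseteq> I" for A
    using that
    by (induction A rule: infinite_finite_induct)
      (auto simp: N_zero intro!: N_add frag_zero_N(1)[OF _ zero_closed_series] obasisD(3)[OF B])
  then show ?case using N_minus[of "\<Sum>i\<in>I. frag_of (w i, \<zero>\<^bsub>S\<^esub>)"] by (simp add: coh_simps novikov_simps)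
next
  case (diff p q)
  let ?s = "\<lambda>i. coh I w i p" and ?t = "\<lambda>i. coh I w i q"
  \<comment> \<open>Additivity in the second slot, applied to \<open>?t i\<close> plus the
    difference, compares a difference of normal forms with the normal form of the
    difference.\<close>
  have step: "(\<Sum>i\<in>A. frag_of (w i, ?s i) - frag_of (w i, ?t i) - frag_of (w i, \<lambda>g. ?s i g - ?t i g)) \<in> N"
    if "A \<subseteq> I" for A
    using that
  proof (induction A rule: infinite_finite_induct)
    case (insert i A)
    then have i: "i \<in> I" by simp
    have st: "?s i \<in> carrier S" "?t i \<in> carrier S" using coh_closed[OF B i] diff.hyps by blast+
    have d: "(\<lambda>g. ?s i g - ?t i g) \<in> carrier S" by (rule diff_closed_S[OF st])
    have "frag_of (w i, ?s i) - frag_of (w i, \<lambda>g. ?s i g - ?t i g) - frag_of (w i, ?t i) \<in> N"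
      using N_rel(2)[OF obasisD(3)[OF B i] d st(2)] by (simp add: novikov_simps)
    then have "frag_of (w i, ?s i) - frag_of (w i, ?t i) - frag_of (w i, \<lambda>g. ?s i g - ?t i g) \<in> N"
      by (simp add: diff_diff_eq add.commute)
    then show ?case using insert by (simp add: N_add)
  qed (auto simp: N_zero)
  have "p - q - (\<Sum>i\<in>I. frag_of (w i, coh I w i (p - q))) =
      (p - (\<Sum>i\<in>I. frag_of (w i, ?s i))) - (q - (\<Sum>i\<in>I. frag_of (w i, ?t i))) +
      (\<Sum>i\<in>I. frag_of (w i, ?s i) - frag_of (w i, ?t i) - frag_of (w i, \<lambda>g. ?s i g - ?t i g))"
    by (simp add: coh_simps sum_subtractf)
  also have "\<dots> \<in> N" by (intro N_add N_diff diff.IH step order_refl)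
  finally show ?case .
next
  case (gen x s)
  have "frag_of (lcomb I w (coord I w x), s) - (\<Sum>i\<in>I. frag_of (w i, mult S (coord I w x i) s)) \<in> N"
    by (rule frag_lcomb_N[OF obasisD(1,2)[OF B] coord_closed(1)[OF B gen(1)] gen(2)])
  then show ?case using lcomb_coord[OF B gen(1)] by simp
qed

lemma cl_eq: "cl p = (\<lambda>n. n + p) ` N"
  by (auto simp: tensor_class_def r_coset_def)

lemma cl_self: "p \<in> cl p"
  unfolding cl_eq using N_zero by force

lemma cl_eq_iff: "cl p = cl q \<longleftrightarrow> p - q \<in> N"
proof
  assume "cl p = cl q"
  then have "p \<in> cl q" using cl_self by blast
  then show "p - q \<in> N" unfolding cl_eq by auto
next
  assume pq: "p - q \<in> N"
  have "n + p \<in> cl q" if "n \<in> N" for n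
  proof -
    have "n + p = (n + (p - q)) + q" by simp
    then show ?thesis unfolding cl_eq using N_add[OF that pq] by blast
  qed
  moreover have "n + q \<in> cl p" if "n \<in> N" for n
  proof -
    have "n + q = (n - (p - q)) + p" by simp
    then show ?thesis unfolding cl_eq using N_diff[OF that pq] by blast
  qed
  ultimately show "cl p = cl q" unfolding cl_eq by blast
qed

text \<open>In effect the elements \<open>w i \<otimes> 1\<close> are independent over the universal
  field; later identities in the tensor product reduce to identities between coordinates.\<close>

lemma cl_eq_iff_coh:
  assumes B: "obasis I w" and p: "p \<in> carrier F" and q: "q \<in> carrier F"
  shows "cl p = cl q \<longleftrightarrow> (\<forall>i\<in>I. coh I w i p = coh I w i q)"
proof
  assume "cl p = cl q"
  then have "p - q \<in> N" by (simp add: cl_eq_iff)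
  then have "coh I w i (p - q) = (\<lambda>g. 0)" if "i \<in> I" for i by (rule coh_N[OF B that])
  then show "\<forall>i\<in>I. coh I w i p = coh I w i q" by (simp add: coh_simps fun_eq_iff)
next
  assume eq: "\<forall>i\<in>I. coh I w i p = coh I w i q"
  have "p - q = (p - (\<Sum>i\<in>I. frag_of (w i, coh I w i p))) - (q - (\<Sum>i\<in>I. frag_of (w i, coh I w i q)))"
    using eq by simp
  also have "\<dots> \<in> N" by (intro N_diff reduce_N[OF B] p q)
  finally show "cl p = cl q" by (simp add: cl_eq_iff)
qed

text \<open>The coordinate of a coset, read off from an arbitrary representative;
  \<open>coh_mem_cl\<close> shows that the choice does not matter.\<close>

definition kap :: "'i set \<Rightarrow> ('i \<Rightarrow> 'c) \<Rightarrow> ('c \<times> 'k series \<Rightarrow>\<^sub>0 int) set \<Rightarrow> 'i \<Rightarrow> 'k series" where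
  "kap I w X i = coh I w i (SOME p. p \<in> X)"

lemma coh_mem_cl:
  assumes B: "obasis I w" and i: "i \<in> I" and "q \<in> cl p"
  shows "coh I w i q = coh I w i p"
proof -
  obtain n where "n \<in> N" "q = n + p" using assms(3) unfolding cl_eq by blast
  then show ?thesis using coh_N[OF B i] by (simp add: coh_simps)
qed

lemma cl_F: "p \<in> carrier F \<Longrightarrow> q \<in> cl p \<Longrightarrow> q \<in> carrier F"
  unfolding cl_eq by (auto simp del: F_simps intro: F_add N_F)

lemma kap_cl: "obasis I w \<Longrightarrow> i \<in> I \<Longrightarrow> kap I w (cl p) i = coh I w i p"
  unfolding kap_def by (rule coh_mem_cl, assumption, assumption, rule someI, rule cl_self)

lemma TE_carrier: "carrier TE = cl ` carrier F"
  by (auto simp: extend_scalars_def FactGroup_def RCOSETS_def tensor_class_def)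

lemma TE_add:
  assumes "p \<in> carrier F" "q \<in> carrier F"
  shows "cl p \<oplus>\<^bsub>TE\<^esub> cl q = cl (p + q)"
proof -
  interpret F: comm_group F by (rule comm_group_F)
  have "N \<lhd> F" by (rule F.subgroup_imp_normal[OF N_subgroup])
  then have "cl p <#>\<^bsub>F\<^esub> cl q = cl (p + q)"
    using normal.rcos_sum[of N F p q] assms by (simp add: tensor_class_def)
  then show ?thesis by (simp add: extend_scalars_def FactGroup_def)
qed

lemma TE_zero: "\<zero>\<^bsub>TE\<^esub> = cl 0"
  by (simp add: extend_scalars_def FactGroup_def cl_eq)

lemma act_F:
  assumes s: "s \<in> carrier S" and p: "p \<in> carrier F"
  shows "frag_extend (\<lambda>(x, t). frag_of (x, mult S s t)) p \<in> carrier F"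
  using p
proof (induction p rule: F_induct)
  case (diff p q)
  then show ?case by (simp add: frag_extend_diff F_diff del: F_simps)
next
  case (gen x t)
  then show ?case using s by (simp add: mult_closed_series)
qed simp

lemma act_coh:
  assumes B: "obasis I w" and i: "i \<in> I" and s: "s \<in> carrier S" and p: "p \<in> carrier F"
  shows "coh I w i (frag_extend (\<lambda>(x, t). frag_of (x, mult S s t)) p) = mult S s (coh I w i p)"
  using p
proof (induction p rule: F_induct)
  case zero
  then show ?case by (simp add: coh_simps mult_zero_series)
next
  case (diff p q)
  then show ?case
    using coh_closed[OF B i] s by (simp add: frag_extend_diff coh_simps mult_diff_series del: F_simps)
next
  case (gen x t)
  interpret S: cring S by (rule cring_novikov_univ)
  show ?case using gen s coord_S[OF B gen(1) i] by (simp add: S.m_lcomm)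
qed

text \<open>Scaling is given as a union over all representatives. Their scaled versions have equal
  coordinates in the basis, so all cosets in the union agree.\<close>

lemma TE_smult:
  assumes ex: "obasis I w" and s: "s \<in> carrier S" and p: "p \<in> carrier F"
  shows "s \<odot>\<^bsub>TE\<^esub> cl p = cl (frag_extend (\<lambda>(x, t). frag_of (x, mult S s t)) p)"
proof -
  let ?a = "frag_extend (\<lambda>(x, t). frag_of (x, mult S s t))"
  have "cl (?a q) = cl (?a p)" if q: "q \<in> cl p" for q
    using cl_eq_iff_coh[OF ex act_F[OF s cl_F[OF p q]] act_F[OF s p]]
      act_coh[OF ex _ s] cl_F[OF p q] p coh_mem_cl[OF ex _ q] by simp
  then have "(\<Union>q\<in>cl p. cl (?a q)) = (\<Union>q\<in>cl p. cl (?a p))" by (intro SUP_cong refl)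
  also have "\<dots> = cl (?a p)" using cl_self by auto
  finally show ?thesis by (simp add: extend_scalars_def)
qed

lemma kap_closed:
  assumes "obasis I w" "X \<in> carrier TE" "i \<in> I" shows "kap I w X i \<in> carrier S"
  using assms(2) unfolding TE_carrier
  by (auto simp: kap_cl[OF assms(1,3)] simp del: F_simps intro: coh_closed[OF assms(1,3)])

lemma kap_eqI:
  assumes B: "obasis I w" and "X \<in> carrier TE" "Y \<in> carrier TE" "\<And>i. i \<in> I \<Longrightarrow> kap I w X i = kap I w Y i"
  shows "X = Y"
proof -
  obtain p q where pq: "p \<in> carrier F" "X = cl p" "q \<in> carrier F" "Y = cl q"
    using assms(2,3) unfolding TE_carrier by blast
  then show ?thesis using assms(4) cl_eq_iff_coh[OF B pq(1,3)] kap_cl[OF B] by simp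
qed

lemma kap_surj:
  assumes B: "obasis I w" and c: "c \<in> I \<rightarrow> carrier S"
  shows "\<exists>X\<in>carrier TE. \<forall>i\<in>I. kap I w X i = c i"
proof -
  interpret S: cring S by (rule cring_novikov_univ)
  define p where "p = (\<Sum>k\<in>I. frag_of (w k, c k))"
  have "(\<Sum>k\<in>A. frag_of (w k, c k)) \<in> carrier F" if "A \<subseteq> I" for A
    using that
  proof (induction A rule: infinite_finite_induct)
    case (insert a A)
    then have "frag_of (w a, c a) \<in> carrier F" using obasisD(3)[OF B] c by (intro frag_of_F) auto
    then show ?case using insert F_add by (simp del: F_simps)
  qed auto
  then have p: "p \<in> carrier F" by (simp add: p_def del: F_simps)
  have "coh I w i p = c i" if i: "i \<in> I" for i
  proof -
    have ck: "c k \<in> carrier S" if "k \<in> I" for k using c that by (rule Pi_mem)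
    have "mult S (coord I w (w k) i) (c k) = (if k = i then c i else (\<lambda>g. 0))" if "k \<in> I" for k
      using coord_basis[OF B i that] S.l_one[OF ck[OF that]] S.l_null[OF ck[OF that]]
      by (auto simp: novikov_simps)
    then have "coh I w i p = (\<lambda>g. \<Sum>k\<in>I. (if k = i then c i else (\<lambda>g. 0)) g)"
      unfolding p_def coh_simps coh_gen by (intro ext sum.cong) auto
    also have "\<dots> = c i"
    proof
      fix g
      have "(\<Sum>k\<in>I. (if k = i then c i else (\<lambda>g. 0)) g) = (\<Sum>k\<in>I. if k = i then c i g else 0)"
        by (rule sum.cong) auto
      then show "(\<Sum>k\<in>I. (if k = i then c i else (\<lambda>g. 0)) g) = c i g"
        using i obasisD(1)[OF B] by simp
    qed
    finally show ?thesis .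
  qed
  then show ?thesis using p by (intro bexI[of _ "cl p"]) (auto simp: TE_carrier kap_cl[OF B] simp del: F_simps)
qed

lemma kap_add:
  assumes B: "obasis I w" and "X \<in> carrier TE" "Y \<in> carrier TE"
  shows "X \<oplus>\<^bsub>TE\<^esub> Y \<in> carrier TE"
    and "i \<in> I \<Longrightarrow> kap I w (X \<oplus>\<^bsub>TE\<^esub> Y) i = (\<lambda>g. kap I w X i g + kap I w Y i g)"
proof -
  obtain p q where pq: "p \<in> carrier F" "X = cl p" "q \<in> carrier F" "Y = cl q"
    using assms(2,3) unfolding TE_carrier by blast
  show "X \<oplus>\<^bsub>TE\<^esub> Y \<in> carrier TE"
    unfolding pq(2,4) TE_add[OF pq(1,3)] TE_carrier by (rule imageI) (rule F_add[OF pq(1,3)])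
  show "i \<in> I \<Longrightarrow> kap I w (X \<oplus>\<^bsub>TE\<^esub> Y) i = (\<lambda>g. kap I w X i g + kap I w Y i g)"
    unfolding pq(2,4) TE_add[OF pq(1,3)] by (simp add: kap_cl[OF B] coh_simps)
qed

lemma kap_smult:
  assumes B: "obasis I w" and s: "s \<in> carrier S" and "X \<in> carrier TE"
  shows "s \<odot>\<^bsub>TE\<^esub> X \<in> carrier TE"
    and "i \<in> I \<Longrightarrow> kap I w (s \<odot>\<^bsub>TE\<^esub> X) i = mult S s (kap I w X i)"
proof -
  obtain p where p: "p \<in> carrier F" "X = cl p"
    using assms(3) unfolding TE_carrier by blast
  show "s \<odot>\<^bsub>TE\<^esub> X \<in> carrier TE"
    unfolding p(2) TE_smult[OF B s p(1)] TE_carrier by (rule imageI) (rule act_F[OF s p(1)])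
  show "i \<in> I \<Longrightarrow> kap I w (s \<odot>\<^bsub>TE\<^esub> X) i = mult S s (kap I w X i)"
    unfolding p(2) TE_smult[OF B s p(1)] by (simp add: kap_cl[OF B] act_coh[OF B _ s p(1)])
qed

lemma kap_zero:
  assumes B: "obasis I w"
  shows "\<zero>\<^bsub>TE\<^esub> \<in> carrier TE" and "i \<in> I \<Longrightarrow> kap I w \<zero>\<^bsub>TE\<^esub> i = (\<lambda>g. 0)"
  unfolding TE_zero TE_carrier by (simp, simp add: kap_cl[OF B] coh_simps)

text \<open>Coordinates are additive and jointly injective, so the group laws are inherited from
  series; negatives are supplied by \<open>kap_surj\<close>.\<close>

lemma abelian_group_TE:
  assumes B: "obasis I w" shows "abelian_group TE"
proof (rule abelian_groupI)
  fix X Y Z assume X: "X \<in> carrier TE" and Y: "Y \<in> carrier TE" and Z: "Z \<in> carrier TE"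
  note c = kap_add(1)[OF B] kap_zero(1)[OF B] and k = kap_add(2)[OF B] kap_zero(2)[OF B]
  show "X \<oplus>\<^bsub>TE\<^esub> Y \<in> carrier TE" by (rule c(1)[OF X Y])
  show "X \<oplus>\<^bsub>TE\<^esub> Y \<oplus>\<^bsub>TE\<^esub> Z = X \<oplus>\<^bsub>TE\<^esub> (Y \<oplus>\<^bsub>TE\<^esub> Z)"
    by (rule kap_eqI[OF B]) (simp_all add: X Y Z c k add.assoc)
  show "X \<oplus>\<^bsub>TE\<^esub> Y = Y \<oplus>\<^bsub>TE\<^esub> X"
    by (rule kap_eqI[OF B]) (simp_all add: X Y Z c k add.commute)
  show "\<zero>\<^bsub>TE\<^esub> \<oplus>\<^bsub>TE\<^esub> X = X"
    by (rule kap_eqI[OF B]) (simp_all add: X Y Z c k)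
  have "(\<lambda>i g. - kap I w X i g) \<in> I \<rightarrow> carrier S"
    using kap_closed[OF B X] by (auto simp: carrier_novikov_univ)
  from kap_surj[OF B this] obtain W where W: "W \<in> carrier TE" "\<forall>i\<in>I. kap I w W i = (\<lambda>g. - kap I w X i g)"
    by blast
  then show "\<exists>y\<in>carrier TE. y \<oplus>\<^bsub>TE\<^esub> X = \<zero>\<^bsub>TE\<^esub>"
    by (intro bexI[of _ W] kap_eqI[OF B]) (simp_all add: X W c k)
qed (rule kap_zero(1)[OF B])

end

section \<open>Independence of the unit ball from the orthogonal basis\<close>

context nonarch
begin

lemma lcomb_series:
  assumes "finite A" "f \<in> A \<rightarrow> carrier K" shows "(\<Oplus>\<^bsub>K\<^esub>i\<in>A. f i) = (\<lambda>g. \<Sum>i\<in>A. f i g)"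
  using assms
proof (induction A rule: finite_induct)
  case empty
  show ?case by (simp add: novikov_simps(2))
next
  case (insert i A)
  then have "(\<Oplus>\<^bsub>K\<^esub>i\<in>insert i A. f i) = f i \<oplus>\<^bsub>K\<^esub> (\<Oplus>\<^bsub>K\<^esub>i\<in>A. f i)"
    by (intro R.finsum_insert) auto
  then show ?case using insert by (simp add: novikov_simps)
qed

lemma sum_mult_series:
  assumes "\<And>i. i \<in> A \<Longrightarrow> f i \<in> carrier S" "s \<in> carrier S"
  shows "mult S (\<lambda>g. \<Sum>i\<in>A. f i g) s = (\<lambda>g. \<Sum>i\<in>A. mult S (f i) s g)"
  using assms(1)
proof (induction A rule: infinite_finite_induct)
  case (insert i A)
  then have "mult S (\<lambda>g. f i g + (\<Sum>i\<in>A. f i g)) s =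
      (\<lambda>g. mult S (f i) s g + mult S (\<lambda>g. \<Sum>i\<in>A. f i g) s g)"
    using assms(2) by (intro l_distr_series sum_closed_S) auto
  then show ?case using insert by simp
qed (simp_all add: mult_comm_series[of _ "\<lambda>g. 0"] mult_zero_series)

text \<open>On a symbol \<open>(x, s)\<close> this is the change of coordinates of \<open>x\<close>
  over \<open>K\<close>, multiplied by \<open>s\<close> in the universal field; both sides are
  additive in \<open>p\<close>.\<close>

lemma coh_basis_change:
  assumes B: "obasis I w" and B': "obasis I' w'" and j: "j \<in> I'" and p: "p \<in> carrier F"
  shows "coh I' w' j p = (\<lambda>g. \<Sum>i\<in>I. mult S (coord I' w' (w i) j) (coh I w i p) g)"
  using p
proof (induction p rule: F_induct)
  case zero
  show ?case by (simp add: coh_simps mult_zero_series)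
next
  case (diff p q)
  have "mult S (coord I' w' (w i) j) (coh I w i (p - q)) =
      (\<lambda>g. mult S (coord I' w' (w i) j) (coh I w i p) g - mult S (coord I' w' (w i) j) (coh I w i q) g)"
    if i: "i \<in> I" for i
    unfolding coh_simps
    by (rule mult_diff_series[OF coord_S[OF B' obasisD(3)[OF B i] j] coh_closed[OF B i diff.hyps(1)]
          coh_closed[OF B i diff.hyps(2)]])
  then have "(\<lambda>g. \<Sum>i\<in>I. mult S (coord I' w' (w i) j) (coh I w i (p - q)) g) =
      (\<lambda>g. (\<Sum>i\<in>I. mult S (coord I' w' (w i) j) (coh I w i p) g) -
        (\<Sum>i\<in>I. mult S (coord I' w' (w i) j) (coh I w i q) g))"
    by (simp add: sum_subtractf)
  then show ?case using diff.IH by (simp add: coh_simps(4))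
next
  case (gen x s)
  interpret S: cring S by (rule cring_novikov_univ)
  note b = obasisD(1-3)[OF B]
  let ?c = "coord I w x" and ?P = "\<lambda>i. coord I' w' (w i) j"
  have c: "?c \<in> I \<rightarrow> carrier K" by (rule coord_closed(1)[OF B gen(1)])
  have cK: "?c i \<in> carrier K" "?P i \<in> carrier K" if "i \<in> I" for i
    using coord_closed'[OF B gen(1) that] coord_closed'[OF B' b(3)[OF that] j] by blast+
  have "coord I' w' x j = (\<Oplus>\<^bsub>K\<^esub>i\<in>I. ?c i \<otimes>\<^bsub>K\<^esub> ?P i)"
    using coord_of_lcomb[OF B' j b(1,2) c] lcomb_coord[OF B gen(1)] by simp
  also have "\<dots> = (\<lambda>g. \<Sum>i\<in>I. mult K (?c i) (?P i) g)"
    by (rule lcomb_series[OF b(1)]) (use cK in auto)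
  also have "\<dots> = (\<lambda>g. \<Sum>i\<in>I. mult S (?c i) (?P i) g)"
    by (simp only: mult_novikov[of \<Gamma>])
  finally have "mult S (coord I' w' x j) s = (\<lambda>g. \<Sum>i\<in>I. mult S (mult S (?c i) (?P i)) s g)"
    using sum_mult_series[of I "\<lambda>i. mult S (?c i) (?P i)" s, OF S.m_closed[OF K_S[OF cK(1)] K_S[OF cK(2)]] gen(2)]
    by simp
  also have "\<dots> = (\<lambda>g. \<Sum>i\<in>I. mult S (?P i) (mult S (?c i) s) g)"
  proof (intro ext sum.cong refl)
    fix g i assume i: "i \<in> I"
    have "mult S (mult S (?c i) (?P i)) s = mult S (?P i) (mult S (?c i) s)"
      using K_S[OF cK(1)[OF i]] K_S[OF cK(2)[OF i]] gen(2) by (simp add: S.m_ac)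
    then show "mult S (mult S (?c i) (?P i)) s g = mult S (?P i) (mult S (?c i) s) g" by simp
  qed
  finally show ?case by simp
qed

lemma kap_basis_change:
  assumes B: "obasis I w" and B': "obasis I' w'" and j: "j \<in> I'" and X: "X \<in> carrier TE"
  shows "kap I' w' X j = (\<lambda>g. \<Sum>i\<in>I. mult S (coord I' w' (w i) j) (kap I w X i) g)"
proof -
  obtain p where p: "p \<in> carrier F" "X = cl p" using X unfolding TE_carrier by blast
  have "(\<lambda>g. \<Sum>i\<in>I. mult S (coord I' w' (w i) j) (kap I w X i) g) =
      (\<lambda>g. \<Sum>i\<in>I. mult S (coord I' w' (w i) j) (coh I w i p) g)"
    by (intro ext sum.cong refl) (simp add: p(2) kap_cl[OF B])
  then show ?thesis using coh_basis_change[OF B B' j p(1)] p(2) kap_cl[OF B' j] by simp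
qed

text \<open>The unit ball of the extended filtration, with the condition on each coordinate
  rearranged so that no difference of extended reals occurs.\<close>

definition ball :: "'i set \<Rightarrow> ('i \<Rightarrow> 'c) \<Rightarrow> ('c \<times> 'k series \<Rightarrow>\<^sub>0 int) set set" where
  "ball I w = {X \<in> carrier TE. \<forall>i\<in>I. l (w i) \<le> nu (kap I w X i)}"

text \<open>Orthogonality of \<open>w'\<close> bounds each transition coefficient by
  \<open>l (w' j) - nu (?P i) \<le> l (w i)\<close>. With the ball condition at \<open>i\<close> it
  follows that every term of the new coordinate, hence their sum, starts no earlier than
  \<open>l (w' j)\<close>.\<close>

lemma ball_subset:
  assumes B: "obasis I w" and B': "obasis I' w'" shows "ball I w \<subseteq> ball I' w'"
proof
  fix X assume "X \<in> ball I w"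
  then have X: "X \<in> carrier TE" and le: "\<And>i. i \<in> I \<Longrightarrow> l (w i) \<le> nu (kap I w X i)"
    by (auto simp: ball_def)
  have "l (w' j) \<le> nu (kap I' w' X j)" if j: "j \<in> I'" for j
  proof -
    let ?P = "\<lambda>i. coord I' w' (w i) j"
    obtain r where r: "l (w' j) = ereal r" using l_real[OF obasisD(3,4)[OF B']] j by blast
    have "mult S (?P i) (kap I w X i) g = 0" if i: "i \<in> I" and g: "g < r" for i g
    proof (cases "?P i = \<zero>\<^bsub>K\<^esub>")
      case True
      then show ?thesis
        by (simp add: novikov_simps mult_comm_series[of UNIV "\<lambda>x. 0"] mult_zero_series)
    next
      case False
      have P: "?P i \<in> carrier K" by (rule coord_closed'[OF B' obasisD(3)[OF B i] j])
      obtain a where a: "nu (?P i) = ereal a" using nu_novikov_real[OF P False] .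
      obtain s where s: "l (w i) = ereal s" using l_real[OF obasisD(3,4)[OF B]] i by blast
      have "l (?P i \<odot>\<^bsub>C\<^esub> w' j) \<le> l (w i)" by (rule l_coord_le[OF B' obasisD(3)[OF B i] j])
      then have "r - a \<le> s" using l_smult[OF P obasisD(3)[OF B' j]] r a s by simp
      moreover have "ereal (a + s) \<le> nu (mult S (?P i) (kap I w X i))"
        by (rule nu_mult_ge) (use a s le[OF i] in auto)
      ultimately show ?thesis using g by (simp add: ereal_le_nu_iff)
    qed
    then show ?thesis
      unfolding r ereal_le_nu_iff kap_basis_change[OF B B' j X] by simp
  qed
  then show "X \<in> ball I' w'" using X by (simp add: ball_def)
qed

lemma ball_independent: "obasis I w \<Longrightarrow> obasis I' w' \<Longrightarrow> ball I w = ball I' w'"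
  by (intro subset_antisym ball_subset)

lemma kap_lincomb:
  assumes B: "obasis I w" and j: "j \<in> I" and "finite A" "c \<in> A \<rightarrow> carrier S" "t \<in> A \<rightarrow> carrier TE"
  shows "(\<Oplus>\<^bsub>TE\<^esub>a\<in>A. c a \<odot>\<^bsub>TE\<^esub> t a) \<in> carrier TE \<and>
    kap I w (\<Oplus>\<^bsub>TE\<^esub>a\<in>A. c a \<odot>\<^bsub>TE\<^esub> t a) j = (\<lambda>g. \<Sum>a\<in>A. mult S (c a) (kap I w (t a) j) g)"
proof -
  interpret TE: abelian_group TE by (rule abelian_group_TE[OF B])
  show ?thesis using assms(3-5)
  proof (induction A rule: finite_induct)
    case empty
    show ?case using kap_zero[OF B] j by simp
  next
    case (insert a A)
    have a: "c a \<in> carrier S" "t a \<in> carrier TE" and A: "c \<in> A \<rightarrow> carrier S" "t \<in> A \<rightarrow> carrier TE"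
      using insert.prems by auto
    have "(\<Oplus>\<^bsub>TE\<^esub>a\<in>insert a A. c a \<odot>\<^bsub>TE\<^esub> t a) = c a \<odot>\<^bsub>TE\<^esub> t a \<oplus>\<^bsub>TE\<^esub> (\<Oplus>\<^bsub>TE\<^esub>a\<in>A. c a \<odot>\<^bsub>TE\<^esub> t a)"
      by (rule TE.finsum_insert) (use insert.hyps a A kap_smult(1)[OF B] in \<open>auto simp: Pi_iff\<close>)
    then show ?case
      using insert.IH[OF A] insert.hyps kap_smult[OF B a] kap_add[OF B kap_smult(1)[OF B a]] j by simp
  qed
qed

lemma obasis_orthogonal_basis:
  assumes O: "orthogonal_basis \<Gamma> C l ws"
  shows "obasis {..<length ws} ((!) ws)"
proof -
  have dist: "distinct ws" and bas: "basis (set ws)" and ol: "orthogonal_list \<Gamma> C l ws"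
    using O by (auto simp: orthogonal_basis_def)
  have wsC: "set ws \<subseteq> carrier C" and li: "lin_indpt (set ws)" and gen: "span (set ws) = carrier C"
    using bas by (auto simp: basis_def)
  have set_ws: "set ws = (!) ws ` {..<length ws}" by (auto simp: in_set_conv_nth)
  have inj: "inj_on ((!) ws) {..<length ws}" using dist by (auto simp: inj_on_def nth_eq_iff_index_eq)
  have w: "(!) ws \<in> {..<length ws} \<rightarrow> carrier C" using wsC by auto
  have "\<exists>c\<in>{..<length ws} \<rightarrow> carrier K. x = lcomb {..<length ws} ((!) ws) c" if "x \<in> carrier C" for x
  proof -
    have "x \<in> span (set ws)" using that by (simp only: gen)
    then have "\<exists>a. a \<in> set ws \<rightarrow> carrier K \<and> lincomb a (set ws) = x"
      by (rule finite_in_span[OF finite_set wsC])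
    then obtain a where a: "a \<in> set ws \<rightarrow> carrier K" "lincomb a (set ws) = x"
      by (elim exE conjE)
    have "lincomb a (set ws) = (\<Oplus>\<^bsub>C\<^esub>i\<in>{..<length ws}. a (ws ! i) \<odot>\<^bsub>C\<^esub> ws ! i)"
      unfolding lincomb_def set_ws
      by (rule M.finsum_reindex[OF _ inj]) (use a(1) wsC in \<open>auto simp: Pi_iff set_ws\<close>)
    then have "x = lcomb {..<length ws} ((!) ws) (\<lambda>i. a (ws ! i))" using a(2) by (simp add: lcomb_def)
    moreover have "(\<lambda>i. a (ws ! i)) \<in> {..<length ws} \<rightarrow> carrier K" using a(1) by (auto simp: Pi_iff)
    ultimately show ?thesis by blast
  qed
  moreover have "ws ! i \<noteq> \<zero>\<^bsub>C\<^esub>" if "i < length ws" for i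
    using vs_zero_lin_dep[OF wsC li] nth_mem[OF that] by auto
  ultimately show ?thesis
    using ol w unfolding obasis_def orthogonal_list_def lcomb_def by auto
qed

text \<open>Coefficients with respect to the vectors \<open>w\<^sub>i \<otimes> 1\<close> exist and
  must be the coordinates \<open>kap\<close>, so the definite description has exactly one
  candidate.\<close>

lemma extended_filtration_eq:
  assumes O: "orthogonal_basis \<Gamma> C l ws" and X: "X \<in> carrier TE"
  shows "extended_filtration \<Gamma> C l ws X =
    (SUP i\<in>{..<length ws}. l (ws ! i) - nu (kap {..<length ws} ((!) ws) X i))"
proof -
  interpret S: cring S by (rule cring_novikov_univ)
  let ?I = "{..<length ws}" and ?w = "(!) ws"
  let ?t = "\<lambda>i. cl (frag_of (ws ! i, \<one>\<^bsub>S\<^esub>))"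
  note B = obasis_orthogonal_basis[OF O]
  have w: "?w i \<in> carrier C" if "i \<in> ?I" for i using obasisD(3)[OF B that] .
  have t: "?t \<in> ?I \<rightarrow> carrier TE"
    using frag_of_F[OF w S.one_closed] by (auto simp: TE_carrier simp del: F_simps)
  have kt: "kap ?I ?w (?t i) j = (if i = j then \<one>\<^bsub>S\<^esub> else \<zero>\<^bsub>S\<^esub>)" if "i \<in> ?I" "j \<in> ?I" for i j
  proof -
    have "\<one>\<^bsub>K\<^esub> = \<one>\<^bsub>S\<^esub>" "\<zero>\<^bsub>K\<^esub> = \<zero>\<^bsub>S\<^esub>" by (simp_all add: novikov_simps)
    then have "coord ?I ?w (?w i) j = (if i = j then \<one>\<^bsub>S\<^esub> else \<zero>\<^bsub>S\<^esub>)"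
      using coord_basis[OF B that(2,1)] by auto
    then show ?thesis by (simp only: kap_cl[OF B that(2)] coh_gen) simp
  qed
  have lin: "(\<Oplus>\<^bsub>TE\<^esub>i\<in>?I. c i \<odot>\<^bsub>TE\<^esub> ?t i) \<in> carrier TE \<and>
      (\<forall>j\<in>?I. kap ?I ?w (\<Oplus>\<^bsub>TE\<^esub>i\<in>?I. c i \<odot>\<^bsub>TE\<^esub> ?t i) j = c j)" if c: "c \<in> ?I \<rightarrow> carrier S" for c
  proof
    interpret TE: abelian_group TE by (rule abelian_group_TE[OF B])
    show "(\<Oplus>\<^bsub>TE\<^esub>i\<in>?I. c i \<odot>\<^bsub>TE\<^esub> ?t i) \<in> carrier TE"
      by (rule TE.finsum_closed) (use c t kap_smult(1)[OF B] in \<open>auto simp: Pi_iff\<close>)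
    show "\<forall>j\<in>?I. kap ?I ?w (\<Oplus>\<^bsub>TE\<^esub>i\<in>?I. c i \<odot>\<^bsub>TE\<^esub> ?t i) j = c j"
    proof
      fix j assume j: "j \<in> ?I"
      have ci: "c i \<in> carrier S" if "i \<in> ?I" for i using c that by (rule Pi_mem)
      have "kap ?I ?w (\<Oplus>\<^bsub>TE\<^esub>i\<in>?I. c i \<odot>\<^bsub>TE\<^esub> ?t i) j =
          (\<lambda>g. \<Sum>i\<in>?I. mult S (c i) (kap ?I ?w (?t i) j) g)"
        using kap_lincomb[OF B j _ c t] by simp
      also have "\<dots> = c j"
      proof
        fix g
        have "(\<Sum>i\<in>?I. mult S (c i) (kap ?I ?w (?t i) j) g) = (\<Sum>i\<in>?I. if i = j then c j g else 0)"
        proof (rule sum.cong[OF refl])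
          fix i assume i: "i \<in> ?I"
          show "mult S (c i) (kap ?I ?w (?t i) j) g = (if i = j then c j g else 0)"
            unfolding kt[OF i j] using S.r_one[OF ci[OF i]] S.r_null[OF ci[OF i]]
            by (auto simp: novikov_simps)
        qed
        then show "(\<Sum>i\<in>?I. mult S (c i) (kap ?I ?w (?t i) j) g) = c j g" using j by simp
      qed
      finally show "kap ?I ?w (\<Oplus>\<^bsub>TE\<^esub>i\<in>?I. c i \<odot>\<^bsub>TE\<^esub> ?t i) j = c j" .
    qed
  qed
  have iff: "X = (\<Oplus>\<^bsub>TE\<^esub>i\<in>?I. c i \<odot>\<^bsub>TE\<^esub> ?t i) \<longleftrightarrow> (\<forall>j\<in>?I. kap ?I ?w X j = c j)"
    if c: "c \<in> ?I \<rightarrow> carrier S" for c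
  proof
    assume "\<forall>j\<in>?I. kap ?I ?w X j = c j"
    then show "X = (\<Oplus>\<^bsub>TE\<^esub>i\<in>?I. c i \<odot>\<^bsub>TE\<^esub> ?t i)"
      using lin[OF c] X by (intro kap_eqI[OF B]) auto
  qed (use lin[OF c] in auto)
  have kX: "kap ?I ?w X \<in> ?I \<rightarrow> carrier S" using kap_closed[OF B X] by auto
  show ?thesis
    unfolding extended_filtration_def
  proof (rule the_equality)
    show "\<exists>c\<in>?I \<rightarrow> carrier S. X = (\<Oplus>\<^bsub>TE\<^esub>i\<in>?I. c i \<odot>\<^bsub>TE\<^esub> ?t i) \<and>
        (SUP i\<in>?I. l (ws ! i) - nu (kap ?I ?w X i)) = (SUP i\<in>?I. l (ws ! i) - nu (c i))"
      using iff[OF kX] kX by blast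
  next
    fix v assume "\<exists>c\<in>?I \<rightarrow> carrier S. X = (\<Oplus>\<^bsub>TE\<^esub>i\<in>?I. c i \<odot>\<^bsub>TE\<^esub> ?t i) \<and>
        v = (SUP i\<in>?I. l (ws ! i) - nu (c i))"
    then obtain c where c: "c \<in> ?I \<rightarrow> carrier S" "X = (\<Oplus>\<^bsub>TE\<^esub>i\<in>?I. c i \<odot>\<^bsub>TE\<^esub> ?t i)"
      "v = (SUP i\<in>?I. l (ws ! i) - nu (c i))" by blast
    have "\<forall>j\<in>?I. kap ?I ?w X j = c j" using iff[OF c(1)] c(2) by blast
    then show "v = (SUP i\<in>?I. l (ws ! i) - nu (kap ?I ?w X i))"
      unfolding c(3) by (intro SUP_cong refl) simp
  qed
qed

text \<open>The ball is defined from a given list, while the quotient is computed in a reduced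
  basis; this passes from one to the other.\<close>

lemma extended_ball_carrier:
  assumes O: "orthogonal_basis \<Gamma> C l ws" and B': "obasis I w"
  shows "{X \<in> carrier TE. extended_filtration \<Gamma> C l ws X \<le> 0} = ball I w"
proof -
  note B = obasis_orthogonal_basis[OF O]
  have "extended_filtration \<Gamma> C l ws X \<le> 0 \<longleftrightarrow>
      (\<forall>i\<in>{..<length ws}. l (ws ! i) \<le> nu (kap {..<length ws} ((!) ws) X i))" if X: "X \<in> carrier TE" for X
    unfolding extended_filtration_eq[OF O X] SUP_le_iff
  proof (rule ball_cong[OF refl])
    fix i assume i: "i \<in> {..<length ws}"
    obtain r where "l (ws ! i) = ereal r" using l_real[OF obasisD(3,4)[OF B i]] i by blast
    then show "l (ws ! i) - nu (kap {..<length ws} ((!) ws) X i) \<le> 0 \<longleftrightarrow>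
        l (ws ! i) \<le> nu (kap {..<length ws} ((!) ws) X i)"
      by (cases "nu (kap {..<length ws} ((!) ws) X i)") (auto simp: zero_ereal_def)
  qed
  then have "{X \<in> carrier TE. extended_filtration \<Gamma> C l ws X \<le> 0} = ball {..<length ws} ((!) ws)"
    unfolding ball_def by blast
  then show ?thesis using ball_independent[OF B B'] by simp
qed

end

section \<open>The torsion quotient in the reduced bases\<close>

context floer_svd
begin

text \<open>The extended map applies \<open>d\<close> to first components of symbols, so it copies
  coordinates just as \<open>d\<close> does in \<open>coord_d\<close>. This also shows that all
  representatives yield one coset, so the union in \<open>extend_map\<close> collapses.\<close>

lemma extend_map_kap:
  assumes X: "X \<in> carrier C1.TE"
  shows "extend_map K C0.S C0 d X \<in> carrier C0.TE"
    and "i \<in> D \<Longrightarrow> C0.kap J v (extend_map K C0.S C0 d X) (\<sigma> i) = C1.kap I w X i"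
    and "j \<in> J \<Longrightarrow> j \<notin> \<sigma> ` D \<Longrightarrow> C0.kap J v (extend_map K C0.S C0 d X) j = (\<lambda>g. 0)"
proof -
  obtain p where p: "p \<in> carrier C1.F" "X = C1.cl p" using X unfolding C1.TE_carrier by blast
  let ?f = "frag_extend (\<lambda>(x, t). frag_of (d x, t))"
  have lift: "C0.coh J v j (?f q) = frag_lift (\<lambda>(x, t). mult C0.S (C0.coord J v (d x) j) t) q" for q j
  proof -
    have "?f q = frag_extend (\<lambda>z. frag_of (case z of (x, t) \<Rightarrow> (d x, t))) q"
      by (simp add: case_prod_unfold)
    then show ?thesis by (simp add: C0.coh_def frag_lift_extend case_prod_unfold)
  qed
  have fF: "?f q \<in> carrier C0.F" if "q \<in> carrier C1.F" for q
    using that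
  proof (induction q rule: C1.F_induct)
    case (diff p q)
    then show ?case by (simp add: frag_extend_diff C0.F_diff del: C0.F_simps)
  qed (simp_all add: d_closed)
  have coh1: "C0.coh J v (\<sigma> i) (?f q) = C1.coh I w i q" if q: "q \<in> carrier C1.F" and i: "i \<in> D" for q i
    unfolding lift C1.coh_def
  proof (rule frag_lift_cong)
    fix z assume z: "z \<in> Poly_Mapping.keys q"
    obtain x t where xt: "z = (x, t)" by (cases z)
    then have "x \<in> carrier C1" using z q by auto
    then have "C0.coord J v (d x) (\<sigma> i) = C1.coord I w x i"
      by (rule coord_d(1)[OF _ D_mem(2)[OF i] i refl])
    then show "(case z of (x, t) \<Rightarrow> mult C0.S (C0.coord J v (d x) (\<sigma> i)) t) =
        (case z of (x, t) \<Rightarrow> mult C1.S (C1.coord I w x i) t)" by (simp add: xt)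
  qed
  have coh0: "C0.coh J v j (?f q) = (\<lambda>g. 0)"
    if q: "q \<in> carrier C1.F" and j: "j \<in> J" "j \<notin> \<sigma> ` D" for q j
  proof -
    have "C0.coh J v j (?f q) = frag_lift (\<lambda>z g. 0) q"
      unfolding lift
    proof (rule frag_lift_cong)
      fix z assume z: "z \<in> Poly_Mapping.keys q"
      obtain x t where xt: "z = (x, t)" by (cases z)
      then have "x \<in> carrier C1" using z q by auto
      then have "C0.coord J v (d x) j = (\<lambda>g. 0)"
        using coord_d(2)[OF _ j] by (simp add: novikov_simps)
      then show "(case z of (x, t) \<Rightarrow> mult C0.S (C0.coord J v (d x) j) t) = (\<lambda>g. 0)"
        by (simp add: xt mult_comm_series[of UNIV "\<lambda>g. 0"] mult_zero_series)
    qed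
    then show ?thesis by (simp add: frag_lift_def)
  qed
  have same: "C0.cl (?f q) = C0.cl (?f p)" if q: "q \<in> C1.cl p" for q
  proof (subst C0.cl_eq_iff_coh[OF B0 fF[OF C1.cl_F[OF p(1) q]] fF[OF p(1)]], rule ballI)
    fix j assume j: "j \<in> J"
    show "C0.coh J v j (?f q) = C0.coh J v j (?f p)"
    proof (cases "j \<in> \<sigma> ` D")
      case True
      then obtain i where i: "i \<in> D" "j = \<sigma> i" by blast
      then show ?thesis
        using coh1[OF C1.cl_F[OF p(1) q] i(1)] coh1[OF p(1) i(1)]
          C1.coh_mem_cl[OF B1 D_mem(1)[OF i(1)] q] by simp
    next
      case False
      then show ?thesis using coh0[OF C1.cl_F[OF p(1) q] j] coh0[OF p(1) j] by simp
    qed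
  qed
  then have "(\<Union>q\<in>C1.cl p. C0.cl (?f q)) = (\<Union>q\<in>C1.cl p. C0.cl (?f p))" by (intro SUP_cong refl)
  also have "\<dots> = C0.cl (?f p)" using C1.cl_self by auto
  finally have ext: "extend_map K C0.S C0 d X = C0.cl (?f p)" by (simp add: extend_map_def p(2))
  show "extend_map K C0.S C0 d X \<in> carrier C0.TE"
    unfolding ext C0.TE_carrier by (rule imageI) (rule fF[OF p(1)])
  show "i \<in> D \<Longrightarrow> C0.kap J v (extend_map K C0.S C0 d X) (\<sigma> i) = C1.kap I w X i"
    unfolding ext by (simp add: C0.kap_cl[OF B0 D_mem(2)] coh1[OF p(1)] p(2) C1.kap_cl[OF B1 D_mem(1)])
  show "j \<in> J \<Longrightarrow> j \<notin> \<sigma> ` D \<Longrightarrow> C0.kap J v (extend_map K C0.S C0 d X) j = (\<lambda>g. 0)"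
    unfolding ext by (simp add: C0.kap_cl[OF B0] coh0[OF p(1)])
qed

text \<open>A preimage has prescribed coordinates at the indices in \<open>D\<close>; at all others
  0 may be chosen, which satisfies any ball condition.\<close>

lemma extend_map_ball:
  "extend_map K C0.S C0 d ` C1.ball I w = {Y \<in> carrier C0.TE.
     (\<forall>i\<in>D. l1 (w i) \<le> nu (C0.kap J v Y (\<sigma> i))) \<and> (\<forall>j\<in>J - \<sigma> ` D. C0.kap J v Y j = (\<lambda>g. 0))}"
    (is "?e ` _ = ?R")
proof
  show "?e ` C1.ball I w \<subseteq> ?R"
    using extend_map_kap D_mem(1) by (auto simp: C1.ball_def)
  show "?R \<subseteq> ?e ` C1.ball I w"
  proof
    fix Y assume "Y \<in> ?R"
    then have Y: "Y \<in> carrier C0.TE" and le: "\<And>i. i \<in> D \<Longrightarrow> l1 (w i) \<le> nu (C0.kap J v Y (\<sigma> i))"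
      and z: "\<And>j. j \<in> J - \<sigma> ` D \<Longrightarrow> C0.kap J v Y j = (\<lambda>g. 0)" by auto
    let ?c = "\<lambda>i. if i \<in> D then C0.kap J v Y (\<sigma> i) else (\<lambda>g. 0)"
    have "?c \<in> I \<rightarrow> carrier C1.S"
      using C0.kap_closed[OF B0 Y D_mem(2)] zero_closed_series by auto
    from C1.kap_surj[OF B1 this] obtain X where X: "X \<in> carrier C1.TE" "\<forall>i\<in>I. C1.kap I w X i = ?c i"
      by blast
    have "X \<in> C1.ball I w" using X le by (auto simp: C1.ball_def)
    moreover have "Y = ?e X"
    proof (rule C0.kap_eqI[OF B0 Y extend_map_kap(1)[OF X(1)]])
      fix j assume j: "j \<in> J"
      show "C0.kap J v Y j = C0.kap J v (?e X) j"
      proof (cases "j \<in> \<sigma> ` D")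
        case True
        then obtain i where i: "i \<in> D" "j = \<sigma> i" by blast
        then show ?thesis using extend_map_kap(2)[OF X(1) i(1)] X(2) D_mem(1)[OF i(1)] by simp
      next
        case False
        then show ?thesis using extend_map_kap(3)[OF X(1) j] z j by simp
      qed
    qed
    ultimately show "Y \<in> ?e ` C1.ball I w" by (rule image_eqI[rotated])
  qed
qed

text \<open>A basis vector of the target that is not hit contributes a free summand, hence
  \<open>\<infinity>\<close>; a hit one is cut off at the gap of its unique source index.\<close>

definition exponent :: "'j \<Rightarrow> ereal" where
  "exponent j = (if j \<in> \<sigma> ` D then ereal (gap (inv_into D \<sigma> j)) else \<infinity>)"

lemma exponent_D: "i \<in> D \<Longrightarrow> exponent (\<sigma> i) = ereal (gap i)"
  using inj by (simp add: exponent_def)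

text \<open>Scaled by T to the power \<open>l0 (v j)\<close>, the vector \<open>v j\<close> has
  level 0, and its multiples by the valuation ring fill its part of the ball. In these coordinates
  the image of the source ball asks for valuation at least
  \<open>l1 (w i) - l0 (v (\<sigma> i))\<close>, which is the gap.\<close>

lemma presents_torsion_quotient:
  assumes O1: "orthogonal_basis \<Gamma> C1 l1 ws1" and O0: "orthogonal_basis \<Gamma> C0 l0 ws0"
  shows "\<exists>F. presents (torsion_quotient \<Gamma> C1 l1 ws1 C0 l0 ws0 d) J exponent F"
proof -
  let ?T = "C0.TE" and ?k = "C0.kap J v" and ?R = "carrier novikov_univ0 :: 'k series set"
  define G where "G = extended_ball \<Gamma> C0 l0 ws0"
  have G_simps [simp]: "add G = add ?T" "zero G = zero ?T" "smult G = smult ?T"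
    "carrier G = C0.ball J v"
    unfolding G_def extended_ball_def C0.extended_ball_carrier[OF O0 B0] by simp_all
  define NN where "NN = extend_map K C0.S C0 d ` C1.ball I w"
  have tq: "torsion_quotient \<Gamma> C1 l1 ws1 C0 l0 ws0 d = quot_module G NN"
    unfolding torsion_quotient_def G_def NN_def extended_ball_def
    using C1.extended_ball_carrier[OF O1 B1] by simp
  have NN: "Y \<in> NN \<longleftrightarrow> Y \<in> carrier ?T \<and> (\<forall>i\<in>D. l1 (w i) \<le> nu (?k Y (\<sigma> i))) \<and>
      (\<forall>j\<in>J - \<sigma> ` D. ?k Y j = (\<lambda>g. 0))" for Y
    unfolding NN_def extend_map_ball by simp
  define lv where "lv j = real_of_ereal (l0 (v j))" for j
  have lv: "l0 (v j) = ereal (lv j)" if j: "j \<in> J" for j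
  proof -
    obtain r where "l0 (v j) = ereal r" using C0.l_real[OF C0.obasisD(3,4)[OF B0]] j by blast
    then show ?thesis by (simp add: lv_def)
  qed
  have lw: "l1 (w i) = ereal (lv (\<sigma> i) + gap i)" if "i \<in> D" for i
    using l1_eq_gap[OF that] lv[OF D_mem(2)[OF that]] by simp
  have ball_iff: "X \<in> C0.ball J v \<longleftrightarrow> X \<in> carrier ?T \<and> (\<forall>j\<in>J. \<forall>x<lv j. ?k X j x = 0)" for X
    using lv by (auto simp: C0.ball_def ereal_le_nu_iff)
  have NNI: "Y \<in> NN \<longleftrightarrow> Y \<in> carrier ?T \<and> (\<forall>i\<in>D. \<forall>x<lv (\<sigma> i) + gap i. ?k Y (\<sigma> i) x = 0) \<and>
      (\<forall>j\<in>J - \<sigma> ` D. \<forall>x. ?k Y j x = 0)" for Y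
    unfolding NN using lw by (auto simp: ereal_le_nu_iff fun_eq_iff)
  have NN_ball: "Y \<in> C0.ball J v" if "Y \<in> NN" for Y
    unfolding ball_iff
  proof (intro conjI ballI allI impI)
    show "Y \<in> carrier ?T" using that by (simp add: NNI)
    fix j x assume j: "j \<in> J" and x: "x < lv j"
    show "?k Y j x = 0"
    proof (cases "j \<in> \<sigma> ` D")
      case True
      then obtain i where i: "i \<in> D" "j = \<sigma> i" by blast
      then show ?thesis using that x gap_nonneg[OF i(1)] by (simp add: NNI)
    next
      case False
      then show ?thesis using that j by (simp add: NNI)
    qed
  qed
  note kadd = C0.kap_add[OF B0] and kzero = C0.kap_zero[OF B0] and ksm = C0.kap_smult[OF B0]
  interpret T: abelian_group ?T by (rule C0.abelian_group_TE[OF B0])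
  have kinv: "?k (\<ominus>\<^bsub>?T\<^esub> X) j = (\<lambda>g. - ?k X j g)" if X: "X \<in> carrier ?T" and j: "j \<in> J" for X j
  proof -
    have "(\<lambda>g. ?k (\<ominus>\<^bsub>?T\<^esub> X) j g + ?k X j g) = (\<lambda>g. 0)"
      using kadd(2)[OF T.a_inv_closed[OF X] X j] kzero(2)[OF j] T.l_neg[OF X] by simp
    then show ?thesis by (simp add: fun_eq_iff eq_neg_iff_add_eq_0)
  qed
  have bT: "X \<in> carrier ?T" if "X \<in> C0.ball J v" for X using that by (simp add: ball_iff)
  have b_add: "X \<oplus>\<^bsub>?T\<^esub> Y \<in> C0.ball J v" if "X \<in> C0.ball J v" "Y \<in> C0.ball J v" for X Y
    using that kadd[of X Y] by (simp add: ball_iff)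
  have b_zero: "\<zero>\<^bsub>?T\<^esub> \<in> C0.ball J v" using kzero by (simp add: ball_iff)
  have b_inv: "\<ominus>\<^bsub>?T\<^esub> X \<in> C0.ball J v" if "X \<in> C0.ball J v" for X
    using that kinv[of X] by (simp add: ball_iff)
  have G: "abelian_group G"
  proof (rule abelian_groupI)
    fix X assume X: "X \<in> carrier G"
    then show "\<exists>Y\<in>carrier G. Y \<oplus>\<^bsub>G\<^esub> X = \<zero>\<^bsub>G\<^esub>"
      by (intro bexI[of _ "\<ominus>\<^bsub>?T\<^esub> X"]) (simp_all add: b_inv bT T.l_neg)
  next
    fix X Y assume "X \<in> carrier G" "Y \<in> carrier G"
    then show "X \<oplus>\<^bsub>G\<^esub> Y = Y \<oplus>\<^bsub>G\<^esub> X" using T.a_comm[of X Y] by (simp add: bT)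
  qed (simp_all add: b_add b_zero bT T.a_assoc)
  interpret G: abelian_group G by (rule G)
  have Ginv: "\<ominus>\<^bsub>G\<^esub> X = \<ominus>\<^bsub>?T\<^esub> X" if "X \<in> C0.ball J v" for X
    by (rule G.minus_equality) (use that in \<open>simp_all add: b_inv bT T.l_neg\<close>)
  have N: "subgroup NN (add_monoid G)"
  proof (rule G.add_subgroupI)
    show "NN \<subseteq> carrier G" using NN_ball by auto
    show "\<zero>\<^bsub>G\<^esub> \<in> NN" using kzero D_mem(2) by (simp add: NNI)
    show "X \<oplus>\<^bsub>G\<^esub> Y \<in> NN" if "X \<in> NN" "Y \<in> NN" for X Y
      using that kadd[of X Y] D_mem(2) by (simp add: NNI)
    show "\<ominus>\<^bsub>G\<^esub> X \<in> NN" if "X \<in> NN" for X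
      using that kinv[of X] D_mem(2) by (simp add: Ginv[OF NN_ball[OF that]] NNI)
  qed
  have low: "\<forall>x<a. mult novikov_univ r f x = 0" if "r \<in> ?R" "\<forall>x<a. f x = 0" for r f and a :: real
    using nu_mult_ge[of 0 r a f UNIV] that by (simp add: ereal_le_nu_iff carrier_novikov_univ0)
  have RS: "r \<in> carrier C0.S" if "r \<in> ?R" for r using that by (rule univ0_subset)
  have b_sm: "r \<odot>\<^bsub>?T\<^esub> X \<in> C0.ball J v" if r: "r \<in> ?R" and X: "X \<in> C0.ball J v" for r X
    unfolding ball_iff
  proof (intro conjI ballI)
    show "r \<odot>\<^bsub>?T\<^esub> X \<in> carrier ?T" by (rule ksm(1)[OF RS[OF r] bT[OF X]])
    fix j assume j: "j \<in> J"
    show "\<forall>x<lv j. ?k (r \<odot>\<^bsub>?T\<^esub> X) j x = 0"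
      unfolding ksm(2)[OF RS[OF r] bT[OF X] j] by (rule low[OF r]) (use X j in \<open>simp add: ball_iff\<close>)
  qed
  have N_sm: "r \<odot>\<^bsub>?T\<^esub> X \<in> NN" if r: "r \<in> ?R" and X: "X \<in> NN" for r X
    unfolding NNI
  proof (intro conjI ballI)
    have XT: "X \<in> carrier ?T" using X by (simp add: NNI)
    show "r \<odot>\<^bsub>?T\<^esub> X \<in> carrier ?T" by (rule ksm(1)[OF RS[OF r] XT])
    show "\<forall>x<lv (\<sigma> i) + gap i. ?k (r \<odot>\<^bsub>?T\<^esub> X) (\<sigma> i) x = 0" if i: "i \<in> D" for i
      unfolding ksm(2)[OF RS[OF r] XT D_mem(2)[OF i]]
      by (rule low[OF r]) (use X i in \<open>simp add: NNI\<close>)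
    show "\<forall>x. ?k (r \<odot>\<^bsub>?T\<^esub> X) j x = 0" if j: "j \<in> J - \<sigma> ` D" for j
    proof -
      have "?k X j = (\<lambda>x. 0)" using X j unfolding NN by blast
      then show ?thesis using ksm(2)[OF RS[OF r] XT, of j] j by (simp add: mult_zero_series)
    qed
  qed
  \<comment> \<open>Shifting coordinate \<open>j\<close> by \<open>lv j\<close> is multiplication by
    that power of T, which the universal field contains for every real level.\<close>
  define E where "E c = (SOME X. X \<in> carrier ?T \<and> (\<forall>j\<in>J. ?k X j = (\<lambda>x. c j (x - lv j))))" for c
  have E: "E c \<in> carrier ?T" "\<And>j. j \<in> J \<Longrightarrow> ?k (E c) j = (\<lambda>x. c j (x - lv j))" if c: "c \<in> J \<rightarrow> ?R" for c
  proof -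
    have "(\<lambda>j x. c j (x - lv j)) \<in> J \<rightarrow> carrier C0.S"
      using c by (auto simp only: Pi_iff intro!: shift_closed[OF RS])
    from C0.kap_surj[OF B0 this]
    have "\<exists>X. X \<in> carrier ?T \<and> (\<forall>j\<in>J. ?k X j = (\<lambda>x. c j (x - lv j)))" by blast
    from someI_ex[OF this] show "E c \<in> carrier ?T" "\<And>j. j \<in> J \<Longrightarrow> ?k (E c) j = (\<lambda>x. c j (x - lv j))"
      unfolding E_def by blast+
  qed
  have Eball: "E c \<in> C0.ball J v" if c: "c \<in> J \<rightarrow> ?R" for c
    using E[OF c] c by (auto simp: ball_iff Pi_iff carrier_novikov_univ0)
  have "presents (quot_module G NN) J exponent (\<lambda>c. NN +>\<^bsub>G\<^esub> E c)"
  proof (rule presents_quotient[OF G N])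
    fix r X assume r: "r \<in> ?R"
    { assume "X \<in> carrier G"
      then show "r \<odot>\<^bsub>G\<^esub> X \<in> carrier G"
        using b_sm[OF r] by simp }
    { assume "X \<in> NN"
      then show "r \<odot>\<^bsub>G\<^esub> X \<in> NN"
        using N_sm[OF r] by simp }
    fix Y assume "X \<in> carrier G" "Y \<in> carrier G"
    then have XY: "X \<in> carrier ?T" "Y \<in> carrier ?T" by (simp_all add: bT)
    interpret S: cring C0.S by (rule cring_novikov_univ)
    have "r \<odot>\<^bsub>?T\<^esub> (X \<oplus>\<^bsub>?T\<^esub> Y) = r \<odot>\<^bsub>?T\<^esub> X \<oplus>\<^bsub>?T\<^esub> r \<odot>\<^bsub>?T\<^esub> Y"
    proof (rule C0.kap_eqI[OF B0])
      fix j assume j: "j \<in> J"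
      have "mult C0.S r (\<lambda>g. ?k X j g + ?k Y j g) = (\<lambda>g. mult C0.S r (?k X j) g + mult C0.S r (?k Y j) g)"
        using S.r_distr[OF C0.kap_closed[OF B0 XY(1) j] C0.kap_closed[OF B0 XY(2) j] RS[OF r]]
        by (simp add: novikov_simps)
      then show "?k (r \<odot>\<^bsub>?T\<^esub> (X \<oplus>\<^bsub>?T\<^esub> Y)) j = ?k (r \<odot>\<^bsub>?T\<^esub> X \<oplus>\<^bsub>?T\<^esub> r \<odot>\<^bsub>?T\<^esub> Y) j"
        using j XY ksm[OF RS[OF r]] kadd by simp
    qed (use XY ksm[OF RS[OF r]] kadd in simp_all)
    then show "r \<odot>\<^bsub>G\<^esub> (X \<oplus>\<^bsub>G\<^esub> Y) = r \<odot>\<^bsub>G\<^esub> X \<oplus>\<^bsub>G\<^esub> r \<odot>\<^bsub>G\<^esub> Y" by simp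
  next
    show "E ` (J \<rightarrow> ?R) = carrier G"
    proof
      show "E ` (J \<rightarrow> ?R) \<subseteq> carrier G" using Eball by auto
      show "carrier G \<subseteq> E ` (J \<rightarrow> ?R)"
      proof
        fix X assume "X \<in> carrier G"
        then have X: "X \<in> carrier ?T" "\<And>j x. j \<in> J \<Longrightarrow> x < lv j \<Longrightarrow> ?k X j x = 0" by (auto simp: ball_iff)
        \<comment> \<open>Shifting back undoes \<open>E\<close>, and the ball condition says exactly
          that the result has no negative exponents.\<close>
        define c where "c j = (\<lambda>x. ?k X j (x - (- lv j)))" for j
        have c: "c \<in> J \<rightarrow> ?R"
        proof (rule Pi_I)
          fix j assume j: "j \<in> J"
          show "c j \<in> ?R"
            using shift_closed[OF C0.kap_closed[OF B0 X(1) j], of "- lv j"] X(2)[OF j]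
            by (simp add: c_def carrier_novikov_univ0)
        qed
        have "X = E c" by (rule C0.kap_eqI[OF B0 X(1) E(1)[OF c]]) (simp add: E(2)[OF c] c_def)
        then show "X \<in> E ` (J \<rightarrow> ?R)" using c by (rule image_eqI)
      qed
    qed
  next
    fix c c' assume c: "c \<in> J \<rightarrow> ?R" and c': "c' \<in> J \<rightarrow> ?R"
    have cc: "(\<lambda>i x. c i x + c' i x) \<in> J \<rightarrow> ?R" using c c' by (auto intro!: add_closed_univ0)
    have "E (\<lambda>i x. c i x + c' i x) = E c \<oplus>\<^bsub>?T\<^esub> E c'"
      by (rule C0.kap_eqI[OF B0 E(1)[OF cc]]) (simp_all add: E[OF cc] E[OF c] E[OF c'] kadd)
    then show "E (\<lambda>i x. c i x + c' i x) = E c \<oplus>\<^bsub>G\<^esub> E c'" by simp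
    let ?Y = "E c \<ominus>\<^bsub>G\<^esub> E c'"
    have Yeq: "?Y = E c \<oplus>\<^bsub>?T\<^esub> \<ominus>\<^bsub>?T\<^esub> E c'" by (simp add: a_minus_def Ginv[OF Eball[OF c']])
    have Y: "?Y \<in> carrier ?T" unfolding Yeq by (intro kadd(1) T.a_inv_closed E(1) c c')
    have kY: "?k ?Y j = (\<lambda>x. c j (x - lv j) - c' j (x - lv j))" if j: "j \<in> J" for j
      unfolding Yeq using E[OF c] E[OF c'] kadd(2)[OF _ _ j] kinv[OF _ j] j by simp
    \<comment> \<open>Membership in \<open>NN\<close> concerns the shifted series; shifting back
      removes the level of \<open>v j\<close> and leaves the bare gap as threshold.\<close>
    have shift: "(\<forall>x<a + lv j. c j (x - lv j) - c' j (x - lv j) = 0) \<longleftrightarrow> (\<forall>x<a. c j x - c' j x = 0)" for a j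
    proof (intro iffI allI impI)
      fix x assume "\<forall>x<a + lv j. c j (x - lv j) - c' j (x - lv j) = 0" "x < a"
      then show "c j x - c' j x = 0" by (elim allE[of _ "x + lv j"]) simp
    qed simp
    have shift': "(\<forall>x. c j (x - lv j) - c' j (x - lv j) = 0) \<longleftrightarrow> (\<forall>x. c j x - c' j x = 0)" for j
    proof (intro iffI allI)
      fix x assume "\<forall>x. c j (x - lv j) - c' j (x - lv j) = 0"
      then show "c j x - c' j x = 0" by (elim allE[of _ "x + lv j"]) simp
    qed simp
    have inf: "\<infinity> \<le> nu (\<lambda>x. c j x - c' j x) \<longleftrightarrow> (\<forall>x. c j x - c' j x = 0)" for j
    proof
      assume A: "\<infinity> \<le> nu (\<lambda>x. c j x - c' j x)"
      show "\<forall>x. c j x - c' j x = 0"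
      proof
        fix x
        have "ereal (x + 1) \<le> nu (\<lambda>x. c j x - c' j x)" by (rule order_trans[OF _ A]) simp
        then show "c j x - c' j x = 0" unfolding ereal_le_nu_iff by simp
      qed
    next
      assume "\<forall>x. c j x - c' j x = 0"
      then have "(\<lambda>x. c j x - c' j x) = (\<lambda>x. 0)" by simp
      then show "\<infinity> \<le> nu (\<lambda>x. c j x - c' j x)" by simp
    qed
    have "?Y \<in> NN \<longleftrightarrow> (\<forall>i\<in>D. \<forall>x<gap i + lv (\<sigma> i). ?k ?Y (\<sigma> i) x = 0) \<and> (\<forall>j\<in>J - \<sigma> ` D. \<forall>x. ?k ?Y j x = 0)"
      using Y by (simp add: NNI add.commute)
    also have "\<dots> \<longleftrightarrow> (\<forall>i\<in>D. exponent (\<sigma> i) \<le> nu (\<lambda>x. c (\<sigma> i) x - c' (\<sigma> i) x)) \<and>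
        (\<forall>j\<in>J - \<sigma> ` D. exponent j \<le> nu (\<lambda>x. c j x - c' j x))"
    proof (intro conj_cong ball_cong refl)
      fix i assume i: "i \<in> D"
      show "(\<forall>x<gap i + lv (\<sigma> i). ?k ?Y (\<sigma> i) x = 0) \<longleftrightarrow> exponent (\<sigma> i) \<le> nu (\<lambda>x. c (\<sigma> i) x - c' (\<sigma> i) x)"
        unfolding kY[OF D_mem(2)[OF i]] shift exponent_D[OF i] ereal_le_nu_iff ..
    next
      fix j assume j: "j \<in> J - \<sigma> ` D"
      then have "j \<in> J" "exponent j = \<infinity>" by (auto simp: exponent_def)
      then show "(\<forall>x. ?k ?Y j x = 0) \<longleftrightarrow> exponent j \<le> nu (\<lambda>x. c j x - c' j x)"
        by (simp only: kY[OF \<open>j \<in> J\<close>] shift' inf)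
    qed
    also have "\<dots> \<longleftrightarrow> (\<forall>j\<in>J. exponent j \<le> nu (\<lambda>x. c j x - c' j x))" using sJ by blast
    finally show "?Y \<in> NN \<longleftrightarrow> (\<forall>j\<in>J. exponent j \<le> nu (\<lambda>x. c j x - c' j x))" .
  next
    fix r c assume r: "r \<in> ?R" and c: "c \<in> J \<rightarrow> ?R"
    interpret S: cring C0.S by (rule cring_novikov_univ)
    have rc: "(\<lambda>i. mult novikov_univ r (c i)) \<in> J \<rightarrow> ?R" using r c by (auto intro!: mult_closed_univ0)
    have "E (\<lambda>i. mult novikov_univ r (c i)) = r \<odot>\<^bsub>?T\<^esub> E c"
    proof (rule C0.kap_eqI[OF B0 E(1)[OF rc] ksm(1)[OF RS[OF r] E(1)[OF c]]])
      fix j assume j: "j \<in> J"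
      have cj: "c j \<in> carrier C0.S" using c j by (auto intro: RS)
      \<comment> \<open>Scalars commute with the shift because the shift is itself a
        multiplication.\<close>
      have "mult C0.S (T_power (lv j)) (mult C0.S r (c j)) = mult C0.S r (mult C0.S (T_power (lv j)) (c j))"
        using S.m_lcomm[OF T_power_closed RS[OF r] cj] .
      then have "(\<lambda>x. mult C0.S r (c j) (x - lv j)) = mult C0.S r (\<lambda>x. c j (x - lv j))"
        by (simp only: T_power_mult)
      then show "?k (E (\<lambda>i. mult novikov_univ r (c i))) j = ?k (r \<odot>\<^bsub>?T\<^esub> E c) j"
        using E(2)[OF rc j] E[OF c] ksm(2)[OF RS[OF r] _ j] j by simp
    qed
    then show "E (\<lambda>i. mult novikov_univ r (c i)) = r \<odot>\<^bsub>G\<^esub> E c" by simp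
  qed
  then show ?thesis unfolding tq by blast
qed

text \<open>Target vectors that are not hit give the free summands, positive gaps give the torsion
  summands, and zero gaps give nothing. Since the exponents are unique, the definite description
  picks out this decomposition.\<close>

lemma torsion_exponent_eq:
  assumes O1: "orthogonal_basis \<Gamma> C1 l1 ws1" and O0: "orthogonal_basis \<Gamma> C0 l0 ws0"
    and k: "k > 0" and ds: "distinct ds" "set ds = D" "sorted_wrt (\<lambda>i j. gap i \<ge> gap j) ds"
  shows "torsion_exponent \<Gamma> C1 l1 ws1 C0 l0 ws0 d k = (if k \<le> length ds then gap (ds ! (k - 1)) else 0)"
proof -
  let ?M = "torsion_quotient \<Gamma> C1 l1 ws1 C0 l0 ws0 d"
  define fs where "fs = filter (\<lambda>i. gap i > 0) ds"
  define ls where "ls = map gap fs"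
  obtain es where es: "distinct es" "set es = J - \<sigma> ` D"
    using finite_distinct_list[of "J - \<sigma> ` D"] C0.obasisD(1)[OF B0] by auto
  define q where "q = length es"
  \<comment> \<open>Vectors that are not hit come first, so that the enumeration follows the index
    convention of \<open>standard_module\<close>.\<close>
  let ?xs = "es @ map \<sigma> fs" and ?lam = "\<lambda>i. if i < q then \<infinity> else ereal (ls ! (i - q))"
  have fsD: "set fs \<subseteq> D" using ds(2) by (auto simp: fs_def)
  have "inj_on \<sigma> (set fs)" using inj fsD by (rule inj_on_subset)
  then have dist: "distinct ?xs"
    using es ds(1) fsD by (auto simp: distinct_map fs_def)
  have "set ?xs = {j \<in> J. exponent j > 0}"
  proof (intro subset_antisym subsetI)
    fix j assume "j \<in> set ?xs"
    then consider "j \<in> J - \<sigma> ` D" | i where "i \<in> D" "gap i > 0" "j = \<sigma> i"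
      using es(2) ds(2) by (auto simp: fs_def)
    then show "j \<in> {j \<in> J. exponent j > 0}"
    proof cases
      case 1
      then show ?thesis by (simp add: exponent_def)
    next
      case 2
      then show ?thesis using D_mem(2) exponent_D by simp
    qed
  next
    fix j assume j: "j \<in> {j \<in> J. exponent j > 0}"
    show "j \<in> set ?xs"
    proof (cases "j \<in> \<sigma> ` D")
      case True
      then obtain i where i: "i \<in> D" "j = \<sigma> i" by blast
      then have "i \<in> set fs" using j ds(2) by (simp add: fs_def exponent_D)
      then show ?thesis using i by simp
    next
      case False
      then show ?thesis using j es(2) by simp
    qed
  qed
  then have bij: "bij_betw ((!) ?xs) {..<q + length ls} {j \<in> J. exponent j > 0}"
    using bij_betw_nth[OF dist] by (simp add: q_def ls_def)
  obtain F where F: "presents ?M J exponent F" using presents_torsion_quotient[OF O1 O0] by blast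
  obtain F' where F': "presents ?M {..<q + length ls} (exponent \<circ> (!) ?xs) F'"
    using presents_reindex[OF F bij] by blast
  have lam: "(exponent \<circ> (!) ?xs) i = ?lam i" if i: "i \<in> {..<q + length ls}" for i
  proof (cases "i < q")
    case True
    then have "?xs ! i = es ! i" by (simp add: q_def nth_append)
    moreover have "es ! i \<in> set es" using True by (simp add: q_def)
    ultimately show ?thesis using True es(2) by (simp add: exponent_def)
  next
    case False
    then have len: "i - q < length fs" using i by (auto simp: ls_def)
    then have "?xs ! i = \<sigma> (fs ! (i - q))" using False by (simp add: q_def nth_append)
    moreover have "fs ! (i - q) \<in> D" using fsD nth_mem[OF len] by blast
    ultimately show ?thesis using False len by (simp add: exponent_D ls_def)
  qed
  have P: "presents ?M {..<q + length ls} ?lam F'"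
    using F' lam by (rule presents_cong)
  have ls_pos: "\<forall>x\<in>set ls. x > 0" by (simp add: ls_def fs_def)
  have sorted_map: "sorted_wrt (\<ge>) (map gap ds)" using ds(3) by (simp add: sorted_wrt_map)
  then have sorted: "sorted_wrt (\<ge>) ls"
    unfolding ls_def fs_def by (simp add: sorted_wrt_map sorted_wrt_filter)
  obtain H where "presents (standard_module q ls :: ('k series, _) module) {..<q + length ls} ?lam H"
    using presents_standard_module[of ls q] ls_pos less_imp_le by blast
  then have iso: "module_isomorphic novikov_univ0 ?M (standard_module q ls)"
    by (rule presents_isomorphic[OF P])
  have "torsion_exponent \<Gamma> C1 l1 ws1 C0 l0 ws0 d k = (if k \<le> length ls then ls ! (k - 1) else 0)"
    unfolding torsion_exponent_def
  proof (rule the_equality)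
    show "\<exists>q ls'. sorted_wrt (\<ge>) ls' \<and> (\<forall>x\<in>set ls'. x > 0) \<and>
        module_isomorphic novikov_univ0 ?M (standard_module q ls') \<and>
        (if k \<le> length ls then ls ! (k - 1) else 0) = (if k \<le> length ls' then ls' ! (k - 1) else 0)"
      using sorted ls_pos iso by blast
  next
    fix e assume "\<exists>q ls'. sorted_wrt (\<ge>) ls' \<and> (\<forall>x\<in>set ls'. x > 0) \<and>
        module_isomorphic novikov_univ0 ?M (standard_module q ls') \<and>
        e = (if k \<le> length ls' then ls' ! (k - 1) else 0)"
    then obtain q' ls' where ls': "sorted_wrt (\<ge>) ls'" "\<forall>x\<in>set ls'. x > 0"
      "module_isomorphic novikov_univ0 ?M (standard_module q' ls')"
      "e = (if k \<le> length ls' then ls' ! (k - 1) else 0)" by blast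
    show "e = (if k \<le> length ls then ls ! (k - 1) else 0)"
      unfolding ls'(4)
      by (rule sorted_desc_nth_cong[OF ls'(1) _ sorted _ k])
        (use ls'(2) ls_pos exponents_unique[OF P ls'(3,2)] in \<open>auto intro: less_imp_le\<close>)
  qed
  \<comment> \<open>Restoring the zero gaps does not change the \<open>k\<close>-th entry: they are
    the smallest ones, and a removed 0 was represented by the default 0.\<close>
  also have "\<dots> = (if k \<le> length (map gap ds) then map gap ds ! (k - 1) else 0)"
  proof (rule sorted_desc_nth_cong[OF sorted _ sorted_map _ k])
    show "\<forall>x\<in>set ls. x \<ge> 0" using ls_pos by (auto intro: less_imp_le)
    show "\<forall>x\<in>set (map gap ds). x \<ge> 0" using gap_nonneg ds(2) by auto
    fix a :: real assume "a \<ge> 0"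
    then have "filter (\<lambda>i. gap i > a) fs = filter (\<lambda>i. gap i > a) ds"
      unfolding fs_def filter_filter by (intro filter_cong) auto
    then show "length (filter (\<lambda>x. x > a) ls) = length (filter (\<lambda>x. x > a) (map gap ds))"
      by (simp add: ls_def filter_map o_def)
  qed
  also have "\<dots> = (if k \<le> length ds then gap (ds ! (k - 1)) else 0)" using k by auto
  finally show ?thesis .
qed

end

lemma nonarch_of_normed_space: "nonarch_normed_space \<Gamma> C l \<Longrightarrow> nonarch \<Gamma> C l"
  unfolding nonarch_normed_space_def nonarch_def nonarch_axioms_def by blast

theorem theorem4p13:
  fixes \<Gamma> :: "real set"
    and C1 :: "('k::field series, 'a) module" and l1 :: "'a \<Rightarrow> ereal" and ws1 :: "'a list"
    and C0 :: "('k series, 'b) module" and l0 :: "'b \<Rightarrow> ereal" and ws0 :: "'b list"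
    and d :: "'a \<Rightarrow> 'b" and k :: nat
  assumes "subgroup \<Gamma> \<lparr>carrier = UNIV, monoid.mult = (+), one = (0::real)\<rparr>"
    and "two_term_floer_complex \<Gamma> C1 l1 C0 l0 d"
    and "orthogonal_basis \<Gamma> C1 l1 ws1"
    and "orthogonal_basis \<Gamma> C0 l0 ws0"
    and "k > 0"
  shows "ereal (torsion_exponent \<Gamma> C1 l1 ws1 C0 l0 ws0 d k) = boundary_depth \<Gamma> C1 l1 C0 l0 d k"
proof -
  have c: "nonarch_normed_space \<Gamma> C1 l1" "nonarch_normed_space \<Gamma> C0 l0" "linear_map (novikov \<Gamma>) C1 C0 d"
    "\<forall>x\<in>carrier C1. l0 (d x) \<le> l1 x" and fd: "vectorspace.fin_dim (novikov \<Gamma>) C0"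
    using assms(2) by (auto simp: two_term_floer_complex_def orthogonalizable_space_def)
  interpret floer \<Gamma> C1 l1 C0 l0 d
    by (intro floer.intro nonarch_of_normed_space c floer_axioms.intro) (use c(4) in blast)
  let ?I = "{..<length ws1}" and ?J = "{..<length ws0}"
  \<comment> \<open>Elimination starts from the given bases with no index processed, so
    \<open>\<sigma>\<close> may be arbitrary.\<close>
  have "partial_svd ?I ((!) ws1) ?J ((!) ws0) {} (\<lambda>_. 0)"
    unfolding partial_svd_def
    using C1.obasis_orthogonal_basis[OF assms(3)] C0.obasis_orthogonal_basis[OF assms(4)] by simp
  from svd_exists[OF this] obtain w v D \<sigma>
    where P: "partial_svd ?I w ?J v D \<sigma>" and z: "\<forall>i\<in>?I - D. d (w i) = \<zero>\<^bsub>C0\<^esub>" by blast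
  interpret floer_svd \<Gamma> C1 l1 C0 l0 d ?I w ?J v D \<sigma>
    by unfold_locales (use P z in \<open>auto simp: partial_svd_def\<close>)
  have "finite D" using D by (rule finite_subset) simp
  then obtain ds where ds: "distinct ds" "set ds = D" "sorted_wrt (\<lambda>i j. gap i \<ge> gap j) ds"
  proof -
    obtain xs where xs: "set xs = D" "distinct xs" using finite_distinct_list[OF \<open>finite D\<close>] by blast
    have "sorted (map (\<lambda>i. - gap i) (sort_key (\<lambda>i. - gap i) xs))" by simp
    then have "sorted_wrt (\<lambda>i j. gap i \<ge> gap j) (sort_key (\<lambda>i. - gap i) xs)"
      by (simp add: sorted_map)
    then show ?thesis using xs by (intro that[of "sort_key (\<lambda>i. - gap i) xs"]) auto
  qed
  \<comment> \<open>Both invariants have been evaluated to the \<open>k\<close>-th largest gap,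
    padded by 0, for one and the same reduction.\<close>
  show ?thesis
    unfolding torsion_exponent_eq[OF assms(3,4,5) ds] boundary_depth_eq[OF fd assms(5) ds] ..
qed

end
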